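(* Let $\boldsymbol{X}=\boldsymbol{V}_h\times Q_h$, $\zeta=\sqrt{\lambda+2\mu/d}$, and let $H_{\boldsymbol{u}}:\boldsymbol{V}_h'\to\boldsymbol{V}_h$ and $H_p:Q_h'\to Q_h$ be symmetric positive definite operators. Let $$\mathcal{A}=\begin{pmatrix}A_{\boldsymbol{u}}&\alpha B^T\\-\alpha B&\tau A_p+\eta h^2L_p\end{pmatrix},\quad \mathcal{M}_L=\begin{pmatrix}H_{\boldsymbol{u}}^{-1}&0\\-\alpha B&H_p^{-1}\end{pmatrix}^{-1},\quad \mathcal{M}_D=\begin{pmatrix}H_{\boldsymbol{u}}&0\\0&H_p\end{pmatrix}.$$ Suppose that there are positive constants $c_{1,\boldsymbol{u}},c_{2,\boldsymbol{u}},c_{1,p},c_{2,p}$ such that $$c_{1,\boldsymbol{u}}(H_{\boldsymbol{u}}\boldsymbol{u},\boldsymbol{u})\le(A_{\boldsymbol{u}}^{-1}\boldsymbol{u},\boldsymbol{u})\le c_{2,\boldsymbol{u}}(H_{\boldsymbol{u}}\boldsymbol{u},\boldsymbol{u})\quad\text{for all }\boldsymbol{u}\in\boldsymbol{V}_h',$$ $$c_{1,p}(H_pp,p)\le\Big(\big(\tau A_p+\eta h^2L_p+\tfrac{\alpha^2}{\zeta^2}M\big)^{-1}p,p\Big)\le c_{2,p}(H_pp,p)\quad\text{for all }p\in Q_h',$$ that $\|I-H_{\boldsymbol{u}}A_{\boldsymbol{u}}\|_{A_{\boldsymbol{u}}}\le\rho$ with $0\le\rho<1$, and that $\eta=\delta\frac{\alpha^2}{\zeta^2}$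 with $\delta>0$. Then there exist positive constants $\Sigma$ and $\Upsilon$, independent of discretization or physical parameters, such that, for any $\boldsymbol{x}=(\boldsymbol{u},p)^T\in\boldsymbol{X}$ with $\boldsymbol{x}\ne\boldsymbol{0}$, $$\Sigma\le\frac{(\mathcal{M}_L\mathcal{A}\boldsymbol{x},\boldsymbol{x})_{(\mathcal{M}_D)^{-1}}}{(\boldsymbol{x},\boldsymbol{x})_{(\mathcal{M}_D)^{-1}}},\qquad \frac{\|\mathcal{M}_L\mathcal{A}\boldsymbol{x}\|_{(\mathcal{M}_D)^{-1}}}{\|\boldsymbol{x}\|_{(\mathcal{M}_D)^{-1}}}\le\Upsilon.$$
   Context: Setting. $\Omega\subset\mathbb{R}^d$, $d\in\{2,3\}$, is a bounded open set with regular boundary. Physical parameters: Lamé coefficients $\lambda\ge 0$, $\mu>0$; Biot–Willis constant $\alpha>0$; hydraulic conductivity $K>0$. Discretization parameters: mesh size $h>0$, time step size $\tau>0$. $(\cdot,\cdot)$ and $\|\cdot\|$ are the $L^2(\Omega)$ inner product and norm (also used for the duality pairing between a finite-dimensional space and its dual), $\|\cdot\|_1$ is the $H^1(\Omega)$ norm, and $\varepsilon(\boldsymbol{u})=\frac12(\nabla\boldsymbol{u}+\nabla\boldsymbol{u}^t)$. Bilinear forms: $a(\boldsymbol{u},\boldsymbol{v})=2\mu\int_\Omega\varepsilon(\boldsymbol{u}):\varepsilon(\boldsymbol{v})+\lambda\int_\Omega\operatorname{div}\boldsymbol{u}\,\operatorname{div}\boldsymbol{v}$ and $a_p(p,q)=\int_\Omega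 K\nabla p\cdot\nabla q$. Finite-element spaces: $\boldsymbol{V}_h\subset\boldsymbol{H}^1_0(\Omega)=H_0^1(\Omega)^d$ and $Q_h\subset H^1_0(\Omega)$ are the finite-element spaces for displacement and pressure given by the $\mathbb{P}_1$-$\mathbb{P}_1$ pair or the Mini element on a mesh of size $h$. The pair is taken to satisfy the weak inf-sup condition $$\sup_{0\ne\boldsymbol{v}\in\boldsymbol{V}_h}\frac{(\operatorname{div}\boldsymbol{v},q)}{\|\boldsymbol{v}\|_1}\ge\gamma_B^0\|q\|-\xi^0h\|\nabla q\|\qquad\text{for all }q\in Q_h,$$ with constants $\gamma_B^0>0$, $\xi^0\ge0$ that do not depend on $h$ ($\xi^0=0$ for the Mini element). Discrete operators: $A_{\boldsymbol{u}}:\boldsymbol{V}_h\to\boldsymbol{V}_h'$, $B:\boldsymbol{V}_h\to Q_h'$, $A_p,L_p,M:Q_h\to Q_h'$ are defined by $(A_{\boldsymbol{u}}\boldsymbol{u},\boldsymbol{v})=a(\boldsymbol{u},\boldsymbol{v})$, $(B\boldsymbol{u},q)=-(\operatorname{div}\boldsymbol{u},q)$, $(A_pp,q)=a_p(p,q)$, $(L_pp,q)=(\nabla p,\nabla q)$, $(Mp,q)=\int_\Omega pq$ (pressure mass operator); $B^T:Q_h\to\boldsymbol{V}_h'$ is the adjoint of $B$. Here $\mathcal{A}:\boldsymbol{X}\to\boldsymbol{X}'$ is the operator of the stabilized discrete Biot system with its second equation negated, and $\eta$ is the stabilization parameter. $\|\cdot\|_{A_{\boldsymbol{u}}}$ is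 the norm $\|\boldsymbol{v}\|_{A_{\boldsymbol{u}}}^2=a(\boldsymbol{v},\boldsymbol{v})$ on $\boldsymbol{V}_h$ and also the induced operator norm. For symmetric positive definite $\mathcal{N}:\boldsymbol{X}'\to\boldsymbol{X}$, $(\boldsymbol{x},\boldsymbol{y})_{\mathcal{N}^{-1}}=\langle\mathcal{N}^{-1}\boldsymbol{x},\boldsymbol{y}\rangle$ and $\|\boldsymbol{x}\|_{\mathcal{N}^{-1}}^2=(\boldsymbol{x},\boldsymbol{x})_{\mathcal{N}^{-1}}$ on $\boldsymbol{X}$. "Independent of discretization or physical parameters" means independent of $\lambda,\mu,K,\alpha,h,\tau$; the constants may depend on $d,\gamma_B^0,\xi^0,\delta,\rho,c_{1,\boldsymbol{u}},c_{2,\boldsymbol{u}},c_{1,p},c_{2,p}$. *)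

theory Defs
  imports "HOL-Analysis.Analysis"
begin

section \<open>Lebesgue and Sobolev spaces\<close>

definition L2 :: "(real^'n) set \<Rightarrow> (real^'n \<Rightarrow> 'b::euclidean_space) \<Rightarrow> bool" where
  "L2 \<Omega> f \<longleftrightarrow> set_borel_measurable lborel \<Omega> f \<and>
     set_integrable lborel \<Omega> (\<lambda>x. (norm (f x))\<^sup>2)"

text \<open>On matrix fields the inner product of the library is the Frobenius product, so that
  one definition covers scalar, vector and tensor fields.\<close>

definition L2_inner :: "(real^'n) set \<Rightarrow> (real^'n \<Rightarrow> 'b::euclidean_space) \<Rightarrow> (real^'n \<Rightarrow> 'b) \<Rightarrow> real" where
  "L2_inner \<Omega> f g = (LINT x:\<Omega>|lborel. f x \<bullet> g x)"

definition L2_norm :: "(real^'n) set \<Rightarrow> (real^'n \<Rightarrow> 'b::euclidean_space) \<Rightarrow> real" where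
  "L2_norm \<Omega> f = sqrt (L2_inner \<Omega> f f)"

definition partial :: "'n \<Rightarrow> (real^'n \<Rightarrow> real) \<Rightarrow> real^'n \<Rightarrow> real" where
  "partial i f x = frechet_derivative f (at x) (axis i 1)"

primrec C_k :: "nat \<Rightarrow> (real^'n \<Rightarrow> real) \<Rightarrow> bool" where
  "C_k 0 f \<longleftrightarrow> continuous_on UNIV f"
| "C_k (Suc k) f \<longleftrightarrow> (\<forall>x. f differentiable (at x)) \<and> (\<forall>i. C_k k (partial i f))"

definition test_functions :: "(real^'n) set \<Rightarrow> (real^'n \<Rightarrow> real) set" where
  "test_functions \<Omega> = {\<phi>. (\<forall>k. C_k k \<phi>) \<and> (\<exists>S. compact S \<and> S \<subseteq> \<Omega> \<and> (\<forall>x. x \<notin> S \<longrightarrow> \<phi> x = 0))}"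

definition has_weak_grad :: "(real^'n) set \<Rightarrow> (real^'n \<Rightarrow> real) \<Rightarrow> (real^'n \<Rightarrow> real^'n) \<Rightarrow> bool" where
  "has_weak_grad \<Omega> u g \<longleftrightarrow> L2 \<Omega> g \<and>
     (\<forall>\<phi>\<in>test_functions \<Omega>. \<forall>i.
        (LINT x:\<Omega>|lborel. u x * partial i \<phi> x) = - (LINT x:\<Omega>|lborel. g x $ i * \<phi> x))"

definition H1 :: "(real^'n) set \<Rightarrow> (real^'n \<Rightarrow> real) set" where
  "H1 \<Omega> = {u. L2 \<Omega> u \<and> (\<exists>g. has_weak_grad \<Omega> u g)}"

text \<open>The weak gradient is determined only almost everywhere in \<open>\<Omega>\<close>; an arbitrary
  representative is chosen, and it is used only under integrals over \<open>\<Omega>\<close>.\<close>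

definition weak_grad :: "(real^'n) set \<Rightarrow> (real^'n \<Rightarrow> real) \<Rightarrow> real^'n \<Rightarrow> real^'n" where
  "weak_grad \<Omega> u = (SOME g. has_weak_grad \<Omega> u g)"

definition H1_norm :: "(real^'n) set \<Rightarrow> (real^'n \<Rightarrow> real) \<Rightarrow> real" where
  "H1_norm \<Omega> u = sqrt ((L2_norm \<Omega> u)\<^sup>2 + (L2_norm \<Omega> (weak_grad \<Omega> u))\<^sup>2)"

definition H10 :: "(real^'n) set \<Rightarrow> (real^'n \<Rightarrow> real) set" where
  "H10 \<Omega> = {u \<in> H1 \<Omega>. \<exists>\<phi>. (\<forall>k::nat. \<phi> k \<in> test_functions \<Omega>) \<and>
     (\<lambda>k. H1_norm \<Omega> (\<lambda>x. u x - \<phi> k x)) \<longlonglongrightarrow> 0}"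

definition H10_vec :: "(real^'n) set \<Rightarrow> (real^'n \<Rightarrow> real^'n) set" where
  "H10_vec \<Omega> = {v. \<forall>i. (\<lambda>x. v x $ i) \<in> H10 \<Omega>}"

text \<open>Row \<open>i\<close> of the Jacobian is the gradient of the component \<open>i\<close>.\<close>

definition jac :: "(real^'n) set \<Rightarrow> (real^'n \<Rightarrow> real^'n) \<Rightarrow> real^'n \<Rightarrow> real^'n^'n" where
  "jac \<Omega> v x = (\<chi> i. weak_grad \<Omega> (\<lambda>y. v y $ i) x)"

definition sym_grad :: "(real^'n) set \<Rightarrow> (real^'n \<Rightarrow> real^'n) \<Rightarrow> real^'n \<Rightarrow> real^'n^'n" where
  "sym_grad \<Omega> v x = (1/2) *\<^sub>R (jac \<Omega> v x + transpose (jac \<Omega> v x))"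

definition dvg :: "(real^'n) set \<Rightarrow> (real^'n \<Rightarrow> real^'n) \<Rightarrow> real^'n \<Rightarrow> real" where
  "dvg \<Omega> v x = trace (jac \<Omega> v x)"

definition H1_norm_vec :: "(real^'n) set \<Rightarrow> (real^'n \<Rightarrow> real^'n) \<Rightarrow> real" where
  "H1_norm_vec \<Omega> v = sqrt ((L2_norm \<Omega> v)\<^sup>2 + (L2_norm \<Omega> (jac \<Omega> v))\<^sup>2)"


section \<open>Domains, meshes and finite elements\<close>

text \<open>Regularity of the boundary is read as the Lipschitz property: near each boundary point the
  domain is the part below the graph, in some unit direction \<open>e\<close>, of a Lipschitz function of
  the coordinates orthogonal to \<open>e\<close>.\<close>

definition lipschitz_boundary :: "(real^'n) set \<Rightarrow> bool" where
  "lipschitz_boundary \<Omega> \<longleftrightarrow>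
     (\<forall>x\<in>frontier \<Omega>. \<exists>r>0. \<exists>e L g. norm e = 1 \<and> L-lipschitz_on {z. z \<bullet> e = 0} g \<and>
        \<Omega> \<inter> ball x r = {y \<in> ball x r. y \<bullet> e < g (y - (y \<bullet> e) *\<^sub>R e)})"

text \<open>The mesh may cover \<open>closure \<Omega>\<close> exactly (polyhedral domains) or be inscribed in it (curved
  boundaries); finite-element functions are extended by zero outside the mesh.\<close>

definition mesh :: "(real^'n) set \<Rightarrow> real \<Rightarrow> (real^'n) set set \<Rightarrow> bool" where
  "mesh \<Omega> h \<T> \<longleftrightarrow> triangulation \<T> \<and> \<T> \<noteq> {} \<and> (\<forall>T\<in>\<T>. int CARD('n) simplex T) \<and>
     \<Union>\<T> \<subseteq> closure \<Omega> \<and> h = Max (diameter ` \<T>)"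

definition P1 :: "(real^'n) set set \<Rightarrow> (real^'n \<Rightarrow> real) set" where
  "P1 \<T> = {q. continuous_on UNIV q \<and> (\<forall>T\<in>\<T>. \<exists>a b. \<forall>x\<in>T. q x = a \<bullet> x + b) \<and>
     (\<forall>x. x \<notin> \<Union>\<T> \<longrightarrow> q x = 0)}"

definition P1_vec :: "(real^'n) set set \<Rightarrow> (real^'n \<Rightarrow> real^'n) set" where
  "P1_vec \<T> = {v. \<forall>i. (\<lambda>x. v x $ i) \<in> P1 \<T>}"

definition vertices :: "(real^'n) set \<Rightarrow> (real^'n) set" where
  "vertices T = {w. w extreme_point_of T}"

definition barycentric :: "(real^'n) set \<Rightarrow> real^'n \<Rightarrow> real^'n \<Rightarrow> real" where
  "barycentric T x = (THE c. (\<forall>w. w \<notin> vertices T \<longrightarrow> c w = 0) \<and> (\<Sum>w\<in>vertices T. c w) = 1 \<and>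
     (\<Sum>w\<in>vertices T. c w *\<^sub>R w) = x)"

definition bubble :: "(real^'n) set \<Rightarrow> real^'n \<Rightarrow> real" where
  "bubble T x = (if x \<in> T then \<Prod>w\<in>vertices T. barycentric T x w else 0)"

datatype fe_pair = P1_P1 | Mini

primrec disp_space :: "fe_pair \<Rightarrow> (real^'n) set \<Rightarrow> (real^'n) set set \<Rightarrow> (real^'n \<Rightarrow> real^'n) set" where
  "disp_space P1_P1 \<Omega> \<T> = P1_vec \<T> \<inter> H10_vec \<Omega>"
| "disp_space Mini \<Omega> \<T> =
     {\<lambda>x. w x + (\<Sum>T\<in>\<T>. bubble T x *\<^sub>R c T) | w c. w \<in> P1_vec \<T>} \<inter> H10_vec \<Omega>"

definition pres_space :: "(real^'n) set \<Rightarrow> (real^'n) set set \<Rightarrow> (real^'n \<Rightarrow> real) set" where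
  "pres_space \<Omega> \<T> = P1 \<T> \<inter> H10 \<Omega>"

text \<open>The supremum is taken in the extended reals, so that no boundedness or nonemptiness is
  presupposed.\<close>

definition weak_inf_sup ::
    "(real^'n) set \<Rightarrow> (real^'n \<Rightarrow> real^'n) set \<Rightarrow> (real^'n \<Rightarrow> real) set \<Rightarrow> real \<Rightarrow> real \<Rightarrow> real \<Rightarrow> bool" where
  "weak_inf_sup \<Omega> V Q h \<gamma> \<xi> \<longleftrightarrow>
     (\<forall>q\<in>Q. (SUP v\<in>V - {\<lambda>_. 0}. ereal (L2_inner \<Omega> (dvg \<Omega> v) q / H1_norm_vec \<Omega> v))
        \<ge> ereal (\<gamma> * L2_norm \<Omega> q - \<xi> * h * L2_norm \<Omega> (weak_grad \<Omega> q)))"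


section \<open>Duals and operators\<close>

text \<open>Finite-element spaces are sets of functions with pointwise operations. Functionals on such a
  space \<open>S\<close> are made \<open>undefined\<close> outside \<open>S\<close>, so that equality in the dual is
  equality on \<open>S\<close>.\<close>

definition dual :: "('a \<Rightarrow> 'b::real_vector) set \<Rightarrow> (('a \<Rightarrow> 'b) \<Rightarrow> real) set" where
  "dual S = {f \<in> extensional S.
     (\<forall>u\<in>S. \<forall>v\<in>S. f (\<lambda>x. u x + v x) = f u + f v) \<and>
     (\<forall>c. \<forall>v\<in>S. f (\<lambda>x. c *\<^sub>R v x) = c * f v)}"

definition spd_operator ::
    "('a \<Rightarrow> 'b::real_vector) set \<Rightarrow> ((('a \<Rightarrow> 'b) \<Rightarrow> real) \<Rightarrow> 'a \<Rightarrow> 'b) \<Rightarrow> bool" where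
  "spd_operator S H \<longleftrightarrow> H \<in> dual S \<rightarrow> S \<and>
     (\<forall>f\<in>dual S. \<forall>g\<in>dual S. H (\<lambda>v\<in>S. f v + g v) = (\<lambda>x. H f x + H g x)) \<and>
     (\<forall>c. \<forall>f\<in>dual S. H (\<lambda>v\<in>S. c * f v) = (\<lambda>x. c *\<^sub>R H f x)) \<and>
     (\<forall>f\<in>dual S. \<forall>g\<in>dual S. f (H g) = g (H f)) \<and>
     (\<forall>f\<in>dual S. f \<noteq> (\<lambda>v\<in>S. 0) \<longrightarrow> f (H f) > 0)"

definition a_form :: "(real^'n) set \<Rightarrow> real \<Rightarrow> real \<Rightarrow> (real^'n \<Rightarrow> real^'n) \<Rightarrow> (real^'n \<Rightarrow> real^'n) \<Rightarrow> real" where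
  "a_form \<Omega> lam \<mu> u v = 2 * \<mu> * L2_inner \<Omega> (sym_grad \<Omega> u) (sym_grad \<Omega> v)
     + lam * L2_inner \<Omega> (dvg \<Omega> u) (dvg \<Omega> v)"

definition ap_form :: "(real^'n) set \<Rightarrow> real \<Rightarrow> (real^'n \<Rightarrow> real) \<Rightarrow> (real^'n \<Rightarrow> real) \<Rightarrow> real" where
  "ap_form \<Omega> K p q = L2_inner \<Omega> (\<lambda>x. K *\<^sub>R weak_grad \<Omega> p x) (weak_grad \<Omega> q)"

definition A_u where "A_u \<Omega> V lam \<mu> u = (\<lambda>v\<in>V. a_form \<Omega> lam \<mu> u v)"

definition B_op where "B_op \<Omega> Q u = (\<lambda>q\<in>Q. - L2_inner \<Omega> (dvg \<Omega> u) q)"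

definition BT_op where "BT_op \<Omega> V Q p = (\<lambda>v\<in>V. B_op \<Omega> Q v p)"

definition A_p where "A_p \<Omega> Q K p = (\<lambda>q\<in>Q. ap_form \<Omega> K p q)"

definition L_p where "L_p \<Omega> Q p = (\<lambda>q\<in>Q. L2_inner \<Omega> (weak_grad \<Omega> p) (weak_grad \<Omega> q))"

definition M_p :: "(real^'n) set \<Rightarrow> (real^'n \<Rightarrow> real) set \<Rightarrow> (real^'n \<Rightarrow> real) \<Rightarrow> (real^'n \<Rightarrow> real) \<Rightarrow> real" where
  "M_p \<Omega> Q p = (\<lambda>q\<in>Q. L2_inner \<Omega> p q)"

definition Au_norm where "Au_norm \<Omega> lam \<mu> v = sqrt (a_form \<Omega> lam \<mu> v v)"

definition Au_op_norm ::
    "(real^'n) set \<Rightarrow> (real^'n \<Rightarrow> real^'n) set \<Rightarrow> real \<Rightarrow> real \<Rightarrow>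
     ((real^'n \<Rightarrow> real^'n) \<Rightarrow> real^'n \<Rightarrow> real^'n) \<Rightarrow> ereal" where
  "Au_op_norm \<Omega> V lam \<mu> E =
     (SUP v\<in>V - {\<lambda>_. 0}. ereal (Au_norm \<Omega> lam \<mu> (E v) / Au_norm \<Omega> lam \<mu> v))"

text \<open>Two-by-two block operators from \<open>V \<times> Q\<close> to its dual, the latter being identified with
  \<open>dual V \<times> dual Q\<close>.\<close>

definition block_op where
  "block_op V Q A11 A12 A21 A22 =
     (\<lambda>(u, p). (\<lambda>v\<in>V. A11 u v + A12 p v :: real, \<lambda>q\<in>Q. A21 u q + A22 p q :: real))"

definition pairing :: "('v \<Rightarrow> real) \<times> ('q \<Rightarrow> real) \<Rightarrow> 'v \<times> 'q \<Rightarrow> real" where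
  "pairing = (\<lambda>(f, g) (v, q). f v + g q)"

definition op_inner where "op_inner N x y = pairing (N x) y"

definition op_norm where "op_norm N x = sqrt (op_inner N x x)"

end

theory Submission
  imports Defs "HOL-Library.Function_Algebras"
begin

text \<open>Write \<open>b = \<alpha> B\<^sup>T p\<close>, \<open>s\<close> for the form of \<open>\<tau> A\<^sub>p + \<eta> h\<^sup>2 L\<^sub>p\<close> and \<open>k\<close> for that of
  \<open>\<alpha>\<^sup>2/\<zeta>\<^sup>2 M\<close>. The skew terms of \<open>\<A>\<close> cancel, and the numerator of the first quotient is
  \<open>a(u, u) + s(p, p) + b(H\<^sub>u A\<^sub>u u) + b(H\<^sub>u b)\<close>. The Cauchy-Schwarz inequality for \<open>H\<^sub>u\<close> bounds
  the third summand by the square root of \<open>(A\<^sub>u u)(H\<^sub>u A\<^sub>u u) b(H\<^sub>u b)\<close>, and the contraction hypothesis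
  gives \<open>(A\<^sub>u u)(H\<^sub>u A\<^sub>u u) \<le> 2 a(u, u)\<close>; as the square root of \<open>2 x y\<close> is at most
  \<open>3/4 (x + y)\<close>, a quarter of \<open>a(u, u) + b(H\<^sub>u b)\<close> survives. The weak
  inf-sup condition then bounds \<open>k(p, p)\<close> by \<open>b(H\<^sub>u b)\<close> and the stabilization term. The upper bound uses \<open>\<zeta>\<^sup>2 \<parallel>div v\<parallel>\<^sup>2 \<le> a(v, v)\<close> and duality. On the analytic side one needs
  that all forms are bilinear, that is, that weak gradients are unique almost everywhere.\<close>

section \<open>Forms and preconditioners on spaces of functions\<close>

text \<open>The mixed term b(H A u) has no sign. It can be absorbed only if its square is at most
  \<theta> a(u, u) b(H b) with \<theta> < 4. The spectral bounds alone give \<theta> = 1 /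
  \<open>c1u\<close>, which may be large; this is why the contraction hypothesis is brought in.
  Parameter independence comes from \<zeta>: its square is a lower bound for a(v, v) / |div v|^2
  and, up to the factor d, an upper bound for a(v, v) / |v|_1^2, so \<lambda> and \<mu> cancel
  wherever divergence and energy are compared. The choice of \<eta> makes the defect in the weak
  inf-sup condition a fixed multiple of the stabilization term. A second obstacle is that all
  inverses in the statement are \<open>inv_into\<close>, which means nothing off the range.
  Bijectivity is therefore derived: for \<open>Hu\<close> and \<open>Hp\<close> from positive
  definiteness, for the form operators from the two-sided bounds. After that f(H f) is a squared
  dual norm up to constants, and the remaining abstract estimates rest on the Cauchy-Schwarz
  inequality and duality.\<close>

lemma square_le_of_nonneg_quadratic:
  fixes A B C :: real
  assumes A: "0 \<le> A" and C: "0 \<le> C" and q: "\<And>t. 0 \<le> A + 2 * t * B + t\<^sup>2 * C"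
  shows "B\<^sup>2 \<le> A * C"
proof (cases "C = 0")
  case True
  have "B = 0"
  proof (rule ccontr)
    assume "B \<noteq> 0"
    then show False
      \<comment> \<open>At this point the affine function takes the value -1.\<close>
      using q[of "- (A + 1) / (2 * B)"] True A by (simp add: field_simps)
  qed
  then show ?thesis using A C by simp
next
  case False
  then have "C > 0" using C by simp
  have "0 \<le> A - B\<^sup>2 / C"
    using q[of "- B / C"] False by (simp add: power2_eq_square field_simps)
  then show ?thesis using \<open>C > 0\<close> by (simp add: field_simps)
qed

text \<open>For quantities estimated by testing a functional with its own representer, where the
  unknown stands on both sides.\<close>

lemma le_of_square_le:
  fixes x k :: real
  assumes "x\<^sup>2 \<le> k * x" "0 \<le> k" "0 \<le> x"
  shows "x \<le> k"
  using assms by (cases "x = 0") (auto simp: power2_eq_square)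

lemma abs_le_of_square_le: "x\<^sup>2 \<le> y\<^sup>2 \<Longrightarrow> 0 \<le> y \<Longrightarrow> \<bar>x\<bar> \<le> (y::real)"
  using abs_le_square_iff[of x y] by simp

lemma square_sum_le: "(x + y)\<^sup>2 \<le> 2 * x\<^sup>2 + 2 * (y::real)\<^sup>2"
  using zero_le_power2[of "x - y"] by (simp add: power2_eq_square algebra_simps)

text \<open>Closure is stated with the same pointwise terms as in \<open>dual\<close>, so that
  membership facts apply to functionals literally.\<close>

definition fun_subspace :: "('a \<Rightarrow> 'b::real_vector) set \<Rightarrow> bool" where
  "fun_subspace S \<longleftrightarrow> (\<lambda>_. 0) \<in> S \<and> (\<forall>u\<in>S. \<forall>v\<in>S. (\<lambda>x. u x + v x) \<in> S) \<and>
     (\<forall>c. \<forall>u\<in>S. (\<lambda>x. c *\<^sub>R u x) \<in> S)"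

lemma fun_subspaceD:
  assumes "fun_subspace S"
  shows "(\<lambda>_. 0) \<in> S" and "\<And>u v. u \<in> S \<Longrightarrow> v \<in> S \<Longrightarrow> (\<lambda>x. u x + v x) \<in> S"
    and "\<And>c u. u \<in> S \<Longrightarrow> (\<lambda>x. c *\<^sub>R u x) \<in> S"
  using assms by (auto simp: fun_subspace_def)

lemma fun_subspace_diff:
  assumes "fun_subspace S" "u \<in> S" "v \<in> S"
  shows "(\<lambda>x. u x - v x) \<in> S"
  using fun_subspaceD(2)[OF assms(1,2) fun_subspaceD(3)[OF assms(1,3), of "-1"]] by simp

text \<open>Only semidefinite, because integrals do not see null sets. Linearity in the second
  argument follows from symmetry, in \<open>psd_form_right\<close>.\<close>

definition psd_form ::
    "('a \<Rightarrow> 'b::real_vector) set \<Rightarrow> (('a \<Rightarrow> 'b) \<Rightarrow> ('a \<Rightarrow> 'b) \<Rightarrow> real) \<Rightarrow> bool" where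
  "psd_form S c \<longleftrightarrow>
     (\<forall>u\<in>S. \<forall>v\<in>S. \<forall>w\<in>S. c (\<lambda>x. u x + v x) w = c u w + c v w) \<and>
     (\<forall>r. \<forall>u\<in>S. \<forall>w\<in>S. c (\<lambda>x. r *\<^sub>R u x) w = r * c u w) \<and>
     (\<forall>u\<in>S. \<forall>v\<in>S. c u v = c v u) \<and> (\<forall>u\<in>S. 0 \<le> c u u)"

lemma psd_formD:
  assumes "psd_form S c"
  shows "\<And>u v w. u \<in> S \<Longrightarrow> v \<in> S \<Longrightarrow> w \<in> S \<Longrightarrow> c (\<lambda>x. u x + v x) w = c u w + c v w"
    and "\<And>r u w. u \<in> S \<Longrightarrow> w \<in> S \<Longrightarrow> c (\<lambda>x. r *\<^sub>R u x) w = r * c u w"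
    and "\<And>u v. u \<in> S \<Longrightarrow> v \<in> S \<Longrightarrow> c u v = c v u"
    and "\<And>u. u \<in> S \<Longrightarrow> 0 \<le> c u u"
  using assms by (auto simp: psd_form_def)

lemma psd_form_right:
  assumes S: "fun_subspace S" and c: "psd_form S c" and w: "w \<in> S"
  shows "\<And>u v. u \<in> S \<Longrightarrow> v \<in> S \<Longrightarrow> c w (\<lambda>x. u x + v x) = c w u + c w v"
    and "\<And>r u. u \<in> S \<Longrightarrow> c w (\<lambda>x. r *\<^sub>R u x) = r * c w u"
proof -
  note sym = psd_formD(3)[OF c w]
  show "c w (\<lambda>x. u x + v x) = c w u + c w v" if "u \<in> S" "v \<in> S" for u v
    using psd_formD(1)[OF c that w] sym[OF fun_subspaceD(2)[OF S that]] sym[OF that(1)] sym[OF that(2)]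
    by simp
  show "c w (\<lambda>x. r *\<^sub>R u x) = r * c w u" if "u \<in> S" for r u
    using psd_formD(2)[OF c that w] sym[OF fun_subspaceD(3)[OF S that]] sym[OF that] by simp
qed

lemma psd_form_diff:
  assumes S: "fun_subspace S" and c: "psd_form S c" and "u \<in> S" "v \<in> S" "w \<in> S"
  shows "c (\<lambda>x. u x - v x) w = c u w - c v w"
  using psd_formD(1)[OF c \<open>u \<in> S\<close> fun_subspaceD(3)[OF S \<open>v \<in> S\<close>, of "-1"] \<open>w \<in> S\<close>]
    psd_formD(2)[OF c \<open>v \<in> S\<close> \<open>w \<in> S\<close>, of "-1"] by simp

lemma psd_form_combination:
  assumes S: "fun_subspace S" and c: "psd_form S c" and u: "u \<in> S" and v: "v \<in> S"
  shows "c (\<lambda>x. u x + t *\<^sub>R v x) (\<lambda>x. u x + t *\<^sub>R v x) = c u u + 2 * t * c u v + t\<^sup>2 * c v v"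
proof -
  note S' = fun_subspaceD[OF S] and c' = psd_formD[OF c]
  have tv: "(\<lambda>x. t *\<^sub>R v x) \<in> S" and w: "(\<lambda>x. u x + t *\<^sub>R v x) \<in> S"
    using S'(2,3) u v by auto
  show ?thesis
    using c'(1)[OF u tv w] c'(2)[OF v w, of t] c'(3)[OF u v] psd_form_right[OF S c]
    by (simp add: u v tv power2_eq_square algebra_simps)
qed

lemma psd_form_Cauchy_Schwarz:
  assumes S: "fun_subspace S" and c: "psd_form S c" and u: "u \<in> S" and v: "v \<in> S"
  shows "(c u v)\<^sup>2 \<le> c u u * c v v"
proof (rule square_le_of_nonneg_quadratic)
  show "0 \<le> c u u" "0 \<le> c v v" using psd_formD(4)[OF c] u v by auto
  show "0 \<le> c u u + 2 * t * c u v + t\<^sup>2 * c v v" for t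
    using psd_form_combination[OF assms, of t] psd_formD(4)[OF c, of "\<lambda>x. u x + t *\<^sub>R v x"]
      fun_subspaceD[OF S] u v by auto
qed

text \<open>The parallelogram law without the nonnegative term at \<open>u + v\<close>.\<close>

lemma psd_form_diff_le:
  assumes S: "fun_subspace S" and c: "psd_form S c" and u: "u \<in> S" and v: "v \<in> S"
  shows "c (\<lambda>x. u x - v x) (\<lambda>x. u x - v x) \<le> 2 * c u u + 2 * c v v"
proof -
  have "0 \<le> c u u + 2 * c u v + c v v"
    using psd_form_combination[OF assms, of 1] psd_formD(4)[OF c, of "\<lambda>x. u x + v x"]
      fun_subspaceD[OF S] u v by auto
  then show ?thesis
    using psd_form_combination[OF assms, of "-1"] by simp
qed

lemma psd_form_add_le:
  assumes S: "fun_subspace S" and c: "psd_form S c" and u: "u \<in> S" and v: "v \<in> S"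
  shows "c (\<lambda>x. u x + v x) (\<lambda>x. u x + v x) \<le> 2 * c u u + 2 * c v v"
proof -
  have "0 \<le> c u u - 2 * c u v + c v v"
    using psd_form_combination[OF assms, of "-1"] psd_formD(4)[OF c fun_subspace_diff[OF S u v]]
    by simp
  then show ?thesis
    using psd_form_combination[OF assms, of 1] by simp
qed

subsection \<open>Duals and symmetric positive definite operators\<close>

lemma dualD:
  assumes "f \<in> dual S"
  shows "\<And>u v. u \<in> S \<Longrightarrow> v \<in> S \<Longrightarrow> f (\<lambda>x. u x + v x) = f u + f v"
    and "\<And>c v. v \<in> S \<Longrightarrow> f (\<lambda>x. c *\<^sub>R v x) = c * f v"
    and "f \<in> extensional S"
  using assms by (auto simp: dual_def)

lemma dualI:
  assumes S: "fun_subspace S"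
    and "\<And>u v. u \<in> S \<Longrightarrow> v \<in> S \<Longrightarrow> F (\<lambda>x. u x + v x) = F u + F v"
    and "\<And>c v. v \<in> S \<Longrightarrow> F (\<lambda>x. c *\<^sub>R v x) = c * F v"
  shows "(\<lambda>v\<in>S. F v) \<in> dual S"
  unfolding dual_def using assms(2,3) fun_subspaceD[OF S] by auto

lemma dual_eqI:
  assumes "f \<in> dual S" "g \<in> dual S" "\<And>v. v \<in> S \<Longrightarrow> f v = g v"
  shows "f = g"
  using assms dualD(3) by (metis extensionalityI)

lemma dual_combination:
  assumes "fun_subspace S" "f \<in> dual S" "g \<in> dual S"
  shows "(\<lambda>v\<in>S. f v + g v) \<in> dual S" "(\<lambda>v\<in>S. c * f v) \<in> dual S"
  by (rule dualI[OF assms(1)]; simp add: dualD(1,2)[OF assms(2)] dualD(1,2)[OF assms(3)] algebra_simps)+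

lemma dual_diff:
  assumes "f \<in> dual S" "fun_subspace S" "u \<in> S" "v \<in> S"
  shows "f (\<lambda>x. u x - v x) = f u - f v"
  using dualD(1)[OF assms(1,3) fun_subspaceD(3)[OF assms(2,4), of "-1"]]
    dualD(2)[OF assms(1,4), of "-1"] by simp

lemma psd_form_dual:
  assumes S: "fun_subspace S" and c: "psd_form S c" and "u \<in> S"
  shows "(\<lambda>v\<in>S. c u v) \<in> dual S"
  by (rule dualI[OF S]) (simp_all add: psd_form_right[OF S c \<open>u \<in> S\<close>])

text \<open>Pointwise evaluations already separate the points of a space of functions.\<close>

lemma dual_separates:
  fixes S :: "('a \<Rightarrow> 'b::real_inner) set"
  assumes S: "fun_subspace S" and u: "u \<in> S" and 0: "\<And>f. f \<in> dual S \<Longrightarrow> f u = 0"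
  shows "u = (\<lambda>_. 0)"
proof
  fix x
  have "(\<lambda>v\<in>S. v x \<bullet> u x) \<in> dual S"
    by (rule dualI[OF S]) (auto simp: inner_add_left)
  from 0[OF this] u show "u x = 0" by simp
qed

lemma dual_separates_points:
  fixes S :: "('a \<Rightarrow> 'b::real_inner) set"
  assumes S: "fun_subspace S" and u: "u \<in> S" and v: "v \<in> S"
    and eq: "\<And>f. f \<in> dual S \<Longrightarrow> f u = f v"
  shows "u = v"
proof -
  have "(\<lambda>x. u x - v x) = (\<lambda>_. 0)"
  proof (rule dual_separates[OF S fun_subspace_diff[OF S u v]])
    fix f assume "f \<in> dual S"
    then show "f (\<lambda>x. u x - v x) = 0" using dual_diff[OF _ S u v, of f] eq[of f] by simp
  qed
  then show ?thesis by (metis eq_iff_diff_eq_0 ext)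
qed

lemma spd_operatorD:
  assumes "spd_operator S H"
  shows "\<And>f. f \<in> dual S \<Longrightarrow> H f \<in> S"
    and "\<And>f g. f \<in> dual S \<Longrightarrow> g \<in> dual S \<Longrightarrow> H (\<lambda>v\<in>S. f v + g v) = (\<lambda>x. H f x + H g x)"
    and "\<And>f c. f \<in> dual S \<Longrightarrow> H (\<lambda>v\<in>S. c * f v) = (\<lambda>x. c *\<^sub>R H f x)"
    and "\<And>f g. f \<in> dual S \<Longrightarrow> g \<in> dual S \<Longrightarrow> f (H g) = g (H f)"
    and "\<And>f. f \<in> dual S \<Longrightarrow> f \<noteq> (\<lambda>v\<in>S. 0) \<Longrightarrow> 0 < f (H f)"
  using assms by (auto simp: spd_operator_def)

lemma spd_operator_nonneg:
  assumes S: "fun_subspace S" and H: "spd_operator S H" and f: "f \<in> dual S"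
  shows "0 \<le> f (H f)"
proof (cases "f = (\<lambda>v\<in>S. 0)")
  case True
  then show ?thesis using spd_operatorD(1)[OF H f] by simp
qed (use spd_operatorD(5)[OF H f] in simp)

text \<open>Expansion of the quadratic form of H along the line f + t g. The nested restriction is
  the literal shape to which additivity and homogeneity of H apply.\<close>

lemma spd_operator_combination:
  fixes t :: real
  assumes S: "fun_subspace S" and H: "spd_operator S H" and f: "f \<in> dual S" and g: "g \<in> dual S"
  defines "h \<equiv> (\<lambda>v\<in>S. f v + (\<lambda>v\<in>S. t * g v) v)"
  shows "h \<in> dual S" and "h (H h) = f (H f) + 2 * t * f (H g) + t\<^sup>2 * g (H g)"
proof -
  note S' = fun_subspaceD[OF S] and H' = spd_operatorD[OF H]
  have tg: "(\<lambda>v\<in>S. t * g v) \<in> dual S" using dual_combination[OF S g g] by blast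
  show h: "h \<in> dual S" unfolding h_def by (rule dual_combination[OF S f tg])
  have Hh: "H h = (\<lambda>x. H f x + t *\<^sub>R H g x)"
    unfolding h_def using H'(2)[OF f tg] H'(3)[OF g] by simp
  have in_S: "H f \<in> S" "H g \<in> S" "(\<lambda>x. t *\<^sub>R H g x) \<in> S" "H h \<in> S"
    using H'(1) f g h S' by auto
  have "h (H h) = f (H h) + t * g (H h)"
    using in_S unfolding h_def by simp
  also have "f (H h) = f (H f) + t * f (H g)"
    unfolding Hh using in_S dualD(1,2)[OF f] by simp
  also have "g (H h) = f (H g) + t * g (H g)"
    unfolding Hh using in_S dualD(1,2)[OF g] H'(4)[OF f g] by simp
  finally show "h (H h) = f (H f) + 2 * t * f (H g) + t\<^sup>2 * g (H g)"
    by (simp add: algebra_simps power2_eq_square)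
qed

lemma spd_operator_Cauchy_Schwarz:
  assumes S: "fun_subspace S" and H: "spd_operator S H" and f: "f \<in> dual S" and g: "g \<in> dual S"
  shows "(f (H g))\<^sup>2 \<le> f (H f) * g (H g)"
proof (rule square_le_of_nonneg_quadratic)
  show "0 \<le> f (H f)" "0 \<le> g (H g)" using spd_operator_nonneg[OF S H] f g by auto
  show "0 \<le> f (H f) + 2 * t * f (H g) + t\<^sup>2 * g (H g)" for t
    using spd_operator_nonneg[OF S H spd_operator_combination(1)[OF assms, of t]]
    unfolding spd_operator_combination(2)[OF assms, of t] .
qed

text \<open>If \<open>H f = H g\<close>, the quadratic form of H vanishes at f - g, and definiteness
  applies.\<close>

lemma spd_operator_inj_on:
  assumes S: "fun_subspace S" and H: "spd_operator S H"
  shows "inj_on H (dual S)"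
proof (rule inj_onI)
  fix f g assume f: "f \<in> dual S" and g: "g \<in> dual S" and eq: "H f = H g"
  note H' = spd_operatorD[OF H]
  define h where "h = (\<lambda>v\<in>S. f v + (\<lambda>v\<in>S. (-1) * g v) v)"
  have h: "h \<in> dual S" "h (H h) = f (H f) + 2 * (-1) * f (H g) + (-1)\<^sup>2 * g (H g)"
    unfolding h_def using spd_operator_combination[OF S H f g] by blast+
  have "h (H h) = 0"
    using h(2) eq H'(4)[OF f g] by simp
  then have "h = (\<lambda>v\<in>S. 0)" using H'(5)[OF h(1)] by force
  then have "f v = g v" if "v \<in> S" for v
    using that unfolding h_def by (auto dest!: fun_cong[where x=v])
  then show "f = g" by (rule dual_eqI[OF f g])
qed

text \<open>Surjectivity onto \<open>S\<close> needs no finite dimension: \<open>H f \<mapsto> f v\<close> is a linear functional on the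
  range of \<open>H\<close>, and any linear extension of it to \<open>S\<close> is a preimage of \<open>v\<close>.\<close>

lemma spd_operator_bij_betw:
  fixes S :: "('a \<Rightarrow> 'b::real_inner) set"
  assumes S: "fun_subspace S" and H: "spd_operator S H"
  shows "bij_betw H (dual S) S"
proof -
  note H' = spd_operatorD[OF H] and S' = fun_subspaceD[OF S]
  note inj = spd_operator_inj_on[OF S H]
  let ?sc = "\<lambda>c (u::'a \<Rightarrow> 'b) x. c *\<^sub>R u x"
  interpret vector_space_pair ?sc "(*) :: real \<Rightarrow> real \<Rightarrow> real"
    by unfold_locales (auto simp: fun_eq_iff algebra_simps)
  define R where "R = H ` dual S"
  have RS: "R \<subseteq> S" using H'(1) by (auto simp: R_def)
  have "v \<in> R" if v: "v \<in> S" for v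
  proof -
    define \<phi> where "\<phi> w = inv_into (dual S) H w v" for w
    have \<phi>: "\<phi> (H f) = f v" if "f \<in> dual S" for f
      unfolding \<phi>_def using inv_into_f_f[OF inj that] by simp
    obtain B where B: "B \<subseteq> R" "vs1.independent B" "R \<subseteq> vs1.span B"
      by (rule vs1.maximal_independent_subset)
    obtain F where lin: "Vector_Spaces.linear ?sc (*) F" and FB: "\<forall>b\<in>B. F b = \<phi> b"
      using linear_independent_extend[OF B(2)] by blast
    interpret F: Vector_Spaces.linear ?sc "(*)" F by (rule lin)
    have Fadd: "F (\<lambda>x. u x + w x) = F u + F w" for u w
      using F.add[of u w] by (simp add: plus_fun_def)
    have Fscale: "F (\<lambda>x. c *\<^sub>R u x) = c * F u" for c u
      using F.scale[of c u] by simp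
    have zero: "(\<lambda>v\<in>S. 0) \<in> dual S"
      by (rule dualI[OF S]) auto
    have H0: "H (\<lambda>v\<in>S. 0) = (\<lambda>_. 0)"
      using H'(3)[OF zero, of 0] by simp
    \<comment> \<open>The set where the linear extension agrees with \<phi>. It is a subspace
      containing B, and B spans R, so agreement on B spreads to all of R.\<close>
    let ?T = "{w \<in> R. F w = \<phi> w}"
    have "vs1.subspace ?T"
      unfolding vs1.subspace_def
    proof (intro conjI ballI allI)
      show "0 \<in> ?T"
        using imageI[OF zero, of H] \<phi>[OF zero] v Fscale[of 0 "\<lambda>_. 0"] by (simp add: H0 R_def zero_fun_def)
      fix w w' assume "w \<in> ?T" "w' \<in> ?T"
      then obtain f g where fg: "f \<in> dual S" "g \<in> dual S" "w = H f" "w' = H g"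
        "F w = \<phi> w" "F w' = \<phi> w'"
        by (auto simp: R_def)
      let ?h = "\<lambda>v\<in>S. f v + g v"
      have h: "?h \<in> dual S" "H ?h = w + w'"
        using dual_combination[OF S fg(1,2)] H'(2)[OF fg(1,2)] fg by (auto simp: plus_fun_def)
      have "F (w + w') = \<phi> (H ?h)"
        using \<phi>[OF h(1)] fg \<phi>[OF fg(1)] \<phi>[OF fg(2)] v by (simp add: F.add)
      with h show "w + w' \<in> ?T"
        using imageI[OF h(1), of H] by (simp add: R_def)
    next
      fix c w assume "w \<in> ?T"
      then obtain f where fg: "f \<in> dual S" "w = H f" "F w = \<phi> w"
        by (auto simp: R_def)
      let ?h = "\<lambda>v\<in>S. c * f v"
      have h: "?h \<in> dual S" "H ?h = (\<lambda>x. c *\<^sub>R w x)"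
        using dual_combination(2)[OF S fg(1,1)] H'(3)[OF fg(1)] fg by auto
      have "F (\<lambda>x. c *\<^sub>R w x) = \<phi> (H ?h)"
        using \<phi>[OF h(1)] fg \<phi>[OF fg(1)] v by (simp add: Fscale)
      with h show "(\<lambda>x. c *\<^sub>R w x) \<in> ?T"
        using imageI[OF h(1), of H] by (simp add: R_def)
    qed
    moreover have "B \<subseteq> ?T" using B(1) FB by auto
    ultimately have "R \<subseteq> ?T" using vs1.span_minimal B(3) by blast
    then have FR: "F (H f) = f v" if "f \<in> dual S" for f
      using \<phi>[OF that] that by (auto simp: R_def)
    have f: "(\<lambda>u\<in>S. F u) \<in> dual S"
      by (rule dualI[OF S]) (simp_all add: Fadd Fscale)
    have "H (\<lambda>u\<in>S. F u) = v"
    proof (rule dual_separates_points[OF S H'(1)[OF f] v])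
      fix g assume g: "g \<in> dual S"
      \<comment> \<open>By symmetry the left side is F (H g), which is g v by
        \<open>FR\<close>.\<close>
      show "g (H (\<lambda>u\<in>S. F u)) = g v"
        using H'(4)[OF g f] H'(1)[OF g] FR[OF g] by simp
    qed
    then show "v \<in> R" using f by (auto simp: R_def)
  qed
  with RS inj show ?thesis by (auto simp: bij_betw_def R_def)
qed

text \<open>A functional outside the range of the form has the junk preimage \<open>SOME v. False\<close>, the same for
  all such functionals; this is incompatible with the two bounds, which hold for all multiples.\<close>

lemma psd_form_bij_betw:
  fixes S :: "('a \<Rightarrow> 'b::real_inner) set"
  assumes S: "fun_subspace S" and c: "psd_form S c" and H: "spd_operator S H"
    and c1: "0 < c1" and C: "\<And>u. u \<in> S \<Longrightarrow> C u = (\<lambda>v\<in>S. c u v)"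
    and lo: "\<And>f. f \<in> dual S \<Longrightarrow> c1 * f (H f) \<le> f (inv_into S C f)"
    and up: "\<And>f. f \<in> dual S \<Longrightarrow> f (inv_into S C f) \<le> c2 * f (H f)"
  shows "bij_betw C S (dual S)"
proof -
  note H' = spd_operatorD[OF H] and S' = fun_subspaceD[OF S]
  have CS: "C u \<in> dual S" if "u \<in> S" for u
    using psd_form_dual[OF S c that] C[OF that] by simp
  have surj: "f \<in> C ` S" if f: "f \<in> dual S" for f
  proof (rule ccontr)
    assume nf: "f \<notin> C ` S"
    let ?f = "\<lambda>t. \<lambda>v\<in>S. t * f v"
    let ?J = "SOME v::'a \<Rightarrow> 'b. False"
    have tf: "?f t \<in> dual S" for t using dual_combination[OF S f f] by blast
    have ntf: "?f t \<notin> C ` S" if "t \<noteq> 0" for t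
    proof
      assume "?f t \<in> C ` S"
      then obtain u where u: "u \<in> S" "?f t = C u" by blast
      have "f = C (\<lambda>x. inverse t *\<^sub>R u x)"
      proof (rule dual_eqI[OF f CS])
        show iu: "(\<lambda>x. inverse t *\<^sub>R u x) \<in> S" using S' u by simp
        fix v assume v: "v \<in> S"
        have "t * f v = c u v" using fun_cong[OF u(2), of v] v C[OF u(1)] by simp
        then show "f v = C (\<lambda>x. inverse t *\<^sub>R u x) v"
          using C[OF iu] v psd_formD(2)[OF c u(1) v] that by (simp add: field_simps)
      qed
      then show False using nf S' u by blast
    qed
    have J: "inv_into S C (?f t) = ?J" if "t \<noteq> 0" for t
    proof -
      have "(\<lambda>v. v \<in> S \<and> C v = ?f t) = (\<lambda>v. False)" using ntf[OF that] by force
      then show ?thesis unfolding inv_into_def by (rule arg_cong)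
    qed
    have Hf: "H f \<in> S" using H'(1)[OF f] .
    have fH: "?f t (H (?f t)) = t\<^sup>2 * f (H f)" for t
      using H'(3)[OF f] S'(3)[OF Hf] dualD(2)[OF f Hf] Hf by (simp add: power2_eq_square)
    have f0: "f \<noteq> (\<lambda>v\<in>S. 0)"
    proof
      assume "f = (\<lambda>v\<in>S. 0)"
      also have "(\<lambda>v\<in>S. 0) = C (\<lambda>_. 0)"
        using C[OF S'(1)] psd_formD(2)[OF c S'(1), of _ 0] by (auto simp: fun_eq_iff)
      finally show False using nf S'(1) by blast
    qed
    define Y where "Y = f (H f)"
    have Y: "0 < Y" unfolding Y_def using H'(5)[OF f f0] .
    have lo': "c1 * (t\<^sup>2 * Y) \<le> ?f t ?J" if "t \<noteq> 0" for t
      using lo[OF tf[of t]] fH[of t] J[OF that] by (simp add: Y_def)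
    have up': "?f t ?J \<le> c2 * (t\<^sup>2 * Y)" if "t \<noteq> 0" for t
      using up[OF tf[of t]] fH[of t] J[OF that] by (simp add: Y_def)
    show False
    proof (cases "?J \<in> S")
      case True
      \<comment> \<open>The value at \<open>?J\<close> is odd in t, but the lower bounds at t = 1
        and t = -1 are the same positive number.\<close>
      have "0 < c1 * Y" using c1 Y by simp
      moreover have "c1 * Y \<le> ?f 1 ?J" "c1 * Y \<le> ?f (-1) ?J" using lo'[of 1] lo'[of "-1"] by simp_all
      ultimately show False using True by simp
    next
      case False
      then have un: "?f t ?J = undefined" for t by simp
      \<comment> \<open>Now all values are the single number \<open>undefined\<close>, squeezed
        between \<open>c1 * ?r * Y\<close> and \<open>c2 * Y\<close>; \<open>?r\<close> is chosen so
        that c1 times it is 2 |c2| + c1, which exceeds c2.\<close>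
      let ?r = "2 * \<bar>c2\<bar> / c1 + 1"
      have r: "0 < ?r" using c1 by (intro add_nonneg_pos) auto
      then have "c1 * ((sqrt ?r)\<^sup>2 * Y) \<le> c2 * (1\<^sup>2 * Y)"
        using lo'[of "sqrt ?r"] up'[of 1] unfolding un by (metis order_trans real_sqrt_eq_0_iff less_irrefl one_neq_zero)
      then have "(c1 * ?r) * Y \<le> c2 * Y" using r by (simp add: mult.assoc)
      moreover have "c1 * ?r = 2 * \<bar>c2\<bar> + c1" using c1 by (simp add: field_simps)
      ultimately have "2 * \<bar>c2\<bar> + c1 \<le> c2" using Y by simp
      then show False using c1 by auto
    qed
  qed
  have "inj_on C S"
  proof (rule inj_onI)
    fix u v assume uv: "u \<in> S" "v \<in> S" "C u = C v"
    show "u = v"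
    proof (rule dual_separates_points[OF S uv(1,2)])
      fix f assume "f \<in> dual S"
      then obtain w where w: "w \<in> S" "f = C w" using surj by blast
      \<comment> \<open>As f is some \<open>C w\<close>, symmetry turns f u and f v into c(u, w) and
        c(v, w).\<close>
      have "c u w = c v w"
        using fun_cong[OF uv(3), of w] w(1) unfolding C[OF uv(1)] C[OF uv(2)] by simp
      then show "f u = f v" using w C uv psd_formD(3)[OF c] by simp
    qed
  qed
  then show ?thesis using CS surj by (auto simp: bij_betw_def)
qed

section \<open>Equivalence of a form and its preconditioner, in the primal and in the dual
  norm\<close>

locale preconditioned_form =
  fixes S :: "('a \<Rightarrow> 'b::real_inner) set" and c C H c1 c2
  assumes S: "fun_subspace S" and c: "psd_form S c" and H: "spd_operator S H"
    and c1: "0 < c1" and c2: "0 < c2" and C: "\<And>u. u \<in> S \<Longrightarrow> C u = (\<lambda>v\<in>S. c u v)"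
    and lo: "\<And>f. f \<in> dual S \<Longrightarrow> c1 * f (H f) \<le> f (inv_into S C f)"
    and up: "\<And>f. f \<in> dual S \<Longrightarrow> f (inv_into S C f) \<le> c2 * f (H f)"
begin

lemmas H_bij = spd_operator_bij_betw[OF S H]
lemmas C_bij = psd_form_bij_betw[OF S c H c1 C lo up]

abbreviation "Hinv \<equiv> inv_into (dual S) H"

lemma C_dual: "u \<in> S \<Longrightarrow> C u \<in> dual S"
  using psd_form_dual[OF S c] C by simp

text \<open>Riesz representation. At the representer w one has f w = c(w, w), so the bounds on the
  inverse become bounds on the energy of w.\<close>

lemma form_rep:
  assumes "f \<in> dual S"
  obtains w where "w \<in> S" "f = C w" "c1 * f (H f) \<le> c w w" "c w w \<le> c2 * f (H f)"
proof -
  obtain w where w: "w \<in> S" "f = C w" using assms C_bij by (auto simp: bij_betw_def)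
  then have "inv_into S C f = w" using C_bij by (auto simp: bij_betw_def)
  with lo[OF assms] up[OF assms] have "c1 * f (H f) \<le> c w w" "c w w \<le> c2 * f (H f)"
    using w C[OF w(1)] by simp_all
  with w show ?thesis by (rule that)
qed

text \<open>Together with \<open>dual_bound\<close> this identifies \<open>f (H f)\<close>, up to
  \<open>c1\<close> and \<open>c2\<close>, with the squared dual norm of f, the supremum of (f v)^2
  / c(v, v).\<close>

lemma dual_le:
  assumes f: "f \<in> dual S" and v: "v \<in> S"
  shows "(f v)\<^sup>2 \<le> c2 * f (H f) * c v v"
proof -
  obtain w where w: "w \<in> S" "f = C w" "c1 * f (H f) \<le> c w w" "c w w \<le> c2 * f (H f)"
    by (rule form_rep[OF f])
  have "(f v)\<^sup>2 \<le> c w w * c v v"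
    using psd_form_Cauchy_Schwarz[OF S c w(1) v] C[OF w(1)] w(2) v by simp
  also have "\<dots> \<le> c2 * f (H f) * c v v"
    using w(4) psd_formD(4)[OF c v] by (rule mult_right_mono)
  finally show ?thesis .
qed

text \<open>The assumed estimate is tested at the representer w of f, where f w = c(w, w).\<close>

lemma dual_bound:
  assumes f: "f \<in> dual S" and k: "0 \<le> k" and b: "\<And>v. v \<in> S \<Longrightarrow> (f v)\<^sup>2 \<le> k * c v v"
  shows "c1 * f (H f) \<le> k"
proof -
  obtain w where w: "w \<in> S" "f = C w" "c1 * f (H f) \<le> c w w" "c w w \<le> c2 * f (H f)"
    by (rule form_rep[OF f])
  have "c w w \<le> k"
  proof (rule le_of_square_le)
    show "(c w w)\<^sup>2 \<le> k * c w w" using b[OF w(1)] w(1) by (simp add: w(2) C[OF w(1)])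
  qed (use psd_formD(4)[OF c w(1)] k in auto)
  with w(3) show ?thesis by simp
qed

lemma Hinv: "v \<in> S \<Longrightarrow> Hinv v \<in> dual S" "v \<in> S \<Longrightarrow> H (Hinv v) = v"
    "f \<in> dual S \<Longrightarrow> Hinv (H f) = f"
  using H_bij by (auto simp: bij_betw_def f_inv_into_f inv_into_into)

lemma Hinv_pos:
  assumes v: "v \<in> S" and "v \<noteq> (\<lambda>_. 0)"
  shows "0 < Hinv v v"
proof -
  have zero: "(\<lambda>v\<in>S. 0) \<in> dual S"
    by (rule dualI[OF S]) auto
  have "H (\<lambda>v\<in>S. 0) = (\<lambda>_. 0)"
    using spd_operatorD(3)[OF H zero, of 0] by simp
  then have "Hinv v \<noteq> (\<lambda>v\<in>S. 0)" using Hinv(2)[OF v] assms(2) by metis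
  then show ?thesis using spd_operatorD(5)[OF H Hinv(1)[OF v]] Hinv(2)[OF v] by simp
qed

lemma Hinv_nonneg: "v \<in> S \<Longrightarrow> 0 \<le> Hinv v v"
  using spd_operator_nonneg[OF S H Hinv(1)] Hinv(2) by metis

text \<open>\<open>dual_le\<close> for the functional \<open>Hinv v\<close>, tested at v itself,
  which is its image under H.\<close>

lemma Hinv_le:
  assumes v: "v \<in> S"
  shows "Hinv v v \<le> c2 * c v v"
proof (rule le_of_square_le)
  have "(Hinv v v)\<^sup>2 \<le> c2 * Hinv v v * c v v"
    using dual_le[OF Hinv(1)[OF v] v] unfolding Hinv(2)[OF v] .
  then show "(Hinv v v)\<^sup>2 \<le> c2 * c v v * Hinv v v" by (simp only: mult.commute mult.left_commute)
  show "0 \<le> c2 * c v v" using psd_formD(4)[OF c v] c2 by simp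
qed (rule Hinv_nonneg[OF v])

text \<open>The Cauchy-Schwarz inequality for H between \<open>C v\<close> and \<open>Hinv v\<close>
  bounds c(v, v)^2 by a product. Its first factor is at most c(v, v) / c1 by
  \<open>dual_bound\<close>, and one power of c(v, v) cancels.\<close>

lemma Hinv_ge:
  assumes v: "v \<in> S"
  shows "c1 * c v v \<le> Hinv v v"
proof (rule le_of_square_le)
  let ?x = "c v v" and ?y = "C v (H (C v))" and ?z = "Hinv v v"
  note nn = psd_formD(4)[OF c v] Hinv_nonneg[OF v]
  have "c1 * ?y \<le> ?x"
  proof (rule dual_bound[OF C_dual[OF v] nn(1)])
    show "(C v w)\<^sup>2 \<le> ?x * c w w" if "w \<in> S" for w
      using psd_form_Cauchy_Schwarz[OF S c v that] C[OF v] that by simp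
  qed
  then have "(c1 * ?y) * ?z \<le> ?x * ?z" using nn(2) by (rule mult_right_mono)
  moreover have "?x\<^sup>2 \<le> ?y * ?z"
    using spd_operator_Cauchy_Schwarz[OF S H C_dual[OF v] Hinv(1)[OF v]] v
    unfolding Hinv(2)[OF v] by (simp add: C[OF v])
  then have "c1 * ?x\<^sup>2 \<le> c1 * (?y * ?z)" using c1 by simp
  ultimately have "c1 * ?x\<^sup>2 \<le> ?x * ?z" by (simp only: mult.assoc)
  then have "c1 * (c1 * ?x\<^sup>2) \<le> c1 * (?x * ?z)" using c1 by simp
  then show "(c1 * ?x)\<^sup>2 \<le> ?z * (c1 * ?x)" by (simp only: power2_eq_square mult.commute mult.left_commute)
  show "0 \<le> ?z" "0 \<le> c1 * ?x" using nn c1 by simp_all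
qed

end

section \<open>The block triangular preconditioner\<close>

text \<open>\<beta>(v, q) stands for \<alpha> (div v, q), so -\<beta>(., p) is \<alpha> B^T p. The
  bound \<open>beta_le\<close> is continuity of the coupling in the energy norms;
  \<open>inf_sup\<close> is the squared weak inf-sup condition, X being any bound on the squared
  dual norm of \<beta>(., p). \<open>A\<close> and \<open>L\<close> are prescribed only on V x Q,
  the set on which L gets inverted.\<close>

locale preconditioned_saddle_point =
  V: preconditioned_form V a Au Hu c1u c2u + Q: preconditioned_form Q cp Cp Hp c1p c2p
  for V :: "('a \<Rightarrow> 'b::real_inner) set" and a Au Hu c1u c2u
    and Q :: "('c \<Rightarrow> 'd::real_inner) set" and cp Cp Hp c1p c2p +
  fixes s k :: "('c \<Rightarrow> 'd) \<Rightarrow> ('c \<Rightarrow> 'd) \<Rightarrow> real"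
    and \<beta> :: "('a \<Rightarrow> 'b) \<Rightarrow> ('c \<Rightarrow> 'd) \<Rightarrow> real" and d1 d2 :: real
    and A L :: "('a \<Rightarrow> 'b) \<times> ('c \<Rightarrow> 'd) \<Rightarrow> (('a \<Rightarrow> 'b) \<Rightarrow> real) \<times> (('c \<Rightarrow> 'd) \<Rightarrow> real)"
  assumes s: "psd_form Q s" and k: "psd_form Q k"
    and cp: "\<And>p q. p \<in> Q \<Longrightarrow> q \<in> Q \<Longrightarrow> cp p q = s p q + k p q"
    and d1: "0 \<le> d1" and d2: "0 \<le> d2"
    and beta_left: "\<And>q. q \<in> Q \<Longrightarrow> (\<lambda>v\<in>V. \<beta> v q) \<in> dual V"
    and beta_right: "\<And>v. v \<in> V \<Longrightarrow> (\<lambda>q\<in>Q. \<beta> v q) \<in> dual Q"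
    and beta_le: "\<And>v q. v \<in> V \<Longrightarrow> q \<in> Q \<Longrightarrow> (\<beta> v q)\<^sup>2 \<le> a v v * k q q"
    and inf_sup: "\<And>p X. p \<in> Q \<Longrightarrow> 0 \<le> X \<Longrightarrow> (\<And>v. v \<in> V \<Longrightarrow> (\<beta> v p)\<^sup>2 \<le> X * a v v) \<Longrightarrow>
      k p p \<le> d1 * X + d2 * s p p"
    and HA_le: "\<And>v. v \<in> V \<Longrightarrow> Au v (Hu (Au v)) \<le> 2 * a v v"
    and A: "\<And>u p. u \<in> V \<Longrightarrow> p \<in> Q \<Longrightarrow>
      A (u, p) = (\<lambda>v\<in>V. a u v - \<beta> v p, \<lambda>q\<in>Q. \<beta> u q + s p q)"
    and L: "\<And>u p. u \<in> V \<Longrightarrow> p \<in> Q \<Longrightarrow>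
      L (u, p) = (V.Hinv u, \<lambda>q\<in>Q. \<beta> u q + Q.Hinv p q)"
begin

abbreviation "prec \<equiv> inv_into (V \<times> Q) L"
abbreviation "MDinv \<equiv> inv_into (dual V \<times> dual Q) (map_prod Hu Hp)"

definition "disp_residual u p = (\<lambda>v\<in>V. a u v - \<beta> v p)"
text \<open>Forward substitution: once the displacement part w =
  \<open>Hu (disp_residual u p)\<close> is known, the coupling term of L at w moves to the
  right-hand side and turns \<beta>(u, .) into \<beta>(u - w, .).\<close>

definition "pres_residual u p = (\<lambda>q\<in>Q. s p q + \<beta> (\<lambda>x. u x - Hu (disp_residual u p) x) q)"

lemma b_dual: "p \<in> Q \<Longrightarrow> (\<lambda>v\<in>V. - \<beta> v p) \<in> dual V"
  using dual_combination(2)[OF V.S beta_left beta_left, of p p "-1"]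
  by (simp cong: restrict_cong)

lemma disp_residual_dual: "u \<in> V \<Longrightarrow> p \<in> Q \<Longrightarrow> disp_residual u p \<in> dual V"
  using dual_combination(1)[OF V.S V.C_dual[of u] b_dual[of p]] V.C[of u]
  by (simp add: disp_residual_def cong: restrict_cong)

lemma w_in: "u \<in> V \<Longrightarrow> p \<in> Q \<Longrightarrow> Hu (disp_residual u p) \<in> V"
  using spd_operatorD(1)[OF V.H disp_residual_dual] .

lemma pres_residual_dual:
  assumes "u \<in> V" "p \<in> Q"
  shows "pres_residual u p \<in> dual Q"
  using dual_combination(1)[OF Q.S psd_form_dual[OF Q.S s assms(2)]
      beta_right[OF fun_subspace_diff[OF V.S assms(1) w_in[OF assms]]]]
  by (simp add: pres_residual_def cong: restrict_cong)

lemma beta_diff: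
  assumes "u \<in> V" "v \<in> V" "q \<in> Q"
  shows "\<beta> (\<lambda>x. u x - v x) q = \<beta> u q - \<beta> v q"
  using dual_diff[OF beta_left[OF assms(3)] V.S assms(1,2)] assms fun_subspace_diff[OF V.S assms(1,2)]
  by simp

text \<open>Besides solving the triangular system, the inverse \<open>inv_into\<close> requires L to
  be injective. This also comes from the triangular shape: the first component determines u, and
  then the second determines p.\<close>

lemma prec_A:
  assumes u: "u \<in> V" and p: "p \<in> Q"
  shows "prec (A (u, p)) = (Hu (disp_residual u p), Hp (pres_residual u p))"
proof -
  note w = w_in[OF u p] and g = pres_residual_dual[OF u p]
  have r: "Hp (pres_residual u p) \<in> Q" using spd_operatorD(1)[OF Q.H g] .
  have inj: "inj_on L (V \<times> Q)"
  proof (rule inj_onI, clarify)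
    fix u p u' p'
    assume V: "u \<in> V" "u' \<in> V" and Q: "p \<in> Q" "p' \<in> Q" and eq: "L (u, p) = L (u', p')"
    have fst: "V.Hinv u = V.Hinv u'"
      and snd: "(\<lambda>q\<in>Q. \<beta> u q + Q.Hinv p q) = (\<lambda>q\<in>Q. \<beta> u' q + Q.Hinv p' q)"
      using eq unfolding L[OF V(1) Q(1)] L[OF V(2) Q(2)] by auto
    have uu: "u = u'" using arg_cong[OF fst, of Hu] unfolding V.Hinv(2)[OF V(1)] V.Hinv(2)[OF V(2)] .
    have "Q.Hinv p q = Q.Hinv p' q" if "q \<in> Q" for q
      using fun_cong[OF snd, of q] uu that by simp
    then have "Q.Hinv p = Q.Hinv p'" by (rule dual_eqI[OF Q.Hinv(1)[OF Q(1)] Q.Hinv(1)[OF Q(2)]])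
    from uu arg_cong[OF this, of Hp] show "u = u' \<and> p = p'"
      unfolding Q.Hinv(2)[OF Q(1)] Q.Hinv(2)[OF Q(2)] by simp
  qed
  have "L (Hu (disp_residual u p), Hp (pres_residual u p)) = A (u, p)"
    unfolding L[OF w r] A[OF u p] Q.Hinv(3)[OF g] V.Hinv(3)[OF disp_residual_dual[OF u p]]
    by (simp add: pres_residual_def beta_diff[OF u w] cong: restrict_cong) (simp add: disp_residual_def add.commute)
  then show ?thesis
    using w r by (intro inv_into_f_eq[OF inj]) auto
qed

lemma MDinv_apply:
  assumes "u \<in> V" "p \<in> Q"
  shows "MDinv (u, p) = (V.Hinv u, Q.Hinv p)"
proof (rule inv_into_f_eq)
  show "inj_on (map_prod Hu Hp) (dual V \<times> dual Q)"
    using V.H_bij Q.H_bij by (intro map_prod_inj_on) (auto simp: bij_betw_def)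
qed (use V.Hinv(1,2)[of u] Q.Hinv(1,2)[of p] assms in auto)

text \<open>\<open>MDinv\<close> cancels \<open>Hu\<close> and \<open>Hp\<close> in the
  preconditioned vector, leaving the two residuals evaluated at u and p; their terms \<beta>(u, p)
  have opposite signs.\<close>

lemma inner_prec_A:
  assumes u: "u \<in> V" and p: "p \<in> Q"
  shows "op_inner MDinv (prec (A (u, p))) (u, p) =
    a u u + s p p - \<beta> (Hu (disp_residual u p)) p"
  using spd_operatorD(1)[OF Q.H pres_residual_dual[OF u p]] V.Hinv(3)[OF disp_residual_dual[OF u p]]
    Q.Hinv(3)[OF pres_residual_dual[OF u p]] u p w_in[OF u p] beta_diff[OF u w_in[OF u p] p]
  by (simp add: prec_A MDinv_apply op_inner_def pairing_def) (simp add: disp_residual_def pres_residual_def)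

lemma norm_prec_A:
  assumes u: "u \<in> V" and p: "p \<in> Q"
  shows "op_inner MDinv (prec (A (u, p))) (prec (A (u, p))) =
    disp_residual u p (Hu (disp_residual u p)) + pres_residual u p (Hp (pres_residual u p))"
  using spd_operatorD(1)[OF Q.H pres_residual_dual[OF u p]] V.Hinv(3)[OF disp_residual_dual[OF u p]]
    Q.Hinv(3)[OF pres_residual_dual[OF u p]] u p w_in[OF u p]
  by (simp add: prec_A MDinv_apply op_inner_def pairing_def)

lemma inner_self:
  assumes u: "u \<in> V" and p: "p \<in> Q"
  shows "op_inner MDinv (u, p) (u, p) = V.Hinv u u + Q.Hinv p p"
  using assms by (simp add: MDinv_apply op_inner_def pairing_def)

lemma nonneg:
  shows "u \<in> V \<Longrightarrow> 0 \<le> a u u" "p \<in> Q \<Longrightarrow> 0 \<le> s p p" "p \<in> Q \<Longrightarrow> 0 \<le> k p p"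
  using psd_formD(4) V.c s k by auto

lemma lower_bound:
  assumes u: "u \<in> V" and p: "p \<in> Q"
  shows "op_inner MDinv (u, p) (u, p) \<le>
    4 * (c2u + c2p * (1 + d2) + c2p * d1 * c2u) * op_inner MDinv (prec (A (u, p))) (u, p)"
proof -
  define b where "b = (\<lambda>v\<in>V. - \<beta> v p)"
  have b: "b \<in> dual V" unfolding b_def by (rule b_dual[OF p])
  have Hb: "Hu b \<in> V" using spd_operatorD(1)[OF V.H b] .
  define Y where "Y = b (Hu b)"
  have Y0: "0 \<le> Y" unfolding Y_def by (rule spd_operator_nonneg[OF V.S V.H b])
  define E where "E = op_inner MDinv (prec (A (u, p))) (u, p)"
  define z where "z = Au u (Hu b)"
  \<comment> \<open>Symmetry of \<open>Hu\<close> moves the preconditioner from the residual onto b,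
    which produces the nonnegative term Y and the mixed term z.\<close>
  have "- \<beta> (Hu (disp_residual u p)) p = b (Hu (disp_residual u p))"
    using w_in[OF u p] by (simp add: b_def)
  also have "\<dots> = disp_residual u p (Hu b)" by (rule spd_operatorD(4)[OF V.H b disp_residual_dual[OF u p]])
  also have "\<dots> = z + Y"
    using Hb V.C[OF u] by (simp add: disp_residual_def Y_def z_def b_def)
  finally have E: "E = a u u + s p p + z + Y"
    unfolding E_def inner_prec_A[OF u p] by simp
  have "z\<^sup>2 \<le> Au u (Hu (Au u)) * Y"
    unfolding z_def Y_def by (rule spd_operator_Cauchy_Schwarz[OF V.S V.H V.C_dual[OF u] b])
  also have "\<dots> \<le> 2 * a u u * Y" using HA_le[OF u] Y0 by (rule mult_right_mono)
  \<comment> \<open>3/4 is a rational number between 1 / sqrt 2, needed for this step, and 1, needed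
    for absorption. The identity used is (3/4 (x + y))^2 - 2 x y = 9/16 (x - y)^2 + 1/4 x y.\<close>
  also have "\<dots> \<le> (3/4 * (a u u + Y))\<^sup>2"
  proof -
    have "0 \<le> 9/16 * (a u u - Y)\<^sup>2 + 1/4 * (a u u * Y)" using Y0 nonneg(1)[OF u] by simp
    then show ?thesis by (simp add: power2_eq_square algebra_simps)
  qed
  finally have "\<bar>z\<bar> \<le> 3/4 * (a u u + Y)"
    using Y0 nonneg(1)[OF u] by (metis abs_le_square_iff abs_of_nonneg add_nonneg_nonneg
      mult_nonneg_nonneg zero_le_divide_iff zero_le_numeral)
  then have "- z \<le> 3/4 * (a u u + Y)" by (rule abs_le_D2)
  then have low: "a u u + Y + s p p \<le> 4 * E" unfolding E using nonneg(2)[OF p] by argo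
  \<comment> \<open>The squared dual norm of \<beta>(., p) is at most \<open>c2u * Y\<close>, so the
    pressure mass, which s alone need not control, is recovered from the displacement block.\<close>
  have "k p p \<le> d1 * (c2u * Y) + d2 * s p p"
  proof (rule inf_sup[OF p])
    show "0 \<le> c2u * Y" using V.c2 Y0 by simp
    show "(\<beta> v p)\<^sup>2 \<le> c2u * Y * a v v" if "v \<in> V" for v
      using V.dual_le[OF b that] that by (simp add: b_def Y_def)
  qed
  then have "cp p p \<le> d1 * (c2u * Y) + (1 + d2) * s p p"
    by (simp add: cp[OF p p] algebra_simps)
  then have "c2p * cp p p \<le> c2p * (d1 * (c2u * Y) + (1 + d2) * s p p)"
    using Q.c2 by (simp only: mult_left_mono less_imp_le)
  then have N: "op_inner MDinv (u, p) (u, p) \<le>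
      c2u * a u u + c2p * (1 + d2) * s p p + c2p * d1 * c2u * Y"
    using V.Hinv_le[OF u] Q.Hinv_le[OF p] by (simp add: inner_self[OF u p] algebra_simps)
  \<comment> \<open>The sum of the three coefficients, used in place of their maximum.\<close>
  let ?C = "c2u + c2p * (1 + d2) + c2p * d1 * c2u"
  have c: "0 \<le> c2u" "0 \<le> c2p * (1 + d2)" "0 \<le> c2p * d1 * c2u"
    using V.c2 Q.c2 d1 d2 by auto
  have "c2u * a u u \<le> ?C * a u u" "c2p * (1 + d2) * s p p \<le> ?C * s p p" "c2p * d1 * c2u * Y \<le> ?C * Y"
    by (rule mult_right_mono; use c nonneg(1)[OF u] nonneg(2)[OF p] Y0 in linarith)+
  then have "op_inner MDinv (u, p) (u, p) \<le> ?C * (a u u + Y + s p p)"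
    using N by (simp only: distrib_left)
  also have "\<dots> \<le> ?C * (4 * E)" using low c by (intro mult_left_mono) auto
  finally show ?thesis by (simp only: E_def mult.commute mult.left_commute)
qed

text \<open>Each residual is bounded as a functional by \<open>dual_bound\<close>, in terms of the
  energy N of x. The pressure residual contains u - w with w the preconditioned displacement
  residual, so the first bound enters the second; this gives the square of \<open>c1u\<close> in the
  constant.\<close>

lemma upper_bound:
  assumes u: "u \<in> V" and p: "p \<in> Q"
  shows "min c1u c1p * op_inner MDinv (prec (A (u, p))) (prec (A (u, p))) \<le>
    (2 / c1u + 2 / c1p * (3 + 4 / c1u\<^sup>2)) * op_inner MDinv (u, p) (u, p)"
proof -
  note f = disp_residual_dual[OF u p] and g = pres_residual_dual[OF u p] and w = w_in[OF u p]
  let ?f = "disp_residual u p" and ?g = "pres_residual u p" and ?w = "Hu (disp_residual u p)"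
  let ?d = "\<lambda>x. u x - ?w x"
  define N where "N = a u u + s p p + k p p"
  have N0: "a u u \<le> N" "a u u + k p p \<le> N" "s p p \<le> N" "0 \<le> N"
    unfolding N_def using nonneg u p by (auto simp: add_nonneg_nonneg)
  have "c1u * ?f (Hu ?f) \<le> 2 * (a u u + k p p)"
  proof (rule V.dual_bound[OF f])
    show "0 \<le> 2 * (a u u + k p p)" using nonneg u p by simp
    fix v assume v: "v \<in> V"
    have "(?f v)\<^sup>2 \<le> 2 * (a u v)\<^sup>2 + 2 * (\<beta> v p)\<^sup>2"
      using square_sum_le[of "a u v" "- \<beta> v p"] v by (simp add: disp_residual_def)
    also have "\<dots> \<le> 2 * (a u u * a v v) + 2 * (a v v * k p p)"
      using psd_form_Cauchy_Schwarz[OF V.S V.c u v] beta_le[OF v p] by linarith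
    finally show "(?f v)\<^sup>2 \<le> 2 * (a u u + k p p) * a v v" by (simp add: algebra_simps)
  qed
  then have F: "?f (Hu ?f) \<le> 2 / c1u * N"
    using N0 V.c1 by (simp add: field_simps)
  \<comment> \<open>\<open>Hinv_ge\<close> at w, where \<open>Hinv w\<close> is the residual
    itself.\<close>
  have "c1u * a ?w ?w \<le> ?f (Hu ?f)"
    using V.Hinv_ge[OF w] V.Hinv(3)[OF f] by simp
  also note F
  finally have "a ?w ?w \<le> 2 / c1u\<^sup>2 * N"
    using V.c1 by (simp add: field_simps power2_eq_square)
  moreover have "(2 + 4 / c1u\<^sup>2) * N = 2 * N + 2 * (2 / c1u\<^sup>2 * N)" by (simp add: algebra_simps)
  ultimately have D: "a ?d ?d \<le> (2 + 4 / c1u\<^sup>2) * N"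
    using psd_form_diff_le[OF V.S V.c u w] N0(1) by linarith
  have d: "?d \<in> V" by (rule fun_subspace_diff[OF V.S u w])
  have "c1p * ?g (Hp ?g) \<le> 2 * (s p p + a ?d ?d)"
  proof (rule Q.dual_bound[OF g])
    show "0 \<le> 2 * (s p p + a ?d ?d)" using nonneg(1)[OF d] nonneg(2)[OF p] by simp
    fix q assume q: "q \<in> Q"
    have "(?g q)\<^sup>2 \<le> 2 * (s p q)\<^sup>2 + 2 * (\<beta> ?d q)\<^sup>2"
      using square_sum_le[of "s p q" "\<beta> ?d q"] q by (simp add: pres_residual_def)
    also have "\<dots> \<le> 2 * (s p p * s q q) + 2 * (a ?d ?d * k q q)"
      using psd_form_Cauchy_Schwarz[OF Q.S s p q] beta_le[OF d q] by linarith
    \<comment> \<open>Both s and k are dominated by their sum \<open>cp\<close>, the form that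
      \<open>Hp\<close> preconditions.\<close>
    also have "\<dots> \<le> 2 * (s p p * cp q q) + 2 * (a ?d ?d * cp q q)"
      using nonneg(1)[OF d] nonneg(2)[OF p] nonneg(2,3)[OF q] cp[OF q q]
      by (intro add_mono mult_left_mono) auto
    finally show "(?g q)\<^sup>2 \<le> 2 * (s p p + a ?d ?d) * cp q q" by (simp add: algebra_simps)
  qed
  \<comment> \<open>The 3 is 1 for s(p, p) plus the 2 from the bound \<open>D\<close>.\<close>
  also have "\<dots> \<le> 2 * ((3 + 4 / c1u\<^sup>2) * N)"
  proof -
    have "(3 + 4 / c1u\<^sup>2) * N = N + (2 + 4 / c1u\<^sup>2) * N" by (simp add: algebra_simps)
    then have "s p p + a ?d ?d \<le> (3 + 4 / c1u\<^sup>2) * N" using add_mono[OF N0(3) D] by (simp only:)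
    then show ?thesis by (intro mult_left_mono) auto
  qed
  finally have G: "?g (Hp ?g) \<le> 2 / c1p * (3 + 4 / c1u\<^sup>2) * N"
    using Q.c1 by (simp add: field_simps)
  let ?C = "2 / c1u + 2 / c1p * (3 + 4 / c1u\<^sup>2)"
  have C0: "0 \<le> ?C" using V.c1 Q.c1 by (intro add_nonneg_nonneg mult_nonneg_nonneg) auto
  have FG: "op_inner MDinv (prec (A (u, p))) (prec (A (u, p))) \<le> ?C * N"
    unfolding norm_prec_A[OF u p] distrib_right using F G by (rule add_mono)
  have m: "0 \<le> min c1u c1p" using V.c1 Q.c1 by simp
  \<comment> \<open>N is the sum of the two preconditioned forms, so \<open>Hinv_ge\<close> in each
    block leads from the energy to the norm of x.\<close>
  have "min c1u c1p * N = min c1u c1p * a u u + min c1u c1p * cp p p"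
    by (simp add: N_def cp[OF p p] algebra_simps)
  also have "\<dots> \<le> c1u * a u u + c1p * cp p p"
    using nonneg u p cp by (intro add_mono mult_right_mono) auto
  also have "\<dots> \<le> op_inner MDinv (u, p) (u, p)"
    unfolding inner_self[OF u p] using V.Hinv_ge[OF u] Q.Hinv_ge[OF p] by (rule add_mono)
  finally have "?C * (min c1u c1p * N) \<le> ?C * op_inner MDinv (u, p) (u, p)"
    using C0 by (rule mult_left_mono)
  moreover have "min c1u c1p * op_inner MDinv (prec (A (u, p))) (prec (A (u, p))) \<le> min c1u c1p * (?C * N)"
    using FG m by (rule mult_left_mono)
  ultimately show ?thesis by (simp only: mult.left_commute)
qed

theorem field_of_values_bounds:
  assumes x: "x \<in> V \<times> Q" "x \<noteq> (\<lambda>_. 0, \<lambda>_. 0)"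
  shows "1 / (4 * (c2u + c2p * (1 + d2) + c2p * d1 * c2u)) \<le>
      op_inner MDinv (prec (A x)) x / op_inner MDinv x x" (is "1 / ?C \<le> _")
    and "op_norm MDinv (prec (A x)) / op_norm MDinv x \<le>
      sqrt ((2 / c1u + 2 / c1p * (3 + 4 / c1u\<^sup>2)) / min c1u c1p)" (is "_ \<le> sqrt (?K / _)")
proof -
  obtain u p where x_eq: "x = (u, p)" and u: "u \<in> V" and p: "p \<in> Q" using x(1) by auto
  have N: "0 < op_inner MDinv x x"
    unfolding x_eq inner_self[OF u p]
    using x(2) x_eq V.Hinv_pos[OF u] Q.Hinv_pos[OF p] V.Hinv_nonneg[OF u] Q.Hinv_nonneg[OF p]
    by (cases "u = (\<lambda>_. 0)") (auto intro: add_pos_nonneg add_nonneg_pos)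
  have "0 < ?C" using V.c2 Q.c2 d1 d2 by (simp add: add_pos_nonneg)
  then show "1 / ?C \<le> op_inner MDinv (prec (A x)) x / op_inner MDinv x x"
    using lower_bound[OF u p] N unfolding x_eq by (simp add: field_simps)
  have "0 < min c1u c1p" using V.c1 Q.c1 by simp
  then have "op_inner MDinv (prec (A x)) (prec (A x)) / op_inner MDinv x x \<le> ?K / min c1u c1p"
    using upper_bound[OF u p] N unfolding x_eq
    by (simp only: pos_divide_le_eq) (simp add: field_simps)
  then show "op_norm MDinv (prec (A x)) / op_norm MDinv x \<le> sqrt (?K / min c1u c1p)"
    unfolding op_norm_def real_sqrt_divide[symmetric] by (rule real_sqrt_le_mono)
qed

end

section \<open>Uniqueness and linearity of weak gradients\<close>

lemma C_k_Suc_imp: "C_k (Suc k) f \<Longrightarrow> C_k k f"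
proof (induction k arbitrary: f)
  case 0
  then show ?case
    by (auto intro!: differentiable_imp_continuous_on simp: differentiable_on_def differentiable_at_withinI)
next
  case (Suc k)
  then show ?case by (metis C_k.simps(2))
qed

lemma partial_cong_open:
  assumes "open U" "x \<in> U" "\<And>y. y \<in> U \<Longrightarrow> f y = g y" "f differentiable (at x)"
  shows "partial i f x = partial i g x"
proof -
  have "(f has_derivative frechet_derivative f (at x)) (at x)"
    using assms(4) frechet_derivative_works by blast
  then have "(g has_derivative frechet_derivative f (at x)) (at x)"
    using assms by (metis has_derivative_transform_within_open)
  then have "frechet_derivative f (at x) = frechet_derivative g (at x)"
    by (rule frechet_derivative_at)
  then show ?thesis by (simp add: partial_def)
qed

lemma partial_eqI: "(f has_derivative f') (at x) \<Longrightarrow> partial i f x = f' (axis i 1)"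
  unfolding partial_def by (metis frechet_derivative_at)

lemma partial_const: "partial i (\<lambda>_. c) = (\<lambda>_. 0)"
  by (rule ext, rule partial_eqI[THEN trans]) (auto intro!: derivative_eq_intros)

lemma partial_add:
  assumes "f differentiable (at x)" "g differentiable (at x)"
  shows "partial i (\<lambda>x. f x + g x) x = partial i f x + partial i g x"
proof -
  have "((\<lambda>x. f x + g x) has_derivative
      (\<lambda>h. frechet_derivative f (at x) h + frechet_derivative g (at x) h)) (at x)"
    using assms frechet_derivative_works by (intro has_derivative_add) blast+
  from partial_eqI[OF this] show ?thesis by (simp add: partial_def)
qed

lemma partial_mult:
  assumes "f differentiable (at x)" "g differentiable (at x)"
  shows "partial i (\<lambda>x. f x * g x) x = f x * partial i g x + partial i f x * g x"
proof -
  have "((\<lambda>x. f x * g x) has_derivative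
      (\<lambda>h. f x * frechet_derivative g (at x) h + frechet_derivative f (at x) h * g x)) (at x)"
    using assms frechet_derivative_works by (intro has_derivative_mult) blast+
  from partial_eqI[OF this] show ?thesis by (simp add: partial_def)
qed

lemma C_k_const: "C_k k (\<lambda>_. c)"
  by (induction k arbitrary: c) (auto simp: partial_const)

lemma C_k_add: "C_k k f \<Longrightarrow> C_k k g \<Longrightarrow> C_k k (\<lambda>x. f x + g x)"
proof (induction k arbitrary: f g)
  case 0
  then show ?case by (auto intro: continuous_on_add)
next
  case (Suc k)
  then have "partial i (\<lambda>x. f x + g x) = (\<lambda>x. partial i f x + partial i g x)" for i
    by (auto simp: partial_add)
  with Suc show ?case by auto
qed

lemma C_k_mult: "C_k k f \<Longrightarrow> C_k k g \<Longrightarrow> C_k k (\<lambda>x. f x * g x)"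
proof (induction k arbitrary: f g)
  case 0
  then show ?case by (auto intro: continuous_on_mult)
next
  case (Suc k)
  have "partial i (\<lambda>x. f x * g x) = (\<lambda>x. f x * partial i g x + partial i f x * g x)" for i
    using Suc.prems by (auto simp: partial_mult)
  moreover have "C_k k (\<lambda>x. f x * partial i g x + partial i f x * g x)" for i
    using Suc.prems C_k_Suc_imp[of k f] C_k_Suc_imp[of k g] by (intro C_k_add Suc.IH) auto
  ultimately show ?case using Suc.prems by auto
qed

lemma C_k_prod: "(\<And>i. i \<in> I \<Longrightarrow> C_k k (f i)) \<Longrightarrow> C_k k (\<lambda>x. \<Prod>i\<in>I. f i x)"
  by (induction I rule: infinite_finite_induct) (auto intro: C_k_mult C_k_const)

subsection \<open>Bump functions and the fundamental lemma of the calculus of variations\<close>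

text \<open>The functions exp(-1/t) t^(-m), extended by 0 to t \<le> 0. Derivatives of members are
  linear combinations of members, so smoothness of the classical cutoff exp(-1/t) becomes one
  induction.\<close>

definition flat :: "nat \<Rightarrow> real \<Rightarrow> real" where
  "flat m t = (if 0 < t then exp (- inverse t) * inverse t ^ m else 0)"

lemma flat_tendsto_0: "(flat m \<longlongrightarrow> 0) (at 0)"
proof -
  have "((\<lambda>y::real. y ^ m / exp y) \<longlongrightarrow> 0) at_top"
    by (rule tendsto_power_div_exp_0)
  then have "((\<lambda>t::real. inverse t ^ m / exp (inverse t)) \<longlongrightarrow> 0) (at_right 0)"
    using filterlim_inverse_at_top_right by (rule filterlim_compose)
  then have "(flat m \<longlongrightarrow> 0) (at_right 0)"
    by (rule Lim_transform_eventually)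
      (auto simp: eventually_at_filter flat_def exp_minus divide_inverse mult.commute)
  moreover have "(flat m \<longlongrightarrow> 0) (at_left 0)"
    by (rule Lim_transform_eventually[OF tendsto_const])
      (auto simp: eventually_at_filter flat_def)
  ultimately show ?thesis by (simp add: filterlim_split_at_real)
qed

lemma DERIV_flat: "(flat m has_real_derivative flat (m + 2) t - real m * flat (m + 1) t) (at t)"
proof -
  consider "0 < t" | "t < 0" | "t = 0" by linarith
  then show ?thesis
  proof cases
    case 1
    let ?u = "inverse t"
    have "((\<lambda>t. exp (- inverse t) * inverse t ^ m) has_real_derivative
        exp (- ?u) * ?u\<^sup>2 * ?u ^ m + exp (- ?u) * (real m * ?u ^ (m - 1) * (- ?u\<^sup>2))) (at t)"
      using 1 by (auto intro!: derivative_eq_intros simp: power2_eq_square)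
    moreover have "real m * ?u ^ (m - 1) * ?u\<^sup>2 = real m * ?u ^ (m + 1)"
      by (cases m) (simp_all add: power2_eq_square)
    then have "exp (- ?u) * ?u\<^sup>2 * ?u ^ m + exp (- ?u) * (real m * ?u ^ (m - 1) * (- ?u\<^sup>2)) =
        flat (m + 2) t - real m * flat (m + 1) t"
      using 1 by (simp add: flat_def power2_eq_square)
    ultimately have "((\<lambda>t. exp (- inverse t) * inverse t ^ m) has_real_derivative
        flat (m + 2) t - real m * flat (m + 1) t) (at t)"
      by simp
    then show ?thesis
      using 1 by (elim has_field_derivative_transform_within_open[where S="{0<..}"]) (auto simp: flat_def)
  next
    case 2
    have "((\<lambda>t::real. 0) has_real_derivative flat (m + 2) t - real m * flat (m + 1) t) (at t)"
      using 2 by (simp add: flat_def)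
    then show ?thesis
      using 2 by (elim has_field_derivative_transform_within_open[where S="{..<0}"]) (auto simp: flat_def)
  next
    case 3
    \<comment> \<open>Division by h only raises the index, so differentiability at 0 is again a
      limit of the form \<open>flat_tendsto_0\<close>.\<close>
    have "(\<lambda>h. (flat m (0 + h) - flat m 0) / h) = flat (Suc m)"
      by (auto simp: flat_def fun_eq_iff divide_inverse)
    then show ?thesis using flat_tendsto_0[of "Suc m"] 3
      by (simp add: DERIV_def) (simp add: flat_def)
  qed
qed

text \<open>The index m is generalized because each differentiation raises it.\<close>

lemma C_k_flat: "C_k k (\<lambda>x::real^'n. flat m (c * x $ i + d))"
proof (induction k arbitrary: m)
  case 0
  have "continuous_on UNIV (flat m)"
    by (rule DERIV_continuous_on) (rule DERIV_flat)
  moreover have "continuous_on UNIV (\<lambda>x::real^'n. c * x $ i + d)"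
    by (intro continuous_intros)
  ultimately have "continuous_on UNIV (\<lambda>x::real^'n. flat m (c * x $ i + d))"
    by (rule continuous_on_compose2) simp
  then show ?case by simp
next
  case (Suc k)
  let ?f = "\<lambda>x::real^'n. flat m (c * x $ i + d)"
  let ?D = "\<lambda>x::real^'n. flat (m + 2) (c * x $ i + d) + - real m * flat (m + 1) (c * x $ i + d)"
  have D: "(?f has_derivative (\<lambda>h. (c * h $ i) * ?D x)) (at x)" for x
  proof -
    have l: "((\<lambda>x::real^'n. c * x $ i + d) has_derivative (\<lambda>h. c * h $ i)) (at x)"
      by (rule has_derivative_add_const[OF has_derivative_mult_right[OF
            bounded_linear_imp_has_derivative[OF bounded_linear_vec_nth]]])
    from DERIV_compose_FDERIV[OF DERIV_flat l, of m]
    show ?thesis by (simp only: diff_conv_add_uminus mult_minus_left)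
  qed
  have p: "partial j ?f = (\<lambda>x. (c * axis j 1 $ i) * ?D x)" for j
    by (rule ext) (rule partial_eqI[OF D])
  have "C_k k ?D" by (rule C_k_add[OF Suc.IH C_k_mult[OF C_k_const Suc.IH]])
  then have "C_k k (partial j ?f)" for j unfolding p by (rule C_k_mult[OF C_k_const])
  moreover have "?f differentiable (at x)" for x using D by (rule differentiableI)
  ultimately show ?case by simp
qed

text \<open>The factor n steepens the profile, so that these smooth functions, zero outside the open
  box, tend pointwise to its indicator.\<close>

definition box_bump :: "nat \<Rightarrow> real^'n \<Rightarrow> real^'n \<Rightarrow> real^'n \<Rightarrow> real" where
  "box_bump n a b x = (\<Prod>i\<in>UNIV. flat 0 (real n * (x $ i - a $ i)) * flat 0 (real n * (b $ i - x $ i)))"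

lemma C_k_box_bump: "C_k k (box_bump n a b)"
proof -
  have "box_bump n a b = (\<lambda>x. \<Prod>i\<in>UNIV. flat 0 (real n * x $ i + - (real n * a $ i)) *
      flat 0 (- real n * x $ i + real n * b $ i))"
    by (auto simp: box_bump_def algebra_simps)
  then show ?thesis by (simp only:) (intro C_k_prod C_k_mult C_k_flat)
qed

lemma flat_0_bounds: "0 \<le> flat 0 t" "flat 0 t \<le> 1"
  by (auto simp: flat_def)

lemma box_bump_bounds: "0 \<le> box_bump n a b x" "box_bump n a b x \<le> 1"
  unfolding box_bump_def
  by (auto intro!: prod_nonneg prod_le_1 mult_nonneg_nonneg mult_le_one flat_0_bounds)

lemma box_bump_outside:
  assumes "x \<notin> box a b"
  shows "box_bump n a b x = 0"
proof -
  obtain i where "x $ i \<le> a $ i \<or> b $ i \<le> x $ i"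
    using assms by (auto simp: mem_box_cart not_less)
  then have "flat 0 (real n * (x $ i - a $ i)) * flat 0 (real n * (b $ i - x $ i)) = 0"
    by (auto simp: flat_def zero_less_mult_iff)
  then show ?thesis unfolding box_bump_def by (auto intro!: prod_zero)
qed

lemma box_bump_tendsto: "(\<lambda>n. box_bump n a b x) \<longlonglongrightarrow> indicator (box a b) x"
proof (cases "x \<in> box a b")
  case True
  have *: "(\<lambda>n. flat 0 (real n * s)) \<longlonglongrightarrow> 1" if "0 < s" for s
  proof -
    have "(\<lambda>n. exp (- (inverse (real n) * inverse s))) \<longlonglongrightarrow> exp (- (0 * inverse s))"
      by (intro tendsto_intros lim_inverse_n)
    then have "(\<lambda>n. exp (- (inverse (real n) * inverse s))) \<longlonglongrightarrow> 1" by simp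
    moreover have "\<forall>\<^sub>F n in sequentially. exp (- (inverse (real n) * inverse s)) = flat 0 (real n * s)"
      using eventually_gt_at_top[of 0]
      by eventually_elim (use that in \<open>simp add: flat_def\<close>)
    ultimately show ?thesis by (rule Lim_transform_eventually)
  qed
  have "(\<lambda>n. box_bump n a b x) \<longlonglongrightarrow> (\<Prod>i\<in>(UNIV::'a set). 1 * 1)"
    unfolding box_bump_def using True
    by (intro tendsto_prod tendsto_mult *) (auto simp: mem_box_cart)
  then show ?thesis using True by simp
qed (simp add: box_bump_outside)

lemma box_bump_test_function:
  assumes "cbox a b \<subseteq> \<Omega>"
  shows "box_bump n a b \<in> test_functions \<Omega>"
  unfolding test_functions_def
  using C_k_box_bump assms box_subset_cbox[of a b]
  by (auto intro!: exI[of _ "cbox a b"] box_bump_outside)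

text \<open>Boxes are an intersection-stable generator of the Borel sets, so vanishing integrals
  spread to all Borel sets, complements being covered by \<open>total\<close>; a density is
  determined almost everywhere by such integrals.\<close>

lemma integral_boxes_zero_imp_AE_zero:
  fixes g :: "'a::euclidean_space \<Rightarrow> real"
  assumes g: "integrable lborel g" and total: "(\<integral>x. g x \<partial>lborel) = 0"
    and boxes: "\<And>a b. (\<integral>x. indicator (box a b) x * g x \<partial>lborel) = 0"
  shows "AE x in lborel. g x = 0"
proof (rule density_unique_real[OF g integrable_zero])
  let ?E = "range (\<lambda>(a, b). box a b :: 'a set)"
  have int: "integrable lborel (\<lambda>x. indicator A x * g x)" if "A \<in> sets borel" for A
    using integrable_mult_indicator[of A lborel g] that g by simp
  fix A :: "'a set" assume "A \<in> sets lborel"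
  then have "A \<in> sets borel" by simp
  have "Int_stable ?E" by (auto simp: Int_stable_def box_Int_box)
  moreover have "?E \<subseteq> Pow UNIV" by auto
  moreover have "A \<in> sigma_sets UNIV ?E"
    using \<open>A \<in> sets borel\<close> unfolding borel_eq_box by simp
  ultimately have "A \<in> sets borel \<and> (\<integral>x. indicator A x * g x \<partial>lborel) = 0"
  proof (induction rule: sigma_sets_induct_disjoint)
    case (basic A)
    then show ?case using boxes by auto
  next
    case empty
    then show ?case by simp
  next
    case (compl A)
    have "indicator (UNIV - A) x * g x = g x - indicator A x * g x" for x
      by (auto simp: indicator_def)
    then show ?case using compl total g int by auto
  next
    case (union A)
    then have A: "\<And>i. A i \<in> sets borel" by auto
    have "((\<lambda>n. \<integral>x. indicator (\<Union>i<n. A i) x * g x \<partial>lborel) \<longlonglongrightarrow>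
        (\<integral>x. indicator (\<Union>i. A i) x * g x \<partial>lborel))"
    proof (rule integral_dominated_convergence[where w="\<lambda>x. norm (g x)"])
      show "AE x in lborel. (\<lambda>n. indicator (\<Union>i<n. A i) x * g x) \<longlonglongrightarrow> indicator (\<Union>i. A i) x * g x"
        by (auto intro!: tendsto_mult LIMSEQ_indicator_UN)
    qed (use A g in \<open>auto simp: indicator_def\<close>)
    moreover have "(\<integral>x. indicator (\<Union>i<n. A i) x * g x \<partial>lborel) = 0" for n
    proof -
      have "disjoint_family_on A {..<n}" using union.hyps(1) by (auto simp: disjoint_family_on_def)
      then have "indicator (\<Union>i<n. A i) x * g x = (\<Sum>i<n. indicator (A i) x * g x)" for x
        using indicator_UN_disjoint[of "{..<n}" A x, where ?'c=real] by (simp add: sum_distrib_right)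
      then have "(\<integral>x. indicator (\<Union>i<n. A i) x * g x \<partial>lborel) =
          (\<Sum>i<n. \<integral>x. indicator (A i) x * g x \<partial>lborel)"
        by (simp only:) (rule Bochner_Integration.integral_sum, rule int, rule A)
      then show ?thesis using union.IH by simp
    qed
    ultimately have "(\<integral>x. indicator (\<Union>i. A i) x * g x \<partial>lborel) = 0"
      by (simp add: LIMSEQ_const_iff)
    then show ?case using A by auto
  qed
  then show "(\<integral>x\<in>A. g x \<partial>lborel) = (\<integral>x\<in>A. 0 \<partial>lborel)"
    by (simp add: set_lebesgue_integral_def)
qed

text \<open>Dominated convergence replaces bumps by indicators of boxes whose closed boxes lie in
  \<Omega>. On each such box g vanishes almost everywhere, and countably many rational ones cover
  \<Omega>.\<close>

lemma test_functions_separate: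
  fixes g :: "real^'n \<Rightarrow> real"
  assumes \<Omega>: "open \<Omega>" and g: "set_integrable lborel \<Omega> g"
    and zero: "\<And>\<phi>. \<phi> \<in> test_functions \<Omega> \<Longrightarrow> (LINT x:\<Omega>|lborel. g x * \<phi> x) = 0"
  shows "AE x in lborel. x \<in> \<Omega> \<longrightarrow> g x = 0"
proof -
  define G where "G x = indicator \<Omega> x * g x" for x
  have G: "integrable lborel G" using g by (simp add: set_integrable_def G_def[abs_def])
  have box0: "(\<integral>x. indicator (box a b) x * G x \<partial>lborel) = 0" if ab: "cbox a b \<subseteq> \<Omega>" for a b
  proof -
    have "(\<lambda>n. \<integral>x. box_bump n a b x * G x \<partial>lborel) \<longlonglongrightarrow> (\<integral>x. indicator (box a b) x * G x \<partial>lborel)"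
    proof (rule integral_dominated_convergence[where w="\<lambda>x. norm (G x)"])
      show "AE x in lborel. (\<lambda>n. box_bump n a b x * G x) \<longlonglongrightarrow> indicator (box a b) x * G x"
        by (auto intro!: tendsto_mult box_bump_tendsto)
      show "(\<lambda>x. box_bump n a b x * G x) \<in> borel_measurable lborel" for n
      proof -
        have [measurable]: "box_bump n a b \<in> borel_measurable borel"
          using C_k_box_bump[of 0 n a b] by (simp add: borel_measurable_continuous_onI)
        have [measurable]: "G \<in> borel_measurable borel" using G by auto
        show ?thesis by simp
      qed
      show "AE x in lborel. norm (box_bump n a b x * G x) \<le> norm (G x)" for n
        using box_bump_bounds[of n a b] by (auto simp: abs_mult mult_left_le_one_le)
    qed (use G in auto)
    moreover have "(\<integral>x. box_bump n a b x * G x \<partial>lborel) = 0" for n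
      using zero[OF box_bump_test_function[OF ab, of n]]
      by (simp add: set_lebesgue_integral_def G_def mult_ac)
    ultimately show ?thesis by (simp add: LIMSEQ_const_iff)
  qed
  have AE_box: "AE x in lborel. x \<in> box a b \<longrightarrow> G x = 0" if ab: "cbox a b \<subseteq> \<Omega>" for a b
  proof -
    have "AE x in lborel. indicator (box a b) x * G x = 0"
    proof (rule integral_boxes_zero_imp_AE_zero)
      show "integrable lborel (\<lambda>x. indicator (box a b) x * G x)"
        using integrable_mult_indicator[of "box a b" lborel G] G by simp
      fix c d :: "real^'n"
      obtain e f where ef: "box a b \<inter> box c d = box e f" unfolding box_Int_box by blast
      have "(\<integral>x. indicator (box e f) x * G x \<partial>lborel) = 0"
      \<comment> \<open>The corners of an empty box are uncontrolled; only a nonempty one has its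
        closed box inside \<open>cbox a b\<close>.\<close>
      proof (cases "box e f = {}")
        case False
        then have "cbox e f \<subseteq> cbox a b"
          using ef by (metis Int_lower1 box_subset_cbox closed_cbox closure_box closure_minimal order_trans)
        then show ?thesis using box0 ab by auto
      qed simp
      then show "(\<integral>x. indicator (box c d) x * (indicator (box a b) x * G x) \<partial>lborel) = 0"
        unfolding ef[symmetric] by (simp add: indicator_inter_arith mult_ac)
    qed (rule box0[OF ab])
    then show ?thesis by eventually_elim (auto simp: indicator_def split: if_splits)
  qed
  let ?I = "{(a, b). cbox a b \<subseteq> \<Omega> \<and> (\<forall>i. a $ i \<in> \<rat>) \<and> (\<forall>i. b $ i \<in> \<rat>)} :: ((real^'n) \<times> (real^'n)) set"
  have cnt: "countable ?I"
  proof -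
    let ?R = "{x::real^'n. \<forall>i. x $ i \<in> \<rat>}"
    have "?R \<subseteq> (\<lambda>f. \<chi> i. f i) ` (PiE UNIV (\<lambda>_. \<rat>))"
    proof
      fix x assume "x \<in> ?R"
      then show "x \<in> (\<lambda>f. \<chi> i. f i) ` (PiE UNIV (\<lambda>_. \<rat>))"
        by (intro image_eqI[where x="\<lambda>i. x $ i"]) auto
    qed
    then have "countable ?R"
      by (meson countable_PiE countable_image countable_rat countable_subset finite)
    then have "countable (?R \<times> ?R)" by auto
    then show ?thesis by (rule countable_subset[rotated]) auto
  qed
  have "AE x in lborel. \<forall>p\<in>?I. x \<in> box (fst p) (snd p) \<longrightarrow> G x = 0"
    using AE_box by (intro AE_ball_countable') (auto intro: cnt)
  then show ?thesis
  proof eventually_elim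
    case (elim x)
    show "x \<in> \<Omega> \<longrightarrow> g x = 0"
    proof
      assume x: "x \<in> \<Omega>"
      obtain e where e: "e > 0" "ball x e \<subseteq> \<Omega>" using openE[OF \<Omega> x] by auto
      \<comment> \<open>Half the radius keeps the closed box, not only the open one, inside the ball
        of radius e.\<close>
      obtain a b where ab: "\<forall>i\<in>Basis. a \<bullet> i \<in> \<rat> \<and> b \<bullet> i \<in> \<rat>" "x \<in> box a b" "box a b \<subseteq> ball x (e / 2)"
        using rational_boxes[of "e / 2" x] e(1) by auto
      have "closure (box a b) \<subseteq> closure (ball x (e / 2))" by (rule closure_mono[OF ab(3)])
      moreover have "box a b \<noteq> {}" using ab(2) by auto
      moreover have "cball x (e / 2) \<subseteq> ball x e" using e(1) by auto
      ultimately have "cbox a b \<subseteq> \<Omega>" using e closure_box[of a b] by auto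
      moreover have "a $ i \<in> \<rat>" "b $ i \<in> \<rat>" for i
        using ab(1) axis_in_Basis_iff[of i "1::real"] by (auto simp: cart_eq_inner_axis)
      ultimately have "(a, b) \<in> ?I" by simp
      with elim ab(2) have "G x = 0" by force
      then show "g x = 0" using x by (simp add: G_def)
    qed
  qed
qed

subsection \<open>Square-integrable fields\<close>

text \<open>Passing to the extension by zero makes the integration rules for the whole space
  applicable.\<close>

lemma L2_iff:
  "L2 \<Omega> f \<longleftrightarrow> (\<lambda>x. indicator \<Omega> x *\<^sub>R f x) \<in> borel_measurable lborel \<and>
     integrable lborel (\<lambda>x. (norm (indicator \<Omega> x *\<^sub>R f x))\<^sup>2)"
proof -
  have "(norm (indicator \<Omega> x *\<^sub>R f x))\<^sup>2 = indicator \<Omega> x *\<^sub>R (norm (f x))\<^sup>2" for x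
    by (auto simp: indicator_def)
  then show ?thesis by (simp add: L2_def set_borel_measurable_def set_integrable_def)
qed

lemma L2_add:
  assumes "L2 \<Omega> f" "L2 \<Omega> g"
  shows "L2 \<Omega> (\<lambda>x. f x + g x)"
proof -
  let ?F = "\<lambda>x. indicator \<Omega> x *\<^sub>R f x" and ?G = "\<lambda>x. indicator \<Omega> x *\<^sub>R g x"
  note [measurable] = assms[unfolded L2_iff, THEN conjunct1]
  have "integrable lborel (\<lambda>x. (norm (?F x + ?G x))\<^sup>2)"
  proof (rule Bochner_Integration.integrable_bound)
    show "integrable lborel (\<lambda>x. 2 * (norm (?F x))\<^sup>2 + 2 * (norm (?G x))\<^sup>2)"
      using assms by (auto simp: L2_iff)
    have "(norm (?F x + ?G x))\<^sup>2 \<le> 2 * (norm (?F x))\<^sup>2 + 2 * (norm (?G x))\<^sup>2" for x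
    proof -
      have "(norm (?F x + ?G x))\<^sup>2 \<le> (norm (?F x) + norm (?G x))\<^sup>2"
        by (intro power_mono norm_triangle_ineq) auto
      also have "\<dots> \<le> 2 * (norm (?F x))\<^sup>2 + 2 * (norm (?G x))\<^sup>2"
        using zero_le_power2[of "norm (?F x) - norm (?G x)"] by (simp add: power2_eq_square algebra_simps)
      finally show ?thesis .
    qed
    then show "AE x in lborel. norm ((norm (?F x + ?G x))\<^sup>2) \<le> norm (2 * (norm (?F x))\<^sup>2 + 2 * (norm (?G x))\<^sup>2)"
      by (intro AE_I2) simp
  qed measurable
  moreover have "(\<lambda>x. ?F x + ?G x) \<in> borel_measurable lborel" by measurable
  ultimately show ?thesis by (simp add: L2_iff scaleR_add_right)
qed

lemma L2_linear:
  assumes T: "bounded_linear T" and f: "L2 \<Omega> f"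
  shows "L2 \<Omega> (\<lambda>x. T (f x))"
proof -
  let ?F = "\<lambda>x. indicator \<Omega> x *\<^sub>R f x"
  note [measurable] = f[unfolded L2_iff, THEN conjunct1]
  have [measurable]: "T \<in> borel_measurable borel"
    using T by (intro borel_measurable_continuous_onI linear_continuous_on)
  obtain K where K: "\<And>x. norm (T x) \<le> norm x * K" using bounded_linear.bounded[OF T] by blast
  have "integrable lborel (\<lambda>x. (norm (T (?F x)))\<^sup>2)"
  proof (rule Bochner_Integration.integrable_bound)
    show "integrable lborel (\<lambda>x. (norm (?F x))\<^sup>2 * K\<^sup>2)" using f by (auto simp: L2_iff)
    show "AE x in lborel. norm ((norm (T (?F x)))\<^sup>2) \<le> norm ((norm (?F x))\<^sup>2 * K\<^sup>2)"
    proof (rule AE_I2)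
      fix x
      have "(norm (T (?F x)))\<^sup>2 \<le> (norm (?F x) * K)\<^sup>2" by (rule power_mono[OF K]) simp
      then show "norm ((norm (T (?F x)))\<^sup>2) \<le> norm ((norm (?F x))\<^sup>2 * K\<^sup>2)"
        by (simp only: power_mult_distrib real_norm_def abs_of_nonneg zero_le_power2 mult_nonneg_nonneg)
    qed
  qed measurable
  moreover have "(\<lambda>x. T (?F x)) \<in> borel_measurable lborel" by measurable
  ultimately show ?thesis
    by (simp add: L2_iff linear.scaleR[OF bounded_linear.linear[OF T]])
qed

lemma L2_zero: "L2 \<Omega> (\<lambda>_. 0)"
  by (simp add: L2_iff)

lemma L2_sum: "finite I \<Longrightarrow> (\<And>i. i \<in> I \<Longrightarrow> L2 \<Omega> (f i)) \<Longrightarrow> L2 \<Omega> (\<lambda>x. \<Sum>i\<in>I. f i x)"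
  by (induction I rule: finite_induct) (auto intro: L2_add L2_zero)

lemma bounded_linear_axis: "bounded_linear (axis i :: 'b::euclidean_space \<Rightarrow> 'b^'m)"
  by (intro linear_conv_bounded_linear[THEN iffD1] linearI) (auto simp: axis_def vec_eq_iff)

lemma L2_vec:
  fixes G :: "'m::finite \<Rightarrow> real^'n \<Rightarrow> 'b::euclidean_space"
  assumes "\<And>i. L2 \<Omega> (G i)"
  shows "L2 \<Omega> (\<lambda>x. \<chi> i. G i x)"
proof -
  have "(\<chi> i. G i x) = (\<Sum>i\<in>UNIV. axis i (G i x))" for x
    by (simp add: vec_eq_iff axis_def if_distrib sum.delta cong: if_cong)
  then show ?thesis
    using assms by (simp only:) (intro L2_sum L2_linear[OF bounded_linear_axis] finite)
qed

lemma L2_inner_integrable: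
  assumes "L2 \<Omega> f" "L2 \<Omega> g"
  shows "set_integrable lborel \<Omega> (\<lambda>x. f x \<bullet> g x)"
proof -
  let ?F = "\<lambda>x. indicator \<Omega> x *\<^sub>R f x" and ?G = "\<lambda>x. indicator \<Omega> x *\<^sub>R g x"
  note [measurable] = assms[unfolded L2_iff, THEN conjunct1]
  have "integrable lborel (\<lambda>x. ?F x \<bullet> ?G x)"
  proof (rule Bochner_Integration.integrable_bound)
    show "integrable lborel (\<lambda>x. (norm (?F x))\<^sup>2 + (norm (?G x))\<^sup>2)"
      using assms by (auto simp: L2_iff)
    have "\<bar>?F x \<bullet> ?G x\<bar> \<le> (norm (?F x))\<^sup>2 + (norm (?G x))\<^sup>2" for x
    proof -
      have "0 \<le> norm (?F x) * norm (?G x)" by simp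
      then have "norm (?F x) * norm (?G x) \<le> (norm (?F x))\<^sup>2 + (norm (?G x))\<^sup>2"
        using zero_le_power2[of "norm (?F x) - norm (?G x)"] by (simp only: power2_diff)
      with Cauchy_Schwarz_ineq2[of "?F x" "?G x"] show ?thesis by linarith
    qed
    then show "AE x in lborel. norm (?F x \<bullet> ?G x) \<le> norm ((norm (?F x))\<^sup>2 + (norm (?G x))\<^sup>2)"
      by (intro AE_I2) simp
  qed measurable
  moreover have "(\<lambda>x. ?F x \<bullet> ?G x) = (\<lambda>x. indicator \<Omega> x *\<^sub>R (f x \<bullet> g x))"
    by (auto simp: indicator_def fun_eq_iff)
  ultimately show ?thesis by (simp only: set_integrable_def)
qed

lemma L2_inner_commute: "L2_inner \<Omega> f g = L2_inner \<Omega> g f"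
  by (simp add: L2_inner_def inner_commute)

lemma L2_inner_add:
  assumes "L2 \<Omega> f" "L2 \<Omega> g" "L2 \<Omega> w"
  shows "L2_inner \<Omega> (\<lambda>x. f x + g x) w = L2_inner \<Omega> f w + L2_inner \<Omega> g w"
  unfolding L2_inner_def inner_add_left
  by (rule set_integral_add(2)) (simp_all add: L2_inner_integrable assms)

lemma L2_inner_scale: "L2_inner \<Omega> (\<lambda>x. c *\<^sub>R f x) w = c * L2_inner \<Omega> f w"
  by (simp add: L2_inner_def)

lemma L2_inner_nonneg: "0 \<le> L2_inner \<Omega> f f"
  unfolding L2_inner_def set_lebesgue_integral_def by (rule integral_nonneg_AE) simp

lemma L2_norm_power2: "(L2_norm \<Omega> f)\<^sup>2 = L2_inner \<Omega> f f"
  by (simp add: L2_norm_def L2_inner_nonneg)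

lemma L2_inner_AE_cong:
  assumes \<Omega>: "\<Omega> \<in> sets lborel" and L2s: "L2 \<Omega> f" "L2 \<Omega> f'" "L2 \<Omega> w"
    and eq: "AE x in lborel. x \<in> \<Omega> \<longrightarrow> f x = f' x"
  shows "L2_inner \<Omega> f w = L2_inner \<Omega> f' w"
  unfolding L2_inner_def set_lebesgue_integral_def
proof (rule integral_cong_AE)
  show "AE x in lborel. indicator \<Omega> x *\<^sub>R (f x \<bullet> w x) = indicator \<Omega> x *\<^sub>R (f' x \<bullet> w x)"
    using eq by eventually_elim (auto simp: indicator_def)
qed (use L2_inner_integrable[OF L2s(1,3)] L2_inner_integrable[OF L2s(2,3)]
      in \<open>auto simp: set_integrable_def\<close>)

lemma L2_inner_mono:
  assumes "L2 \<Omega> f" "L2 \<Omega> g" "\<And>x. f x \<bullet> f x \<le> c * (g x \<bullet> g x)"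
  shows "L2_inner \<Omega> f f \<le> c * L2_inner \<Omega> g g"
proof -
  have "L2_inner \<Omega> f f \<le> (LINT x:\<Omega>|lborel. c * (g x \<bullet> g x))"
    unfolding L2_inner_def
    using assms by (intro set_integral_mono set_integrable_mult_right L2_inner_integrable) auto
  then show ?thesis by (simp add: L2_inner_def)
qed

lemma fun_subspace_L2: "fun_subspace {f. L2 \<Omega> f}"
  unfolding fun_subspace_def
  using L2_add L2_zero L2_linear[OF bounded_linear_scaleR_right] by auto

lemma psd_form_L2_inner: "psd_form {f. L2 \<Omega> f} (L2_inner \<Omega>)"
  unfolding psd_form_def
  using L2_inner_add L2_inner_scale L2_inner_commute L2_inner_nonneg by blast

lemma L2_Cauchy_Schwarz:
  assumes "L2 \<Omega> f" "L2 \<Omega> g"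
  shows "(L2_inner \<Omega> f g)\<^sup>2 \<le> L2_inner \<Omega> f f * L2_inner \<Omega> g g"
  using psd_form_Cauchy_Schwarz[OF fun_subspace_L2 psd_form_L2_inner] assms by auto

text \<open>The weak gradient, being a choice, is linear only almost everywhere.\<close>

definition ae_linear ::
    "(real^'n) set \<Rightarrow> ('a \<Rightarrow> 'c::real_vector) set \<Rightarrow> (('a \<Rightarrow> 'c) \<Rightarrow> real^'n \<Rightarrow> 'b::euclidean_space) \<Rightarrow> bool" where
  "ae_linear \<Omega> W D \<longleftrightarrow> (\<forall>u\<in>W. L2 \<Omega> (D u)) \<and>
     (\<forall>u\<in>W. \<forall>v\<in>W. AE x in lborel. x \<in> \<Omega> \<longrightarrow> D (\<lambda>x. u x + v x) x = D u x + D v x) \<and>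
     (\<forall>c. \<forall>u\<in>W. AE x in lborel. x \<in> \<Omega> \<longrightarrow> D (\<lambda>x. c *\<^sub>R u x) x = c *\<^sub>R D u x)"

lemma ae_linear_L2: "ae_linear \<Omega> W D \<Longrightarrow> u \<in> W \<Longrightarrow> L2 \<Omega> (D u)"
  by (simp add: ae_linear_def)

lemma ae_linear_mono: "ae_linear \<Omega> W D \<Longrightarrow> W' \<subseteq> W \<Longrightarrow> ae_linear \<Omega> W' D"
  unfolding ae_linear_def by blast

lemma ae_linear_compose:
  assumes T: "bounded_linear T" and D: "ae_linear \<Omega> W D"
  shows "ae_linear \<Omega> W (\<lambda>u x. T (D u x))"
proof -
  interpret T: bounded_linear T by (rule T)
  have "AE x in lborel. x \<in> \<Omega> \<longrightarrow> T (D (\<lambda>x. u x + v x) x) = T (D u x) + T (D v x)"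
    if "u \<in> W" "v \<in> W" for u v
  proof -
    have "AE x in lborel. x \<in> \<Omega> \<longrightarrow> D (\<lambda>x. u x + v x) x = D u x + D v x"
      using D that by (simp add: ae_linear_def)
    then show ?thesis by eventually_elim (simp add: T.add)
  qed
  moreover have "AE x in lborel. x \<in> \<Omega> \<longrightarrow> T (D (\<lambda>x. c *\<^sub>R u x) x) = c *\<^sub>R T (D u x)"
    if "u \<in> W" for c u
  proof -
    have "AE x in lborel. x \<in> \<Omega> \<longrightarrow> D (\<lambda>x. c *\<^sub>R u x) x = c *\<^sub>R D u x"
      using D that by (simp add: ae_linear_def)
    then show ?thesis by eventually_elim (simp add: T.scaleR)
  qed
  ultimately show ?thesis
    using D by (auto simp: ae_linear_def intro: L2_linear[OF T])
qed

text \<open>The integral sees D only up to null sets, so almost everywhere linearity of D becomes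
  exact linearity of the pairing.\<close>

lemma ae_linear_inner:
  assumes W: "fun_subspace W" and \<Omega>: "\<Omega> \<in> sets lborel" and D: "ae_linear \<Omega> W D" and w: "L2 \<Omega> w"
  shows "\<And>u v. u \<in> W \<Longrightarrow> v \<in> W \<Longrightarrow>
      L2_inner \<Omega> (D (\<lambda>x. u x + v x)) w = L2_inner \<Omega> (D u) w + L2_inner \<Omega> (D v) w"
    and "\<And>c u. u \<in> W \<Longrightarrow> L2_inner \<Omega> (D (\<lambda>x. c *\<^sub>R u x)) w = c * L2_inner \<Omega> (D u) w"
proof -
  note L2 = ae_linear_L2[OF D]
  show "L2_inner \<Omega> (D (\<lambda>x. u x + v x)) w = L2_inner \<Omega> (D u) w + L2_inner \<Omega> (D v) w"
    if uv: "u \<in> W" "v \<in> W" for u v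
  proof -
    have "L2_inner \<Omega> (D (\<lambda>x. u x + v x)) w = L2_inner \<Omega> (\<lambda>x. D u x + D v x) w"
      using D uv w by (intro L2_inner_AE_cong \<Omega> L2 L2_add fun_subspaceD(2)[OF W])
        (simp_all add: ae_linear_def)
    then show ?thesis using L2_inner_add[OF L2[OF uv(1)] L2[OF uv(2)] w] by simp
  qed
  show "L2_inner \<Omega> (D (\<lambda>x. c *\<^sub>R u x)) w = c * L2_inner \<Omega> (D u) w" if u: "u \<in> W" for c u
  proof -
    have "L2_inner \<Omega> (D (\<lambda>x. c *\<^sub>R u x)) w = L2_inner \<Omega> (\<lambda>x. c *\<^sub>R D u x) w"
      using D u w by (intro L2_inner_AE_cong \<Omega> L2 L2_linear[OF bounded_linear_scaleR_right]
          fun_subspaceD(3)[OF W]) (simp_all add: ae_linear_def)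
    then show ?thesis by (simp add: L2_inner_scale)
  qed
qed

lemma psd_form_ae_linear:
  assumes W: "fun_subspace W" and \<Omega>: "\<Omega> \<in> sets lborel" and D: "ae_linear \<Omega> W D"
  shows "psd_form W (\<lambda>u v. L2_inner \<Omega> (D u) (D v))"
  unfolding psd_form_def
  using ae_linear_inner[OF W \<Omega> D ae_linear_L2[OF D]]
  by (auto simp: L2_inner_nonneg L2_inner_commute)

lemma psd_form_sum:
  assumes "psd_form W c" "psd_form W d" "0 \<le> r" "0 \<le> t"
  shows "psd_form W (\<lambda>u v. r * c u v + t * d u v)"
  using assms unfolding psd_form_def by (simp add: algebra_simps)

subsection \<open>Weak gradients\<close>

lemma test_functionsD:
  assumes "\<phi> \<in> test_functions \<Omega>"
  obtains S where "compact S" "S \<subseteq> \<Omega>" "\<And>x. x \<notin> S \<Longrightarrow> \<phi> x = 0"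
  using assms by (auto simp: test_functions_def)

lemma test_functions_C_k: "\<phi> \<in> test_functions \<Omega> \<Longrightarrow> C_k k \<phi>"
  by (simp add: test_functions_def)

lemma test_functions_diff: "\<phi> \<in> test_functions \<Omega> \<Longrightarrow> \<phi> differentiable (at x)"
  using test_functions_C_k[of \<phi> \<Omega> "Suc 0"] by simp

lemma test_functions_cont: "\<phi> \<in> test_functions \<Omega> \<Longrightarrow> continuous_on UNIV \<phi>"
  using test_functions_C_k[of \<phi> \<Omega> 0] by simp

lemma test_functions_outside: "\<phi> \<in> test_functions \<Omega> \<Longrightarrow> x \<notin> \<Omega> \<Longrightarrow> \<phi> x = 0"
  by (auto simp: test_functions_def)

lemma test_functions_partial:
  assumes "\<phi> \<in> test_functions \<Omega>"
  shows "partial i \<phi> \<in> test_functions \<Omega>"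
proof -
  obtain S where S: "compact S" "S \<subseteq> \<Omega>" "\<And>x. x \<notin> S \<Longrightarrow> \<phi> x = 0"
    using test_functionsD[OF assms] by metis
  have "partial i \<phi> x = 0" if "x \<notin> S" for x
  proof -
    have "partial i \<phi> x = partial i (\<lambda>_. 0) x"
      using S that compact_imp_closed[OF S(1)] test_functions_diff[OF assms]
      by (intro partial_cong_open[of "- S"]) auto
    then show ?thesis by (simp add: partial_const)
  qed
  moreover have "C_k k (partial i \<phi>)" for k
    using test_functions_C_k[OF assms, of "Suc k"] by simp
  ultimately show ?thesis using S by (auto simp: test_functions_def)
qed

lemma test_functions_mult:
  assumes "\<phi> \<in> test_functions \<Omega>" "\<psi> \<in> test_functions \<Omega>"
  shows "(\<lambda>x. \<phi> x * \<psi> x) \<in> test_functions \<Omega>"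
proof -
  obtain S where S: "compact S" "S \<subseteq> \<Omega>" "\<And>x. x \<notin> S \<Longrightarrow> \<phi> x = 0"
    using test_functionsD[OF assms(1)] by metis
  then show ?thesis
    using C_k_mult[OF test_functions_C_k[OF assms(1)] test_functions_C_k[OF assms(2)]]
    by (auto simp: test_functions_def intro!: exI[of _ S])
qed

lemma fun_subspace_test_functions: "fun_subspace (test_functions \<Omega>)"
  unfolding fun_subspace_def
proof (intro conjI ballI allI)
  show "(\<lambda>_. 0) \<in> test_functions \<Omega>"
    by (auto simp: test_functions_def C_k_const intro!: exI[of _ "{}"])
  fix \<phi> \<psi> assume p: "\<phi> \<in> test_functions \<Omega>" "\<psi> \<in> test_functions \<Omega>"
  obtain S where S: "compact S" "S \<subseteq> \<Omega>" "\<And>x. x \<notin> S \<Longrightarrow> \<phi> x = 0"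
    using test_functionsD[OF p(1)] by metis
  obtain T where T: "compact T" "T \<subseteq> \<Omega>" "\<And>x. x \<notin> T \<Longrightarrow> \<psi> x = 0"
    using test_functionsD[OF p(2)] by metis
  have "\<phi> x + \<psi> x = 0" if "x \<notin> S \<union> T" for x
    using S(3)[of x] T(3)[of x] that by simp
  moreover have "compact (S \<union> T)" "S \<union> T \<subseteq> \<Omega>" using S T by (auto intro: compact_Un)
  ultimately show "(\<lambda>x. \<phi> x + \<psi> x) \<in> test_functions \<Omega>"
    using C_k_add[OF test_functions_C_k[OF p(1)] test_functions_C_k[OF p(2)]]
    unfolding test_functions_def by blast
next
  fix c \<phi> assume p: "\<phi> \<in> test_functions \<Omega>"
  then show "(\<lambda>x. c *\<^sub>R \<phi> x) \<in> test_functions \<Omega>"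
    using C_k_mult[OF C_k_const test_functions_C_k[OF p]]
    by (auto simp: test_functions_def)
qed

lemma test_functions_integrable:
  assumes "\<phi> \<in> test_functions \<Omega>"
  shows "integrable lborel \<phi>"
proof -
  obtain S where S: "compact S" "S \<subseteq> \<Omega>" "\<And>x. x \<notin> S \<Longrightarrow> \<phi> x = 0"
    using test_functionsD[OF assms] by metis
  have "integrable lborel (\<lambda>x. indicator S x *\<^sub>R \<phi> x)"
    using S(1) test_functions_cont[OF assms] continuous_on_subset
    by (intro borel_integrable_compact) auto
  moreover have "(\<lambda>x. indicator S x *\<^sub>R \<phi> x) = \<phi>"
    using S(3) by (auto simp: indicator_def fun_eq_iff)
  ultimately show ?thesis by (simp only:)
qed

lemma test_functions_L2:
  assumes "\<phi> \<in> test_functions \<Omega>"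
  shows "L2 \<Omega> \<phi>"
proof -
  have eq: "(\<lambda>x. indicator \<Omega> x *\<^sub>R \<phi> x) = \<phi>"
      "(\<lambda>x. (norm (indicator \<Omega> x *\<^sub>R \<phi> x))\<^sup>2) = (\<lambda>x. \<phi> x * \<phi> x)"
    using test_functions_outside[OF assms] by (auto simp: indicator_def fun_eq_iff power2_eq_square)
  show ?thesis
    unfolding L2_iff eq
    using test_functions_integrable[OF test_functions_mult[OF assms assms]]
      test_functions_integrable[OF assms] by auto
qed

text \<open>By translation invariance the difference quotients of \<open>F\<close> have integral zero; their limit is
  the derivative, and the convergence is dominated.\<close>

lemma integral_partial_zero:
  fixes F :: "real^'n \<Rightarrow> real"
  assumes F: "F \<in> test_functions \<Omega>"
  shows "(\<integral>x. partial i F x \<partial>lborel) = 0"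
proof -
  let ?e = "axis i 1 :: real^'n"
  let ?D = "partial i F"
  let ?h = "\<lambda>n. inverse (real (Suc n))"
  let ?q = "\<lambda>n x. (F (x + ?h n *\<^sub>R ?e) - F x) / ?h n"
  have int: "integrable lborel F" by (rule test_functions_integrable[OF F])
  have D: "((\<lambda>t. F (x + t *\<^sub>R ?e)) has_real_derivative ?D (x + t *\<^sub>R ?e)) (at t)" for x t
  proof -
    let ?y = "x + t *\<^sub>R ?e"
    have F': "(F has_derivative frechet_derivative F (at ?y)) (at ?y)"
      using test_functions_diff[OF F] frechet_derivative_works by blast
    have l: "((\<lambda>t. x + t *\<^sub>R ?e) has_derivative (\<lambda>h. h *\<^sub>R ?e)) (at t)"
      by (auto intro!: derivative_eq_intros)
    have "((\<lambda>t. F (x + t *\<^sub>R ?e)) has_derivative (\<lambda>h. frechet_derivative F (at ?y) (h *\<^sub>R ?e))) (at t)"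
      by (rule has_derivative_compose[OF l F'])
    moreover have "frechet_derivative F (at ?y) (h *\<^sub>R ?e) = ?D ?y * h" for h
      using linear.scaleR[OF has_derivative_linear[OF F']] by (simp add: partial_def)
    ultimately show ?thesis by (simp add: has_field_derivative_def)
  qed
  obtain S where S: "compact S" "\<And>x. x \<notin> S \<Longrightarrow> F x = 0" using test_functionsD[OF F] by metis
  obtain S' where S': "compact S'" "\<And>x. x \<notin> S' \<Longrightarrow> ?D x = 0"
    using test_functionsD[OF test_functions_partial[OF F, of i]] by metis
  have "bounded (?D ` S')"
    using test_functions_cont[OF test_functions_partial[OF F]] S'(1)
    by (meson compact_continuous_image compact_imp_bounded continuous_on_subset subset_UNIV)
  then obtain C0 where C0: "\<And>x. x \<in> S' \<Longrightarrow> \<bar>?D x\<bar> \<le> C0" by (auto simp: bounded_iff)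
  \<comment> \<open>If \<open>S'\<close> is empty, nothing forces C0 to be nonnegative.\<close>
  define C where "C = max C0 0"
  have C: "\<bar>?D x\<bar> \<le> C" for x
    using C0[of x] S'(2)[of x] by (cases "x \<in> S'") (auto simp: C_def)
  obtain R where R: "\<And>x. x \<in> S \<Longrightarrow> norm x \<le> R"
    using compact_imp_bounded[OF S(1)] by (auto simp: bounded_iff)
  \<comment> \<open>The steps 1 / (n + 1) are at most 1, so both F and its translate vanish outside
    this ball.\<close>
  let ?B = "cball (0::real^'n) (R + 1)"
  have bound: "\<bar>?q n x\<bar> \<le> C * indicator ?B x" for n x
  proof (cases "x \<in> ?B")
    case True
    have h: "0 < ?h n" by simp
    obtain z where z: "F (x + ?h n *\<^sub>R ?e) - F (x + 0 *\<^sub>R ?e) = (?h n - 0) * ?D (x + z *\<^sub>R ?e)"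
      using MVT2[OF h, of "\<lambda>t. F (x + t *\<^sub>R ?e)" "\<lambda>t. ?D (x + t *\<^sub>R ?e)"] D by blast
    then have "?q n x = ?D (x + z *\<^sub>R ?e)" by (simp add: field_simps)
    then show ?thesis using C True by simp
  next
    case False
    then have nx: "R + 1 < norm x" by simp
    have "norm (?h n *\<^sub>R ?e) \<le> 1" by (simp add: norm_axis_1 inverse_le_1_iff)
    then have "R < norm (x + ?h n *\<^sub>R ?e)"
      using nx norm_triangle_ineq4[of "x + ?h n *\<^sub>R ?e" "?h n *\<^sub>R ?e"] by simp
    then have "F (x + ?h n *\<^sub>R ?e) = 0" using S(2) R by (meson not_less)
    moreover have "F x = 0" using S(2) R[of x] nx by (meson add_increasing2 not_less order_less_le_trans zero_le_one less_add_one less_trans)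
    ultimately show ?thesis using False by simp
  qed
  have shift: "integrable lborel (\<lambda>x. F (x + c))" "(\<integral>x. F (x + c) \<partial>lborel) = (\<integral>x. F x \<partial>lborel)" for c
  proof -
    have [measurable]: "F \<in> borel_measurable borel" using int by auto
    have "integrable (distr lborel borel ((+) c)) F" "(\<integral>x. F x \<partial>distr lborel borel ((+) c)) = (\<integral>x. F x \<partial>lborel)"
      using int by (simp_all only: lborel_distr_plus)
    then show "integrable lborel (\<lambda>x. F (x + c))" "(\<integral>x. F (x + c) \<partial>lborel) = (\<integral>x. F x \<partial>lborel)"
      by (simp_all add: integrable_distr_eq integral_distr add.commute)
  qed
  have q0: "(\<integral>x. ?q n x \<partial>lborel) = 0" for n
    using shift[of "?h n *\<^sub>R ?e"] int by simp
  have "(\<lambda>n. \<integral>x. ?q n x \<partial>lborel) \<longlonglongrightarrow> (\<integral>x. ?D x \<partial>lborel)"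
  proof (rule integral_dominated_convergence[where w="\<lambda>x. C * indicator ?B x"])
    show "?D \<in> borel_measurable lborel"
      using test_functions_integrable[OF test_functions_partial[OF F]] by auto
    show "?q n \<in> borel_measurable lborel" for n
      using shift(1)[of "?h n *\<^sub>R ?e"] int by (intro borel_measurable_divide borel_measurable_diff) auto
    show "integrable lborel (\<lambda>x. C * indicator ?B x :: real)"
      using integrable_indicator_iff[of lborel ?B] emeasure_lborel_cball_finite[of 0 "R + 1"]
      by (auto simp: less_top[symmetric])
    show "AE x in lborel. (\<lambda>n. ?q n x) \<longlonglongrightarrow> ?D x"
    proof (rule AE_I2)
      fix x
      have "((\<lambda>h. (F (x + (0 + h) *\<^sub>R ?e) - F (x + 0 *\<^sub>R ?e)) / h) \<longlongrightarrow> ?D (x + 0 *\<^sub>R ?e)) (at 0)"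
        using D[of x 0] by (simp only: DERIV_def)
      moreover have "filterlim ?h (at 0) sequentially"
        using LIMSEQ_inverse_real_of_nat by (simp add: filterlim_at)
      ultimately have "(\<lambda>n. (F (x + (0 + ?h n) *\<^sub>R ?e) - F (x + 0 *\<^sub>R ?e)) / ?h n) \<longlonglongrightarrow> ?D (x + 0 *\<^sub>R ?e)"
        by (rule filterlim_compose)
      then show "(\<lambda>n. ?q n x) \<longlonglongrightarrow> ?D x" by simp
    qed
    show "AE x in lborel. norm (?q n x) \<le> C * indicator ?B x" for n
      using bound by (intro AE_I2) (simp only: real_norm_def)
  qed
  then show ?thesis unfolding q0 by (simp add: LIMSEQ_const_iff)
qed

text \<open>Integration by parts, from the product rule and \<open>integral_partial_zero\<close>. It
  places test functions in \<open>H1\<close>, so that the differences u - \<phi> in the definition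
  of \<open>H10\<close> have weak gradients as well.\<close>

lemma test_functions_weak_grad:
  assumes \<phi>: "\<phi> \<in> test_functions \<Omega>"
  shows "has_weak_grad \<Omega> \<phi> (\<lambda>x. \<chi> i. partial i \<phi> x)"
  unfolding has_weak_grad_def
proof (intro conjI ballI allI)
  show "L2 \<Omega> (\<lambda>x. \<chi> i. partial i \<phi> x)"
    by (intro L2_vec test_functions_L2 test_functions_partial \<phi>)
  fix \<psi> i assume \<psi>: "\<psi> \<in> test_functions \<Omega>"
  note d\<phi> = test_functions_partial[OF \<phi>, of i] and d\<psi> = test_functions_partial[OF \<psi>, of i]
  have "0 = (\<integral>x. partial i (\<lambda>x. \<phi> x * \<psi> x) x \<partial>lborel)"
    by (rule integral_partial_zero[OF test_functions_mult[OF \<phi> \<psi>], symmetric])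
  also have "\<dots> = (\<integral>x. \<phi> x * partial i \<psi> x + partial i \<phi> x * \<psi> x \<partial>lborel)"
    using partial_mult test_functions_diff[OF \<phi>] test_functions_diff[OF \<psi>] by metis
  also have "\<dots> = (\<integral>x. \<phi> x * partial i \<psi> x \<partial>lborel) + (\<integral>x. partial i \<phi> x * \<psi> x \<partial>lborel)"
    by (rule Bochner_Integration.integral_add[OF
          test_functions_integrable[OF test_functions_mult[OF \<phi> d\<psi>]]
          test_functions_integrable[OF test_functions_mult[OF d\<phi> \<psi>]]])
  finally have "(\<integral>x. \<phi> x * partial i \<psi> x \<partial>lborel) = - (\<integral>x. partial i \<phi> x * \<psi> x \<partial>lborel)" by simp
  moreover have "(\<lambda>x. indicator \<Omega> x *\<^sub>R (\<phi> x * partial i \<psi> x)) = (\<lambda>x. \<phi> x * partial i \<psi> x)"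
    "(\<lambda>x. indicator \<Omega> x *\<^sub>R (partial i \<phi> x * \<psi> x)) = (\<lambda>x. partial i \<phi> x * \<psi> x)"
    using test_functions_outside[OF \<phi>] test_functions_outside[OF \<psi>]
    by (auto simp: indicator_def fun_eq_iff)
  ultimately show "(LINT x:\<Omega>|lborel. \<phi> x * partial i \<psi> x) = - (LINT x:\<Omega>|lborel. (\<chi> i. partial i \<phi> x) $ i * \<psi> x)"
    by (simp only: set_lebesgue_integral_def vec_lambda_beta)
qed

lemma has_weak_grad_integrable:
  assumes "L2 \<Omega> u" "\<phi> \<in> test_functions \<Omega>"
  shows "set_integrable lborel \<Omega> (\<lambda>x. u x * partial i \<phi> x)" "set_integrable lborel \<Omega> (\<lambda>x. u x * \<phi> x)"
  using L2_inner_integrable[OF assms(1) test_functions_L2] test_functions_partial assms by (auto simp: inner_real_def)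

lemma L2_nth: "L2 \<Omega> g \<Longrightarrow> L2 \<Omega> (\<lambda>x. g x $ i)"
  by (rule L2_linear[OF bounded_linear_vec_nth])

lemma has_weak_grad_add:
  assumes u: "L2 \<Omega> u" "has_weak_grad \<Omega> u g" and v: "L2 \<Omega> v" "has_weak_grad \<Omega> v h"
  shows "has_weak_grad \<Omega> (\<lambda>x. u x + v x) (\<lambda>x. g x + h x)"
  unfolding has_weak_grad_def
proof (intro conjI ballI allI)
  have g: "L2 \<Omega> g" and h: "L2 \<Omega> h" using u v by (auto simp: has_weak_grad_def)
  show "L2 \<Omega> (\<lambda>x. g x + h x)" by (rule L2_add[OF g h])
  fix \<phi> i assume p: "\<phi> \<in> test_functions \<Omega>"
  show "(LINT x:\<Omega>|lborel. (u x + v x) * partial i \<phi> x) = - (LINT x:\<Omega>|lborel. (g x + h x) $ i * \<phi> x)"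
    using u(2) v(2) p has_weak_grad_integrable[OF u(1) p] has_weak_grad_integrable[OF v(1) p]
      has_weak_grad_integrable[OF L2_nth[OF g] p] has_weak_grad_integrable[OF L2_nth[OF h] p]
    by (simp add: distrib_right set_integral_add has_weak_grad_def)
qed

lemma has_weak_grad_scale:
  assumes u: "has_weak_grad \<Omega> u g"
  shows "has_weak_grad \<Omega> (\<lambda>x. c *\<^sub>R u x) (\<lambda>x. c *\<^sub>R g x)"
  using assms L2_linear[OF bounded_linear_scaleR_right, of \<Omega> g c]
  by (auto simp: has_weak_grad_def mult.assoc)

text \<open>Boundedness of \<Omega> makes the constant 1 square integrable, hence each component of
  g - h integrable over \<Omega>, as \<open>test_functions_separate\<close> requires.\<close>

lemma has_weak_grad_unique:
  fixes \<Omega> :: "(real^'n) set"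
  assumes \<Omega>: "open \<Omega>" "bounded \<Omega>" and g: "has_weak_grad \<Omega> u g" and h: "has_weak_grad \<Omega> u h"
  shows "AE x in lborel. x \<in> \<Omega> \<longrightarrow> g x = h x"
proof -
  have L2: "L2 \<Omega> g" "L2 \<Omega> h" using g h by (auto simp: has_weak_grad_def)
  have one: "L2 \<Omega> (\<lambda>_. 1 :: real)"
  proof -
    have "emeasure lborel \<Omega> < \<infinity>" using \<Omega>(2) by (rule emeasure_bounded_finite)
    then have "integrable lborel (indicator \<Omega> :: _ \<Rightarrow> real)" using \<Omega>(1) by (intro integrable_real_indicator) auto
    moreover have "(norm (indicator \<Omega> x *\<^sub>R (1::real)))\<^sup>2 = indicator \<Omega> x" for x
      by (auto simp: indicator_def)
    ultimately show ?thesis using \<Omega>(1) by (simp add: L2_iff)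
  qed
  have "AE x in lborel. x \<in> \<Omega> \<longrightarrow> g x $ i - h x $ i = 0" for i
  proof (rule test_functions_separate[OF \<Omega>(1)])
    have "L2 \<Omega> (\<lambda>x. g x $ i + (-1) *\<^sub>R h x $ i)"
      by (intro L2_add L2_nth L2_linear[OF bounded_linear_scaleR_right] L2)
    from L2_inner_integrable[OF this one] show "set_integrable lborel \<Omega> (\<lambda>x. g x $ i - h x $ i)" by simp
    fix \<phi> assume p: "\<phi> \<in> test_functions \<Omega>"
    have "(LINT x:\<Omega>|lborel. g x $ i * \<phi> x) = (LINT x:\<Omega>|lborel. h x $ i * \<phi> x)"
      using g h p by (simp add: has_weak_grad_def)
    then show "(LINT x:\<Omega>|lborel. (g x $ i - h x $ i) * \<phi> x) = 0"
      using has_weak_grad_integrable(2)[OF L2_nth[OF L2(1)] p] has_weak_grad_integrable(2)[OF L2_nth[OF L2(2)] p]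
      by (simp add: left_diff_distrib set_integral_diff)
  qed
  then have "AE x in lborel. \<forall>i. x \<in> \<Omega> \<longrightarrow> g x $ i - h x $ i = 0" unfolding AE_all_countable by blast
  then show ?thesis by eventually_elim (simp add: vec_eq_iff)
qed

lemma H1D: "u \<in> H1 \<Omega> \<Longrightarrow> L2 \<Omega> u" "u \<in> H1 \<Omega> \<Longrightarrow> has_weak_grad \<Omega> u (weak_grad \<Omega> u)"
  unfolding weak_grad_def H1_def by (simp, metis (mono_tags, lifting) mem_Collect_eq someI_ex)

lemma fun_subspace_H1: "fun_subspace (H1 \<Omega>)"
  unfolding fun_subspace_def
proof (intro conjI ballI allI)
  show "(\<lambda>_. 0) \<in> H1 \<Omega>"
    by (auto simp: H1_def has_weak_grad_def L2_zero intro!: exI[of _ "\<lambda>_. 0"])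
  show "(\<lambda>x. u x + v x) \<in> H1 \<Omega>" if "u \<in> H1 \<Omega>" "v \<in> H1 \<Omega>" for u v
    using has_weak_grad_add[OF H1D[OF that(1)] H1D[OF that(2)]] L2_add[OF H1D(1)[OF that(1)] H1D(1)[OF that(2)]]
    by (auto simp: H1_def)
  show "(\<lambda>x. c *\<^sub>R u x) \<in> H1 \<Omega>" if "u \<in> H1 \<Omega>" for c u
    using has_weak_grad_scale[OF H1D(2)[OF that], of c] L2_linear[OF bounded_linear_scaleR_right H1D(1)[OF that], of c]
    by (auto simp: H1_def)
qed

lemma ae_linear_weak_grad:
  assumes \<Omega>: "open \<Omega>" "bounded \<Omega>"
  shows "ae_linear \<Omega> (H1 \<Omega>) (weak_grad \<Omega>)"
  unfolding ae_linear_def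
proof (intro conjI ballI allI)
  note S = fun_subspaceD[OF fun_subspace_H1]
  show "L2 \<Omega> (weak_grad \<Omega> u)" if "u \<in> H1 \<Omega>" for u
    using H1D(2)[OF that] by (simp add: has_weak_grad_def)
  show "AE x in lborel. x \<in> \<Omega> \<longrightarrow> weak_grad \<Omega> (\<lambda>x. u x + v x) x = weak_grad \<Omega> u x + weak_grad \<Omega> v x"
    if uv: "u \<in> H1 \<Omega>" "v \<in> H1 \<Omega>" for u v
    by (rule has_weak_grad_unique[OF \<Omega> H1D(2)[OF S(2)[OF uv]] has_weak_grad_add[OF H1D[OF uv(1)] H1D[OF uv(2)]]])
  show "AE x in lborel. x \<in> \<Omega> \<longrightarrow> weak_grad \<Omega> (\<lambda>x. c *\<^sub>R u x) x = c *\<^sub>R weak_grad \<Omega> u x"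
    if u: "u \<in> H1 \<Omega>" for c u
    by (rule has_weak_grad_unique[OF \<Omega> H1D(2)[OF S(3)[OF u]] has_weak_grad_scale[OF H1D(2)[OF u]]])
qed

section \<open>The finite-element spaces and operators\<close>

text \<open>The factors 1 give the literal shape of \<open>psd_form_sum\<close>.\<close>

definition H1_inner :: "(real^'n) set \<Rightarrow> (real^'n \<Rightarrow> real) \<Rightarrow> (real^'n \<Rightarrow> real) \<Rightarrow> real" where
  "H1_inner \<Omega> u v = 1 * L2_inner \<Omega> u v + 1 * L2_inner \<Omega> (weak_grad \<Omega> u) (weak_grad \<Omega> v)"

lemma H1_norm_eq: "H1_norm \<Omega> u = sqrt (H1_inner \<Omega> u u)"
  by (simp add: H1_norm_def H1_inner_def L2_norm_power2)

lemma ae_linear_id: "W \<subseteq> H1 \<Omega> \<Longrightarrow> ae_linear \<Omega> W (\<lambda>u. u)"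
  by (auto simp: ae_linear_def intro: H1D(1))

lemma psd_form_H1_inner:
  assumes \<Omega>: "open \<Omega>" "bounded \<Omega>"
  shows "psd_form (H1 \<Omega>) (H1_inner \<Omega>)"
  unfolding H1_inner_def[abs_def]
  using \<Omega>(1) by (intro psd_form_sum psd_form_ae_linear fun_subspace_H1 ae_linear_id ae_linear_weak_grad[OF \<Omega>]) auto

lemma test_functions_H1: "test_functions \<Omega> \<subseteq> H1 \<Omega>"
  using test_functions_weak_grad test_functions_L2 by (auto simp: H1_def)

lemma tendsto_sqrt_0_iff:
  assumes "\<And>k::nat. 0 \<le> h k"
  shows "(\<lambda>k. sqrt (h k)) \<longlonglongrightarrow> 0 \<longleftrightarrow> h \<longlonglongrightarrow> 0"
proof
  assume "(\<lambda>k. sqrt (h k)) \<longlonglongrightarrow> 0"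
  then have "(\<lambda>k. (sqrt (h k))\<^sup>2) \<longlonglongrightarrow> 0\<^sup>2" by (rule tendsto_power)
  then show "h \<longlonglongrightarrow> 0" using assms by simp
next
  assume "h \<longlonglongrightarrow> 0"
  then show "(\<lambda>k. sqrt (h k)) \<longlonglongrightarrow> 0" using tendsto_real_sqrt[of h 0] by simp
qed

text \<open>Squaring the norm turns convergence into a statement about a semidefinite form, so sums
  are handled by \<open>psd_form_add_le\<close>.\<close>

lemma H10_iff:
  assumes \<Omega>: "open \<Omega>" "bounded \<Omega>"
  shows "u \<in> H10 \<Omega> \<longleftrightarrow> u \<in> H1 \<Omega> \<and> (\<exists>\<phi>. (\<forall>k::nat. \<phi> k \<in> test_functions \<Omega>) \<and>
     (\<lambda>k. H1_inner \<Omega> (\<lambda>x. u x - \<phi> k x) (\<lambda>x. u x - \<phi> k x)) \<longlonglongrightarrow> 0)"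
proof -
  have "(\<lambda>k. H1_norm \<Omega> (\<lambda>x. u x - \<phi> k x)) \<longlonglongrightarrow> 0 \<longleftrightarrow>
      (\<lambda>k. H1_inner \<Omega> (\<lambda>x. u x - \<phi> k x) (\<lambda>x. u x - \<phi> k x)) \<longlonglongrightarrow> 0" for \<phi> :: "nat \<Rightarrow> _"
    unfolding H1_norm_eq
    by (rule tendsto_sqrt_0_iff) (simp add: H1_inner_def L2_inner_nonneg)
  then show ?thesis by (simp add: H10_def)
qed

lemma fun_subspace_H10:
  assumes \<Omega>: "open \<Omega>" "bounded \<Omega>"
  shows "fun_subspace (H10 \<Omega>)"
  unfolding fun_subspace_def
proof (intro conjI ballI allI)
  note H = fun_subspaceD[OF fun_subspace_H1[of \<Omega>]] and T = fun_subspaceD[OF fun_subspace_test_functions[of \<Omega>]]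
  note form = psd_form_H1_inner[OF \<Omega>]
  have zero: "H1_inner \<Omega> (\<lambda>_. 0) (\<lambda>_. 0) = 0"
    using psd_formD(2)[OF form H(1) H(1), of 0] by simp
  show "(\<lambda>_. 0) \<in> H10 \<Omega>"
    unfolding H10_iff[OF \<Omega>] using H(1) T(1)
    by (auto intro!: exI[of _ "\<lambda>_ _. 0"] simp: zero)
  fix u assume u: "u \<in> H10 \<Omega>"
  then obtain \<phi> :: "nat \<Rightarrow> _" where \<phi>: "\<And>k. \<phi> k \<in> test_functions \<Omega>"
    "(\<lambda>k. H1_inner \<Omega> (\<lambda>x. u x - \<phi> k x) (\<lambda>x. u x - \<phi> k x)) \<longlonglongrightarrow> 0" and u1: "u \<in> H1 \<Omega>"
    unfolding H10_iff[OF \<Omega>] by blast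
  have d\<phi>: "(\<lambda>x. u x - \<phi> k x) \<in> H1 \<Omega>" for k
    using fun_subspace_diff[OF fun_subspace_H1 u1] \<phi>(1) test_functions_H1 by blast
  {
    fix v assume "v \<in> H10 \<Omega>"
    then obtain \<psi> :: "nat \<Rightarrow> _" where \<psi>: "\<And>k. \<psi> k \<in> test_functions \<Omega>"
      "(\<lambda>k. H1_inner \<Omega> (\<lambda>x. v x - \<psi> k x) (\<lambda>x. v x - \<psi> k x)) \<longlonglongrightarrow> 0" and v1: "v \<in> H1 \<Omega>"
      unfolding H10_iff[OF \<Omega>] by blast
    have d\<psi>: "(\<lambda>x. v x - \<psi> k x) \<in> H1 \<Omega>" for k
      using fun_subspace_diff[OF fun_subspace_H1 v1] \<psi>(1) test_functions_H1 by blast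
    let ?d = "\<lambda>k x. (u x + v x) - (\<phi> k x + \<psi> k x)"
    have d_eq: "?d k = (\<lambda>x. (u x - \<phi> k x) + (v x - \<psi> k x))" for k by auto
    have lim: "(\<lambda>k. 2 * H1_inner \<Omega> (\<lambda>x. u x - \<phi> k x) (\<lambda>x. u x - \<phi> k x) +
        2 * H1_inner \<Omega> (\<lambda>x. v x - \<psi> k x) (\<lambda>x. v x - \<psi> k x)) \<longlonglongrightarrow> 2 * 0 + 2 * 0"
      by (intro tendsto_intros \<phi> \<psi>)
    have "(\<lambda>k. H1_inner \<Omega> (?d k) (?d k)) \<longlonglongrightarrow> 0"
    proof (rule tendsto_sandwich[OF _ _ tendsto_const])
      show "\<forall>\<^sub>F k in sequentially. 0 \<le> H1_inner \<Omega> (?d k) (?d k)"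
        by (simp add: H1_inner_def L2_inner_nonneg)
      show "\<forall>\<^sub>F k in sequentially. H1_inner \<Omega> (?d k) (?d k) \<le>
          2 * H1_inner \<Omega> (\<lambda>x. u x - \<phi> k x) (\<lambda>x. u x - \<phi> k x) +
          2 * H1_inner \<Omega> (\<lambda>x. v x - \<psi> k x) (\<lambda>x. v x - \<psi> k x)"
        unfolding d_eq by (intro always_eventually allI psd_form_add_le[OF fun_subspace_H1 form d\<phi> d\<psi>])
    qed (use lim in simp)
    then show "(\<lambda>x. u x + v x) \<in> H10 \<Omega>"
      unfolding H10_iff[OF \<Omega>] using H(2)[OF u1 v1] T(2)[OF \<phi>(1) \<psi>(1)]
      by (intro conjI exI[of _ "\<lambda>k x. \<phi> k x + \<psi> k x"]) auto
  }
  fix c :: real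
  have "H1_inner \<Omega> (\<lambda>x. c *\<^sub>R u x - c *\<^sub>R \<phi> k x) (\<lambda>x. c *\<^sub>R u x - c *\<^sub>R \<phi> k x) =
      c\<^sup>2 * H1_inner \<Omega> (\<lambda>x. u x - \<phi> k x) (\<lambda>x. u x - \<phi> k x)" for k
    using psd_formD(2)[OF form d\<phi>[of k] H(3)[OF d\<phi>[of k]], of c c]
      psd_form_right(2)[OF fun_subspace_H1 form d\<phi>[of k] d\<phi>[of k], of c]
    by (simp only: scaleR_diff_right[symmetric] power2_eq_square mult.assoc)
  moreover have "(\<lambda>k. c\<^sup>2 * H1_inner \<Omega> (\<lambda>x. u x - \<phi> k x) (\<lambda>x. u x - \<phi> k x)) \<longlonglongrightarrow> c\<^sup>2 * 0"
    by (intro tendsto_intros \<phi>)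
  ultimately show "(\<lambda>x. c *\<^sub>R u x) \<in> H10 \<Omega>"
    unfolding H10_iff[OF \<Omega>] using H(3)[OF u1, of c] T(3)[OF \<phi>(1), of c]
    by (intro conjI exI[of _ "\<lambda>k x. c *\<^sub>R \<phi> k x"]) auto
qed

section \<open>Linearity of the finite-element spaces\<close>

lemma fun_subspace_Int: "fun_subspace S \<Longrightarrow> fun_subspace T \<Longrightarrow> fun_subspace (S \<inter> T)"
  by (simp add: fun_subspace_def)

lemma fun_subspace_components:
  fixes S :: "('a \<Rightarrow> real) set"
  assumes "fun_subspace S"
  shows "fun_subspace {v :: 'a \<Rightarrow> real^'m. \<forall>i. (\<lambda>x. v x $ i) \<in> S}"
  using assms by (simp add: fun_subspace_def)

lemma fun_subspace_P1: "fun_subspace (P1 \<T>)"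
  unfolding fun_subspace_def
proof (intro conjI ballI allI)
  show "(\<lambda>_. 0) \<in> P1 \<T>" by (auto simp: P1_def intro!: exI[of _ 0])
  fix u assume u: "u \<in> P1 \<T>"
  show "(\<lambda>x. c *\<^sub>R u x) \<in> P1 \<T>" for c
    unfolding P1_def
  proof (intro CollectI conjI ballI allI impI)
    show "continuous_on UNIV (\<lambda>x. c *\<^sub>R u x)" using u by (auto simp: P1_def intro!: continuous_intros)
    fix T assume "T \<in> \<T>"
    then obtain a b where "\<forall>x\<in>T. u x = a \<bullet> x + b" using u unfolding P1_def by blast
    then show "\<exists>a b. \<forall>x\<in>T. c *\<^sub>R u x = a \<bullet> x + b"
      by (intro exI[of _ "c *\<^sub>R a"] exI[of _ "c * b"]) (simp add: distrib_left)
  qed (use u in \<open>simp add: P1_def\<close>)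
  fix v assume v: "v \<in> P1 \<T>"
  show "(\<lambda>x. u x + v x) \<in> P1 \<T>"
    unfolding P1_def
  proof (intro CollectI conjI ballI allI impI)
    show "continuous_on UNIV (\<lambda>x. u x + v x)" using u v by (auto simp: P1_def intro!: continuous_intros)
    fix T assume T: "T \<in> \<T>"
    obtain a b where "\<forall>x\<in>T. u x = a \<bullet> x + b" using T u unfolding P1_def by blast
    moreover obtain a' b' where "\<forall>x\<in>T. v x = a' \<bullet> x + b'" using T v unfolding P1_def by blast
    ultimately show "\<exists>a b. \<forall>x\<in>T. u x + v x = a \<bullet> x + b"
      by (intro exI[of _ "a + a'"] exI[of _ "b + b'"]) (simp add: inner_add_left)
  qed (use u v in \<open>simp add: P1_def\<close>)
qed

lemma fun_subspace_disp_space: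
  assumes \<Omega>: "open \<Omega>" "bounded \<Omega>"
  shows "fun_subspace (disp_space elt \<Omega> \<T>)"
proof -
  have P: "fun_subspace (P1_vec \<T>)"
    unfolding P1_vec_def by (rule fun_subspace_components[OF fun_subspace_P1])
  have H: "fun_subspace (H10_vec \<Omega>)"
    unfolding H10_vec_def by (rule fun_subspace_components[OF fun_subspace_H10[OF \<Omega>]])
  let ?f = "\<lambda>w c x. w x + (\<Sum>T\<in>\<T>. bubble T x *\<^sub>R c T)"
  let ?M = "{?f w c | w c. w \<in> P1_vec \<T>}"
  have "fun_subspace ?M"
    unfolding fun_subspace_def
  proof (intro conjI ballI allI)
    show "(\<lambda>_. 0) \<in> ?M"
      using fun_subspaceD(1)[OF P] by (intro CollectI exI[of _ "\<lambda>_. 0"]) auto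
    fix u assume "u \<in> ?M"
    then obtain w c where u: "u = ?f w c" "w \<in> P1_vec \<T>" by blast
    have "(\<lambda>x. r *\<^sub>R u x) = ?f (\<lambda>x. r *\<^sub>R w x) (\<lambda>T. r *\<^sub>R c T)" for r
      unfolding u(1) by (simp add: scaleR_add_right scaleR_sum_right mult.commute)
    then show "(\<lambda>x. r *\<^sub>R u x) \<in> ?M" for r
      using fun_subspaceD(3)[OF P u(2), of r]
      by (intro CollectI exI[of _ "\<lambda>x. r *\<^sub>R w x"] exI[of _ "\<lambda>T. r *\<^sub>R c T"] conjI)
    fix v assume "v \<in> ?M"
    then obtain w' c' where v: "v = ?f w' c'" "w' \<in> P1_vec \<T>" by blast
    have "(\<lambda>x. u x + v x) = ?f (\<lambda>x. w x + w' x) (\<lambda>T. c T + c' T)"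
      unfolding u(1) v(1) by (simp add: scaleR_add_right sum.distrib add_ac)
    then show "(\<lambda>x. u x + v x) \<in> ?M"
      using fun_subspaceD(2)[OF P u(2) v(2)]
      by (intro CollectI exI[of _ "\<lambda>x. w x + w' x"] exI[of _ "\<lambda>T. c T + c' T"] conjI)
  qed
  then show ?thesis using P H by (cases elt) (auto intro: fun_subspace_Int)
qed

lemma disp_space_subset: "disp_space elt \<Omega> \<T> \<subseteq> H10_vec \<Omega>"
  by (cases elt) auto

lemma fun_subspace_pres_space:
  assumes "open \<Omega>" "bounded \<Omega>"
  shows "fun_subspace (pres_space \<Omega> \<T>)"
  unfolding pres_space_def by (intro fun_subspace_Int fun_subspace_P1 fun_subspace_H10 assms)

lemma pres_space_subset: "pres_space \<Omega> \<T> \<subseteq> H1 \<Omega>"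
  by (auto simp: pres_space_def H10_def)

section \<open>Jacobian, divergence and symmetric gradient: linearity and pointwise
  inequalities\<close>

lemma ae_linear_jac:
  fixes \<Omega> :: "(real^'n) set"
  assumes \<Omega>: "open \<Omega>" "bounded \<Omega>"
  shows "ae_linear \<Omega> (H10_vec \<Omega>) (jac \<Omega>)"
proof -
  let ?g = "\<lambda>i v. weak_grad \<Omega> (\<lambda>y. v y $ i)"
  have comp: "(\<lambda>y. v y $ i) \<in> H1 \<Omega>" if "v \<in> H10_vec \<Omega>" for v i
    using that by (auto simp: H10_vec_def H10_def)
  note g = ae_linear_weak_grad[OF \<Omega>, unfolded ae_linear_def]
  have L2: "L2 \<Omega> (jac \<Omega> v)" if "v \<in> H10_vec \<Omega>" for v
    unfolding jac_def[abs_def] using g comp[OF that] by (intro L2_vec) blast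
  have "AE x in lborel. x \<in> \<Omega> \<longrightarrow> jac \<Omega> (\<lambda>x. u x + v x) x = jac \<Omega> u x + jac \<Omega> v x"
    if uv: "u \<in> H10_vec \<Omega>" "v \<in> H10_vec \<Omega>" for u v
  proof -
    have "AE x in lborel. x \<in> \<Omega> \<longrightarrow> ?g i (\<lambda>x. u x + v x) x = ?g i u x + ?g i v x" for i
      using g comp[OF uv(1), of i] comp[OF uv(2), of i] by simp
    then have "AE x in lborel. \<forall>i. x \<in> \<Omega> \<longrightarrow> ?g i (\<lambda>x. u x + v x) x = ?g i u x + ?g i v x"
      unfolding AE_all_countable by blast
    then show ?thesis by eventually_elim (simp add: jac_def vec_eq_iff)
  qed
  moreover have "AE x in lborel. x \<in> \<Omega> \<longrightarrow> jac \<Omega> (\<lambda>x. c *\<^sub>R u x) x = c *\<^sub>R jac \<Omega> u x"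
    if u: "u \<in> H10_vec \<Omega>" for c u
  proof -
    have "AE x in lborel. x \<in> \<Omega> \<longrightarrow> ?g i (\<lambda>x. c *\<^sub>R u x) x = c *\<^sub>R ?g i u x" for i
      using g comp[OF u, of i] by simp
    then have "AE x in lborel. \<forall>i. x \<in> \<Omega> \<longrightarrow> ?g i (\<lambda>x. c *\<^sub>R u x) x = c *\<^sub>R ?g i u x"
      unfolding AE_all_countable by blast
    then show ?thesis by eventually_elim (simp add: jac_def vec_eq_iff)
  qed
  ultimately show ?thesis using L2 by (simp add: ae_linear_def)
qed

lemma bounded_linear_trace: "bounded_linear (trace :: real^'n^'n \<Rightarrow> real)"
  by (intro linear_conv_bounded_linear[THEN iffD1] linearI)
    (simp_all add: trace_def sum.distrib sum_distrib_left)

lemma bounded_linear_sym: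
  "bounded_linear (\<lambda>J :: real^'n^'n. (1/2) *\<^sub>R (J + transpose J))"
  by (intro linear_conv_bounded_linear[THEN iffD1] linearI)
    (simp_all add: transpose_def vec_eq_iff algebra_simps)

lemma ae_linear_dvg:
  assumes "open \<Omega>" "bounded \<Omega>"
  shows "ae_linear \<Omega> (H10_vec \<Omega>) (dvg \<Omega>)"
  using ae_linear_compose[OF bounded_linear_trace ae_linear_jac[OF assms]]
  by (simp add: dvg_def[abs_def])

lemma ae_linear_sym_grad:
  assumes "open \<Omega>" "bounded \<Omega>"
  shows "ae_linear \<Omega> (H10_vec \<Omega>) (sym_grad \<Omega>)"
  using ae_linear_compose[OF bounded_linear_sym ae_linear_jac[OF assms]]
  by (simp add: sym_grad_def[abs_def])

text \<open>The Cauchy-Schwarz inequality on the diagonal. Applied to the symmetric gradient it is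
  the origin of 2 \<mu> / d in \<zeta>.\<close>

lemma trace_power2_le:
  fixes J :: "real^'n^'n"
  shows "(trace J)\<^sup>2 \<le> real CARD('n) * (J \<bullet> J)"
proof -
  have "(trace J)\<^sup>2 \<le> (\<Sum>i\<in>UNIV. (J $ i $ i)\<^sup>2) * real CARD('n)"
    unfolding trace_def by (rule sum_squared_le_sum_of_squares)
  also have "(\<Sum>i\<in>UNIV. (J $ i $ i)\<^sup>2) \<le> J \<bullet> J"
    unfolding inner_vec_def
    by (intro sum_mono) (simp add: power2_eq_square member_le_sum[of _ UNIV "\<lambda>j. J $ _ $ j * J $ _ $ j"])
  finally show ?thesis by (simp add: mult.commute mult_left_mono)
qed

lemma trace_transpose: "trace (transpose J) = trace J"
  by (simp add: trace_def transpose_def)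

lemma dvg_sym_grad: "dvg \<Omega> v x = trace (sym_grad \<Omega> v x)"
proof -
  interpret bounded_linear "trace :: real^'n^'n \<Rightarrow> real" by (rule bounded_linear_trace)
  show ?thesis by (simp add: dvg_def sym_grad_def scaleR add trace_transpose)
qed

lemma inner_transpose: "transpose J \<bullet> transpose J = J \<bullet> (J :: real^'n^'n)"
  unfolding inner_vec_def transpose_def by simp (rule sum.swap)

text \<open>Symmetrization is an orthogonal projection for the Frobenius product; the proof expands
  the square of the antisymmetric part.\<close>

lemma sym_inner_le:
  fixes J :: "real^'n^'n"
  shows "((1/2) *\<^sub>R (J + transpose J)) \<bullet> ((1/2) *\<^sub>R (J + transpose J)) \<le> J \<bullet> J"
proof -
  have "0 \<le> (J - transpose J) \<bullet> (J - transpose J)" by simp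
  then show ?thesis
    by (simp add: inner_diff_left inner_diff_right inner_add_left inner_add_right inner_transpose inner_commute)
qed

section \<open>Bounds for the Biot system\<close>

lemma psd_form_a_form:
  assumes \<Omega>: "open \<Omega>" "bounded \<Omega>" and V: "fun_subspace V" "V \<subseteq> H10_vec \<Omega>" and "0 \<le> lam" "0 < \<mu>"
  shows "psd_form V (a_form \<Omega> lam \<mu>)"
proof -
  have m: "\<Omega> \<in> sets lborel" using \<Omega>(1) by simp
  show ?thesis
    unfolding a_form_def[abs_def]
    using psd_form_sum[OF psd_form_ae_linear[OF V(1) m ae_linear_mono[OF ae_linear_sym_grad[OF \<Omega>] V(2)]]
        psd_form_ae_linear[OF V(1) m ae_linear_mono[OF ae_linear_dvg[OF \<Omega>] V(2)]], of "2 * \<mu>" lam]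
      assms(5,6) by simp
qed

text \<open>The divergence is the trace of the symmetric gradient, so the \<mu> term controls it as
  well, with the weight 2 \<mu> / d.\<close>

lemma a_form_ge:
  fixes \<Omega> :: "(real^'n) set"
  assumes \<Omega>: "open \<Omega>" "bounded \<Omega>" and v: "v \<in> H10_vec \<Omega>" and \<mu>: "0 < \<mu>"
  shows "(lam + 2 * \<mu> / real CARD('n)) * L2_inner \<Omega> (dvg \<Omega> v) (dvg \<Omega> v) \<le> a_form \<Omega> lam \<mu> v v"
proof -
  let ?d = "real CARD('n)"
  have "L2_inner \<Omega> (dvg \<Omega> v) (dvg \<Omega> v) \<le> ?d * L2_inner \<Omega> (sym_grad \<Omega> v) (sym_grad \<Omega> v)"
    using ae_linear_L2[OF ae_linear_dvg[OF \<Omega>] v] ae_linear_L2[OF ae_linear_sym_grad[OF \<Omega>] v]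
  proof (rule L2_inner_mono)
    fix x show "dvg \<Omega> v x \<bullet> dvg \<Omega> v x \<le> ?d * (sym_grad \<Omega> v x \<bullet> sym_grad \<Omega> v x)"
      using trace_power2_le[of "sym_grad \<Omega> v x"] by (simp add: dvg_sym_grad power2_eq_square)
  qed
  then have "2 * \<mu> / ?d * L2_inner \<Omega> (dvg \<Omega> v) (dvg \<Omega> v) \<le>
      2 * \<mu> / ?d * (?d * L2_inner \<Omega> (sym_grad \<Omega> v) (sym_grad \<Omega> v))"
    using \<mu> by (intro mult_left_mono) auto
  then show ?thesis by (simp add: a_form_def distrib_right)
qed

text \<open>The counterpart of \<open>a_form_ge\<close> with the same weight: only the factor d is
  lost, so the inf-sup condition passes from the H1 norm to the energy norm uniformly in \<lambda>
  and \<mu>.\<close>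

lemma a_form_le:
  fixes \<Omega> :: "(real^'n) set"
  assumes \<Omega>: "open \<Omega>" "bounded \<Omega>" and v: "v \<in> H10_vec \<Omega>" and "0 \<le> lam" "0 < \<mu>"
  shows "a_form \<Omega> lam \<mu> v v \<le> real CARD('n) * (lam + 2 * \<mu> / real CARD('n)) * (H1_norm_vec \<Omega> v)\<^sup>2"
proof -
  let ?d = "real CARD('n)" and ?J = "L2_inner \<Omega> (jac \<Omega> v) (jac \<Omega> v)"
  note L2 = ae_linear_L2[OF ae_linear_jac[OF \<Omega>] v]
  have "L2_inner \<Omega> (dvg \<Omega> v) (dvg \<Omega> v) \<le> ?d * ?J"
    using ae_linear_L2[OF ae_linear_dvg[OF \<Omega>] v] L2
  proof (rule L2_inner_mono)
    fix x show "dvg \<Omega> v x \<bullet> dvg \<Omega> v x \<le> ?d * (jac \<Omega> v x \<bullet> jac \<Omega> v x)"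
      using trace_power2_le[of "jac \<Omega> v x"] by (simp add: dvg_def power2_eq_square)
  qed
  then have 1: "lam * L2_inner \<Omega> (dvg \<Omega> v) (dvg \<Omega> v) \<le> lam * (?d * ?J)"
    using \<open>0 \<le> lam\<close> by (rule mult_left_mono)
  have "L2_inner \<Omega> (sym_grad \<Omega> v) (sym_grad \<Omega> v) \<le> 1 * ?J"
    using ae_linear_L2[OF ae_linear_sym_grad[OF \<Omega>] v] L2
  proof (rule L2_inner_mono)
    fix x show "sym_grad \<Omega> v x \<bullet> sym_grad \<Omega> v x \<le> 1 * (jac \<Omega> v x \<bullet> jac \<Omega> v x)"
      using sym_inner_le[of "jac \<Omega> v x"] by (simp only: sym_grad_def mult_1)
  qed
  then have 2: "2 * \<mu> * L2_inner \<Omega> (sym_grad \<Omega> v) (sym_grad \<Omega> v) \<le> 2 * \<mu> * (1 * ?J)"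
    using \<open>0 < \<mu>\<close> by (intro mult_left_mono) auto
  have "a_form \<Omega> lam \<mu> v v \<le> ?d * (lam + 2 * \<mu> / ?d) * ?J"
    using 1 2 by (simp add: a_form_def algebra_simps)
  also have "\<dots> \<le> ?d * (lam + 2 * \<mu> / ?d) * (H1_norm_vec \<Omega> v)\<^sup>2"
    using \<open>0 \<le> lam\<close> \<open>0 < \<mu>\<close>
    by (intro mult_left_mono) (simp_all add: H1_norm_vec_def L2_norm_power2[symmetric] L2_inner_nonneg)
  finally show ?thesis .
qed

lemma weak_inf_sup_le:
  assumes "weak_inf_sup \<Omega> V Q h \<gamma> \<xi>" "p \<in> Q" "0 \<le> R"
    and le: "\<And>v. v \<in> V \<Longrightarrow> L2_inner \<Omega> (dvg \<Omega> v) p \<le> R * H1_norm_vec \<Omega> v"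
  shows "\<gamma> * L2_norm \<Omega> p \<le> R + \<xi> * h * L2_norm \<Omega> (weak_grad \<Omega> p)"
proof -
  have "ereal (\<gamma> * L2_norm \<Omega> p - \<xi> * h * L2_norm \<Omega> (weak_grad \<Omega> p)) \<le>
      (SUP v\<in>V - {\<lambda>_. 0}. ereal (L2_inner \<Omega> (dvg \<Omega> v) p / H1_norm_vec \<Omega> v))"
    using assms(1,2) by (simp add: weak_inf_sup_def)
  also have "\<dots> \<le> ereal R"
  proof (rule SUP_least)
    fix v assume "v \<in> V - {\<lambda>_. 0}"
    moreover have "0 \<le> H1_norm_vec \<Omega> v" by (simp add: H1_norm_vec_def)
    \<comment> \<open>A zero norm makes the quotient 0 by the convention on division, and then the
      sign of R decides.\<close>
    ultimately show "ereal (L2_inner \<Omega> (dvg \<Omega> v) p / H1_norm_vec \<Omega> v) \<le> ereal R"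
      using le[of v] \<open>0 \<le> R\<close> by (cases "H1_norm_vec \<Omega> v = 0") (auto simp: divide_le_eq)
  qed
  finally show ?thesis by simp
qed

text \<open>With E = I - H A, the quantity is a(v, v) - a(v, E v), and the Cauchy-Schwarz inequality
  with the norm bound on E controls the second term by a(v, v). If a(v, v) = 0, the quotient
  defining the operator norm says nothing and the Cauchy-Schwarz inequality alone suffices.\<close>

lemma inner_H_le:
  assumes V: "fun_subspace V" and a: "psd_form V (a_form \<Omega> lam \<mu>)" and H: "spd_operator V Hu"
    and \<rho>: "0 \<le> \<rho>" "\<rho> < 1"
    and norm: "Au_op_norm \<Omega> V lam \<mu> (\<lambda>v x. v x - Hu (A_u \<Omega> V lam \<mu> v) x) \<le> ereal \<rho>"
    and v: "v \<in> V"
  shows "A_u \<Omega> V lam \<mu> v (Hu (A_u \<Omega> V lam \<mu> v)) \<le> 2 * a_form \<Omega> lam \<mu> v v"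
proof -
  let ?a = "a_form \<Omega> lam \<mu>" and ?w = "Hu (A_u \<Omega> V lam \<mu> v)"
  let ?e = "\<lambda>x. v x - ?w x"
  have "A_u \<Omega> V lam \<mu> v \<in> dual V"
    unfolding A_u_def by (rule psd_form_dual[OF V a v])
  then have w: "?w \<in> V" by (rule spd_operatorD(1)[OF H])
  then have e: "?e \<in> V" by (rule fun_subspace_diff[OF V v])
  have Aw: "A_u \<Omega> V lam \<mu> v ?w = ?a v ?w" using w by (simp add: A_u_def)
  have vv: "0 \<le> ?a v v" by (rule psd_formD(4)[OF a v])
  show ?thesis
  proof (cases "?a v v = 0")
    case True
    then have "(?a v ?w)\<^sup>2 \<le> 0" using psd_form_Cauchy_Schwarz[OF V a v w] by simp
    then show ?thesis using True Aw by simp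
  next
    case False
    then have "v \<noteq> (\<lambda>_. 0)" using psd_formD(2)[OF a v v, of 0] by auto
    then have "ereal (Au_norm \<Omega> lam \<mu> ?e / Au_norm \<Omega> lam \<mu> v) \<le>
        Au_op_norm \<Omega> V lam \<mu> (\<lambda>v x. v x - Hu (A_u \<Omega> V lam \<mu> v) x)"
      unfolding Au_op_norm_def using v by (intro SUP_upper) auto
    then have "Au_norm \<Omega> lam \<mu> ?e / Au_norm \<Omega> lam \<mu> v \<le> 1"
      using norm \<rho>(2) by (meson ereal_less_eq(3) less_imp_le order_trans)
    then have ee: "?a ?e ?e \<le> ?a v v"
      using False vv by (simp add: Au_norm_def divide_le_eq)
    have "(?a v ?e)\<^sup>2 \<le> ?a v v * ?a ?e ?e" by (rule psd_form_Cauchy_Schwarz[OF V a v e])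
    also have "\<dots> \<le> ?a v v * ?a v v" using ee vv by (rule mult_left_mono)
    finally have "(?a v ?e)\<^sup>2 \<le> (?a v v)\<^sup>2" by (simp only: power2_eq_square)
    then have "\<bar>?a v ?e\<bar> \<le> ?a v v" using vv by (rule abs_le_of_square_le)
    then have "- ?a v ?e \<le> ?a v v" by (rule abs_le_D2)
    moreover have "?a v ?e = ?a v v - ?a v ?w"
      using psd_form_diff[OF V a v w v] unfolding psd_formD(3)[OF a e v] psd_formD(3)[OF a w v] .
    ultimately show ?thesis unfolding Aw by linarith
  qed
qed

text \<open>Here \<zeta> stands for \<lambda> + 2 \<mu> / d itself, the square of the \<zeta> in the
  final statement. The inf-sup constants obtained contain only d, \<gamma>, \<xi> and \<delta>,
  which is the source of robustness.\<close>

lemma biot_saddle_point: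
  fixes \<Omega> :: "(real^'n) set" and K :: real
  assumes \<zeta>_def: "\<zeta> = lam + 2 * \<mu> / real CARD('n)"
    and \<Omega>: "open \<Omega>" "bounded \<Omega>"
    and V: "fun_subspace V" "V \<subseteq> H10_vec \<Omega>" and Q: "fun_subspace Q" "Q \<subseteq> H1 \<Omega>"
    and const: "0 < \<gamma>" "0 \<le> \<xi>" "0 < \<delta>" "0 \<le> \<rho>" "\<rho> < 1" "0 < c1u" "0 < c2u" "0 < c1p" "0 < c2p"
    and par: "0 \<le> lam" "0 < \<mu>" "0 < \<alpha>" "0 < K" "0 < h" "0 < \<tau>" and \<eta>: "\<eta> = \<delta> * (\<alpha>\<^sup>2 / \<zeta>)"
    and inf_sup: "weak_inf_sup \<Omega> V Q h \<gamma> \<xi>"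
    and Hu: "spd_operator V Hu" and Hp: "spd_operator Q Hp"
    and u_bounds: "\<forall>f\<in>dual V. c1u * f (Hu f) \<le> f (inv_into V (A_u \<Omega> V lam \<mu>) f) \<and>
      f (inv_into V (A_u \<Omega> V lam \<mu>) f) \<le> c2u * f (Hu f)"
    and p_bounds: "\<forall>g\<in>dual Q. c1p * g (Hp g) \<le> g (inv_into Q Cp g) \<and> g (inv_into Q Cp g) \<le> c2p * g (Hp g)"
    and norm: "Au_op_norm \<Omega> V lam \<mu> (\<lambda>v x. v x - Hu (A_u \<Omega> V lam \<mu> v) x) \<le> ereal \<rho>"
  defines "s \<equiv> \<lambda>p q. \<tau> * ap_form \<Omega> K p q + \<eta> * h\<^sup>2 * L2_inner \<Omega> (weak_grad \<Omega> p) (weak_grad \<Omega> q)"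
    and "k \<equiv> \<lambda>p q. \<alpha>\<^sup>2 / \<zeta> * L2_inner \<Omega> p q"
    and "\<beta> \<equiv> \<lambda>v q. \<alpha> * L2_inner \<Omega> (dvg \<Omega> v) q"
  assumes Cp: "\<And>p. p \<in> Q \<Longrightarrow> Cp p = (\<lambda>q\<in>Q. s p q + k p q)"
    and A: "\<And>u p. u \<in> V \<Longrightarrow> p \<in> Q \<Longrightarrow>
      A (u, p) = (\<lambda>v\<in>V. a_form \<Omega> lam \<mu> u v - \<beta> v p, \<lambda>q\<in>Q. \<beta> u q + s p q)"
    and L: "\<And>u p. u \<in> V \<Longrightarrow> p \<in> Q \<Longrightarrow>
      L (u, p) = (inv_into (dual V) Hu u, \<lambda>q\<in>Q. \<beta> u q + inv_into (dual Q) Hp p q)"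
  shows "preconditioned_saddle_point V (a_form \<Omega> lam \<mu>) (A_u \<Omega> V lam \<mu>) Hu c1u c2u
    Q (\<lambda>p q. s p q + k p q) Cp Hp c1p c2p s k \<beta>
    (2 * real CARD('n) / \<gamma>\<^sup>2) (2 * \<xi>\<^sup>2 / (\<delta> * \<gamma>\<^sup>2)) A L"
proof -
  let ?d = "real CARD('n)"
  have \<Omega>': "\<Omega> \<in> sets lborel" using \<Omega>(1) by simp
  have \<zeta>: "0 < \<zeta>" using par by (simp add: \<zeta>_def add_nonneg_pos)
  have \<eta>': "0 < \<eta>" using \<eta> const par \<zeta> by simp
  have \<kappa>: "0 < \<alpha>\<^sup>2 / \<zeta>" using par \<zeta> by simp
  note grad = ae_linear_mono[OF ae_linear_weak_grad[OF \<Omega>] Q(2)]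
    and dvg = ae_linear_mono[OF ae_linear_dvg[OF \<Omega>] V(2)]
  have Q_L2: "L2 \<Omega> q" if "q \<in> Q" for q using that Q(2) H1D(1) by blast
  have a: "psd_form V (a_form \<Omega> lam \<mu>)" by (rule psd_form_a_form[OF \<Omega> V par(1,2)])
  have gg: "psd_form Q (\<lambda>p q. L2_inner \<Omega> (weak_grad \<Omega> p) (weak_grad \<Omega> q))"
    by (rule psd_form_ae_linear[OF Q(1) \<Omega>' grad])
  have s_eq: "s = (\<lambda>p q. \<tau> * K * L2_inner \<Omega> (weak_grad \<Omega> p) (weak_grad \<Omega> q) +
      \<eta> * h\<^sup>2 * L2_inner \<Omega> (weak_grad \<Omega> p) (weak_grad \<Omega> q))"
    by (simp add: s_def ap_form_def L2_inner_scale mult.assoc)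
  have s: "psd_form Q s"
    unfolding s_eq using par \<eta>' by (intro psd_form_sum gg) auto
  have m: "psd_form Q (L2_inner \<Omega>)"
    using psd_form_ae_linear[OF Q(1) \<Omega>' ae_linear_id[OF Q(2)]] .
  \<comment> \<open>A second summand of weight 0 gives the scaled mass form the shape of
    \<open>psd_form_sum\<close>.\<close>
  have "psd_form Q (\<lambda>p q. \<alpha>\<^sup>2 / \<zeta> * L2_inner \<Omega> p q + 0 * L2_inner \<Omega> p q)"
    using \<kappa> by (intro psd_form_sum m) auto
  then have k: "psd_form Q k" by (simp add: k_def)
  have sk: "psd_form Q (\<lambda>p q. s p q + k p q)"
    using psd_form_sum[OF s k, of 1 1] by simp
  have beta_left: "(\<lambda>v\<in>V. \<beta> v q) \<in> dual V" if q: "q \<in> Q" for q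
    by (rule dualI[OF V(1)])
      (simp_all add: \<beta>_def ae_linear_inner[OF V(1) \<Omega>' dvg Q_L2[OF q]] distrib_left)
  have beta_right: "(\<lambda>q\<in>Q. \<beta> v q) \<in> dual Q" if v: "v \<in> V" for v
  proof (rule dualI[OF Q(1)])
    note L2v = ae_linear_L2[OF dvg v]
    show "\<beta> v (\<lambda>x. p x + q x) = \<beta> v p + \<beta> v q" if "p \<in> Q" "q \<in> Q" for p q
      using L2_inner_add[OF Q_L2[OF that(1)] Q_L2[OF that(2)] L2v]
      by (simp add: \<beta>_def L2_inner_commute[of \<Omega> "dvg \<Omega> v"] distrib_left)
    show "\<beta> v (\<lambda>x. c *\<^sub>R q x) = c * \<beta> v q" for c q
      using L2_inner_scale[of \<Omega> c q "dvg \<Omega> v"]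
      by (simp add: \<beta>_def L2_inner_commute[of \<Omega> "dvg \<Omega> v"])
  qed
  have beta_le: "(\<beta> v q)\<^sup>2 \<le> a_form \<Omega> lam \<mu> v v * k q q" if v: "v \<in> V" and q: "q \<in> Q" for v q
  proof -
    let ?D = "L2_inner \<Omega> (dvg \<Omega> v) (dvg \<Omega> v)"
    have "(\<beta> v q)\<^sup>2 \<le> \<alpha>\<^sup>2 * (?D * L2_inner \<Omega> q q)"
      unfolding \<beta>_def power_mult_distrib
      using L2_Cauchy_Schwarz[OF ae_linear_L2[OF dvg v] Q_L2[OF q]] by (rule mult_left_mono) simp
    also have "\<dots> = \<zeta> * ?D * k q q" using \<zeta> by (simp add: k_def)
    also have "\<dots> \<le> a_form \<Omega> lam \<mu> v v * k q q"
      using a_form_ge[OF \<Omega> _ par(2), of v lam] v V(2) psd_formD(4)[OF k q]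
      unfolding \<zeta>_def by (intro mult_right_mono) auto
    finally show ?thesis .
  qed
  have stable: "k p p \<le> 2 * ?d / \<gamma>\<^sup>2 * X + 2 * \<xi>\<^sup>2 / (\<delta> * \<gamma>\<^sup>2) * s p p"
    if p: "p \<in> Q" and X: "0 \<le> X" and bound: "\<And>v. v \<in> V \<Longrightarrow> (\<beta> v p)\<^sup>2 \<le> X * a_form \<Omega> lam \<mu> v v" for p X
  proof -
    let ?P = "L2_norm \<Omega> p" and ?G = "L2_norm \<Omega> (weak_grad \<Omega> p)"
    \<comment> \<open>(div v, p) is \<beta>(v, p) / \<alpha>, at most sqrt(X a(v, v)) / \<alpha>,
      and by \<open>a_form_le\<close> the energy a(v, v) is at most d \<zeta> times the squared H1
      norm.\<close>
    define R where "R = sqrt (X * ?d * \<zeta>) / \<alpha>"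
    have R0: "0 \<le> R" using X \<zeta> par by (simp add: R_def)
    have R2: "R\<^sup>2 = X * ?d * \<zeta> / \<alpha>\<^sup>2" using X \<zeta> by (simp add: R_def power_divide)
    have "\<gamma> * ?P \<le> R + \<xi> * h * ?G"
    proof (rule weak_inf_sup_le[OF inf_sup p R0])
      fix v assume v: "v \<in> V"
      let ?N = "H1_norm_vec \<Omega> v"
      have "(\<beta> v p)\<^sup>2 \<le> X * (?d * \<zeta> * ?N\<^sup>2)"
        using bound[OF v] mult_left_mono[OF a_form_le[OF \<Omega> _ par(1,2), of v] X] v V(2)
        unfolding \<zeta>_def by force
      also have "\<dots> = (\<alpha> * (R * ?N))\<^sup>2"
        unfolding power_mult_distrib R2 using par(3) by simp
      finally have "\<bar>\<beta> v p\<bar> \<le> \<bar>\<alpha> * (R * ?N)\<bar>" by (simp add: abs_le_square_iff)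
      moreover have "0 \<le> ?N" by (simp add: H1_norm_vec_def)
      then have "0 \<le> \<alpha> * (R * ?N)" using R0 par(3) by simp
      ultimately have "\<alpha> * L2_inner \<Omega> (dvg \<Omega> v) p \<le> \<alpha> * (R * ?N)"
        by (simp only: \<beta>_def)
      then show "L2_inner \<Omega> (dvg \<Omega> v) p \<le> R * ?N" using par(3) by simp
    qed
    moreover have "0 \<le> ?P" by (simp add: L2_norm_def L2_inner_nonneg)
    ultimately have "(\<gamma> * ?P)\<^sup>2 \<le> (R + \<xi> * h * ?G)\<^sup>2" using const(1) by (intro power_mono) auto
    also have "\<dots> \<le> 2 * R\<^sup>2 + 2 * (\<xi> * h * ?G)\<^sup>2"
      using zero_le_power2[of "R - \<xi> * h * ?G"] by (simp add: power2_sum power2_diff)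
    \<comment> \<open>This weight turns the left side into k(p, p) and 2 R^2 into the X term. Since
      \<alpha>^2 / \<zeta> = \<eta> / \<delta>, it turns the defect into the stabilization term with
      a factor free of physical parameters.\<close>
    finally have "\<alpha>\<^sup>2 / \<zeta> / \<gamma>\<^sup>2 * (\<gamma> * ?P)\<^sup>2 \<le> \<alpha>\<^sup>2 / \<zeta> / \<gamma>\<^sup>2 * (2 * R\<^sup>2 + 2 * (\<xi> * h * ?G)\<^sup>2)"
      using \<zeta> by (intro mult_left_mono) auto
    moreover have "\<alpha>\<^sup>2 / \<zeta> / \<gamma>\<^sup>2 * (\<gamma> * ?P)\<^sup>2 = k p p"
      using const(1) by (simp add: k_def power_mult_distrib L2_norm_power2)
    moreover have "\<alpha>\<^sup>2 / \<zeta> / \<gamma>\<^sup>2 * (2 * R\<^sup>2) = 2 * ?d / \<gamma>\<^sup>2 * X"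
      unfolding R2 using const(1) \<zeta> par(3) by (simp add: field_simps)
    moreover have "\<alpha>\<^sup>2 / \<zeta> / \<gamma>\<^sup>2 * (2 * (\<xi> * h * ?G)\<^sup>2) = 2 * \<xi>\<^sup>2 / (\<delta> * \<gamma>\<^sup>2) * (\<eta> * h\<^sup>2 * ?G\<^sup>2)"
      unfolding \<eta> using const(1,3) \<zeta> by (simp add: field_simps)
    moreover have "\<eta> * h\<^sup>2 * ?G\<^sup>2 \<le> s p p"
      using par by (simp add: s_eq L2_norm_power2 L2_inner_nonneg)
    then have "2 * \<xi>\<^sup>2 / (\<delta> * \<gamma>\<^sup>2) * (\<eta> * h\<^sup>2 * ?G\<^sup>2) \<le> 2 * \<xi>\<^sup>2 / (\<delta> * \<gamma>\<^sup>2) * s p p"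
      using const(3) by (intro mult_left_mono) auto
    ultimately show ?thesis by (simp only: distrib_left)
  qed
  have HA: "A_u \<Omega> V lam \<mu> v (Hu (A_u \<Omega> V lam \<mu> v)) \<le> 2 * a_form \<Omega> lam \<mu> v v" if "v \<in> V" for v
    by (rule inner_H_le[OF V(1) a Hu const(4,5) norm that])
  have pV: "preconditioned_form V (a_form \<Omega> lam \<mu>) (A_u \<Omega> V lam \<mu>) Hu c1u c2u"
    by (rule preconditioned_form.intro[OF V(1) a Hu const(6,7)]) (simp add: A_u_def, use u_bounds in blast, use u_bounds in blast)
  have pQ: "preconditioned_form Q (\<lambda>p q. s p q + k p q) Cp Hp c1p c2p"
    by (rule preconditioned_form.intro[OF Q(1) sk Hp const(8,9) Cp]) (assumption, use p_bounds in blast, use p_bounds in blast)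
  have d: "0 \<le> 2 * ?d / \<gamma>\<^sup>2" "0 \<le> 2 * \<xi>\<^sup>2 / (\<delta> * \<gamma>\<^sup>2)" using const by simp_all
  show ?thesis
  proof (rule preconditioned_saddle_point.intro[OF pV pQ], rule preconditioned_saddle_point_axioms.intro)
    show "k p p \<le> 2 * ?d / \<gamma>\<^sup>2 * X + 2 * \<xi>\<^sup>2 / (\<delta> * \<gamma>\<^sup>2) * s p p"
      if "p \<in> Q" "0 \<le> X" "\<And>v. v \<in> V \<Longrightarrow> (\<beta> v p)\<^sup>2 \<le> X * a_form \<Omega> lam \<mu> v v" for p X
      by (rule stable[OF that])
  qed (rule s k refl d | erule (1) beta_le A L | erule beta_left beta_right HA)+
qed

theorem theorem5:
  fixes \<gamma> \<xi> \<delta> \<rho> c1u c2u c1p c2p :: real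
  assumes "CARD('n::finite) \<in> {2, 3}"
    and "\<gamma> > 0" and "\<xi> \<ge> 0" and "\<delta> > 0" and "0 \<le> \<rho>" and "\<rho> < 1"
    and "c1u > 0" and "c2u > 0" and "c1p > 0" and "c2p > 0"
  shows "\<exists>sig>0. \<exists>ups>0.
    \<forall>(\<Omega> :: (real^'n) set) \<T> elt h \<tau> lam \<mu> \<alpha> K \<eta> Hu Hp.
      let V = disp_space elt \<Omega> \<T>;
          Q = pres_space \<Omega> \<T>;
          \<zeta> = sqrt (lam + 2 * \<mu> / real CARD('n));
          Au = A_u \<Omega> V lam \<mu>;
          B = B_op \<Omega> Q;
          BT = BT_op \<Omega> V Q;
          Ap = A_p \<Omega> Q K;
          Lp = L_p \<Omega> Q;
          M = M_p \<Omega> Q;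
          Cp = (\<lambda>p. \<lambda>q\<in>Q. \<tau> * Ap p q + \<eta> * h\<^sup>2 * Lp p q + \<alpha>\<^sup>2 / \<zeta>\<^sup>2 * M p q);
          A = block_op V Q Au (\<lambda>p v. \<alpha> * BT p v)
                (\<lambda>u q. - \<alpha> * B u q) (\<lambda>p q. \<tau> * Ap p q + \<eta> * h\<^sup>2 * Lp p q);
          ML = inv_into (V \<times> Q)
                (block_op V Q (inv_into (dual V) Hu) (\<lambda>p v. 0)
                   (\<lambda>u q. - \<alpha> * B u q) (inv_into (dual Q) Hp));
          MD = map_prod Hu Hp;
          MDinv = inv_into (dual V \<times> dual Q) MD
      in
        open \<Omega> \<and> bounded \<Omega> \<and> lipschitz_boundary \<Omega> \<and>
        lam \<ge> 0 \<and> \<mu> > 0 \<and> \<alpha> > 0 \<and> K > 0 \<and> h > 0 \<and> \<tau> > 0 \<and>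
        mesh \<Omega> h \<T> \<and>
        weak_inf_sup \<Omega> V Q h \<gamma> \<xi> \<and> (elt = Mini \<longrightarrow> \<xi> = 0) \<and>
        spd_operator V Hu \<and> spd_operator Q Hp \<and>
        (\<forall>f\<in>dual V. c1u * f (Hu f) \<le> f (inv_into V Au f) \<and>
                     f (inv_into V Au f) \<le> c2u * f (Hu f)) \<and>
        (\<forall>g\<in>dual Q. c1p * g (Hp g) \<le> g (inv_into Q Cp g) \<and>
                     g (inv_into Q Cp g) \<le> c2p * g (Hp g)) \<and>
        Au_op_norm \<Omega> V lam \<mu> (\<lambda>v x. v x - Hu (Au v) x) \<le> ereal \<rho> \<and>
        \<eta> = \<delta> * (\<alpha>\<^sup>2 / \<zeta>\<^sup>2)
        \<longrightarrow>
        (\<forall>x\<in>V \<times> Q. x \<noteq> (\<lambda>_. 0, \<lambda>_. 0) \<longrightarrow>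
           sig \<le> op_inner MDinv (ML (A x)) x / op_inner MDinv x x \<and>
           op_norm MDinv (ML (A x)) / op_norm MDinv x \<le> ups)"
proof -
  let ?d1 = "2 * real CARD('n) / \<gamma>\<^sup>2" and ?d2 = "2 * \<xi>\<^sup>2 / (\<delta> * \<gamma>\<^sup>2)"
  \<comment> \<open>Both constants are those of \<open>field_of_values_bounds\<close>, fixed before
    domain, mesh and physical parameters enter.\<close>
  define sig where "sig = 1 / (4 * (c2u + c2p * (1 + ?d2) + c2p * ?d1 * c2u))"
  define ups where "ups = sqrt ((2 / c1u + 2 / c1p * (3 + 4 / c1u\<^sup>2)) / min c1u c1p)"
  note const = assms(2-10)
  have sig: "0 < sig"
    unfolding sig_def using const by (intro divide_pos_pos mult_pos_pos add_pos_nonneg) auto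
  have ups: "0 < ups"
    unfolding ups_def using const
    by (intro real_sqrt_gt_zero divide_pos_pos add_pos_nonneg mult_nonneg_nonneg) auto
  show ?thesis
  proof (rule exI[of _ sig], rule conjI[OF sig], rule exI[of _ ups], rule conjI[OF ups],
      intro allI, unfold Let_def, rule impI, goal_cases)
    case (1 \<Omega> \<T> elt h \<tau> lam \<mu> \<alpha> K \<eta> Hu Hp)
    let ?V = "disp_space elt \<Omega> \<T>" and ?Q = "pres_space \<Omega> \<T>"
    let ?\<zeta> = "lam + 2 * \<mu> / real CARD('n)"
    let ?s = "\<lambda>p q. \<tau> * ap_form \<Omega> K p q + \<eta> * h\<^sup>2 * L2_inner \<Omega> (weak_grad \<Omega> p) (weak_grad \<Omega> q)"
    let ?k = "\<lambda>p q. \<alpha>\<^sup>2 / ?\<zeta> * L2_inner \<Omega> p q"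
    let ?\<beta> = "\<lambda>v q. \<alpha> * L2_inner \<Omega> (dvg \<Omega> v) q"
    let ?Cp = "\<lambda>p. \<lambda>q\<in>?Q. \<tau> * A_p \<Omega> ?Q K p q + \<eta> * h\<^sup>2 * L_p \<Omega> ?Q p q +
      \<alpha>\<^sup>2 / (sqrt ?\<zeta>)\<^sup>2 * M_p \<Omega> ?Q p q"
    let ?A = "block_op ?V ?Q (A_u \<Omega> ?V lam \<mu>) (\<lambda>p v. \<alpha> * BT_op \<Omega> ?V ?Q p v)
      (\<lambda>u q. - \<alpha> * B_op \<Omega> ?Q u q) (\<lambda>p q. \<tau> * A_p \<Omega> ?Q K p q + \<eta> * h\<^sup>2 * L_p \<Omega> ?Q p q)"
    let ?L = "block_op ?V ?Q (inv_into (dual ?V) Hu) (\<lambda>p v. 0)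
      (\<lambda>u q. - \<alpha> * B_op \<Omega> ?Q u q) (inv_into (dual ?Q) Hp)"
    have \<Omega>: "open \<Omega>" "bounded \<Omega>"
      and par: "0 \<le> lam" "0 < \<mu>" "0 < \<alpha>" "0 < K" "0 < h" "0 < \<tau>"
      and \<eta>: "\<eta> = \<delta> * (\<alpha>\<^sup>2 / (sqrt ?\<zeta>)\<^sup>2)"
      and inf_sup: "weak_inf_sup \<Omega> ?V ?Q h \<gamma> \<xi>"
      and Hu: "spd_operator ?V Hu" and Hp: "spd_operator ?Q Hp"
      and u_bounds: "\<forall>f\<in>dual ?V. c1u * f (Hu f) \<le> f (inv_into ?V (A_u \<Omega> ?V lam \<mu>) f) \<and>
        f (inv_into ?V (A_u \<Omega> ?V lam \<mu>) f) \<le> c2u * f (Hu f)"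
      and p_bounds: "\<forall>g\<in>dual ?Q. c1p * g (Hp g) \<le> g (inv_into ?Q ?Cp g) \<and>
        g (inv_into ?Q ?Cp g) \<le> c2p * g (Hp g)"
      and norm: "Au_op_norm \<Omega> ?V lam \<mu> (\<lambda>v x. v x - Hu (A_u \<Omega> ?V lam \<mu> v) x) \<le> ereal \<rho>"
      using 1 by - (elim conjE; assumption)+
    note V = fun_subspace_disp_space[OF \<Omega>, of elt \<T>] and Q = fun_subspace_pres_space[OF \<Omega>, of \<T>]
    have \<zeta>: "(sqrt ?\<zeta>)\<^sup>2 = ?\<zeta>" using par by simp
    have Cp: "?Cp p = (\<lambda>q\<in>?Q. ?s p q + ?k p q)" for p
      unfolding \<zeta> by (simp add: A_p_def L_p_def M_p_def cong: restrict_cong)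
    \<comment> \<open>\<open>BT_op\<close> evaluates \<open>B_op\<close> at p, which is meaningful
      only for p in the pressure space.\<close>
    have A: "?A (u, p) = (\<lambda>v\<in>?V. a_form \<Omega> lam \<mu> u v - ?\<beta> v p, \<lambda>q\<in>?Q. ?\<beta> u q + ?s p q)"
      if "p \<in> ?Q" for u p
      using that
      by (simp add: block_op_def A_u_def BT_op_def B_op_def A_p_def L_p_def add.assoc cong: restrict_cong)
    have L: "?L (u, p) = (inv_into (dual ?V) Hu u, \<lambda>q\<in>?Q. ?\<beta> u q + inv_into (dual ?Q) Hp p q)"
      if "u \<in> ?V" for u p
    proof -
      \<comment> \<open>\<open>block_op\<close> restricts its components once more; a preimage in
        the dual is already extensional, so the restriction leaves it unchanged.\<close>
      have "u \<in> Hu ` dual ?V" using spd_operator_bij_betw[OF V Hu] that by (simp add: bij_betw_def)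
      then have "inv_into (dual ?V) Hu u \<in> dual ?V" by (rule inv_into_into)
      then have "(\<lambda>v\<in>?V. inv_into (dual ?V) Hu u v) = inv_into (dual ?V) Hu u"
        using dualD(3) extensional_restrict by blast
      then show ?thesis by (simp add: block_op_def B_op_def cong: restrict_cong)
    qed
    interpret preconditioned_saddle_point ?V "a_form \<Omega> lam \<mu>" "A_u \<Omega> ?V lam \<mu>" Hu c1u c2u
      ?Q "\<lambda>p q. ?s p q + ?k p q" ?Cp Hp c1p c2p ?s ?k ?\<beta> ?d1 ?d2 ?A ?L
      by (rule biot_saddle_point[OF refl \<Omega> V disp_space_subset Q pres_space_subset const par
            \<eta>[unfolded \<zeta>] inf_sup Hu Hp u_bounds p_bounds norm Cp A L])
    show ?case
      unfolding sig_def ups_def using field_of_values_bounds by blast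
  qed
qed

end
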